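(* Let $\Gamma$ be a discrete group acting on a unital C$^*$-algebra $\mathcal A$ through an action $\alpha$. If the action $\alpha$ is amenable, then the reduced crossed product $\mathcal A\rtimes_r\Gamma$ is $\mathcal A$-$\Gamma$-nuclear as an $\mathcal A$-$\Gamma$-module.
   Context: Abbreviations: c.p. = completely positive, c.c.p. = contractive completely positive. $\otimes$ always denotes the minimal tensor product. Setting. $\Gamma$ is a discrete group with identity $e$, acting by automorphisms $\alpha_s$ ($s\in\Gamma$) on a unital C$^*$-algebra $\mathcal A$. In the reduced crossed product $\mathcal A\rtimes_r\Gamma$ we identify $\mathcal A$ and $\Gamma$ with their canonical images, so $sas^{-1}=\alpha_s(a)$ and the elements $as$ ($a\in\mathcal A$, $s\in\Gamma$) are total. Amenable action. $\alpha$ is amenable if there is a net $(T_i)$ of finitely supported functions $T_i:\Gamma\to Z(\mathcal A)^+$ (positive elements of the center) with $\sum_{s\in\Gamma}T_i(s)^2=1$ for all $i$ and, for each $t\in\Gamma$, $\sum_{s\in\Gamma}\big(T_i(s)-\alpha_t(T_i(t^{-1}s))\big)^*\big(T_i(s)-\alpha_t(T_i(t^{-1}s))\big)\to0$ in norm. Notation. $\Gamma^\infty=\bigcup_{n\ge1}\Gamma^n$ (union of all finite Cartesian powers). For $t=(t_1,\dots,t_\ell)\in\Gamma^\infty$ and $r\in\Gamma$ put $\bar t=t_1\cdots t_\ell\in\Gamma$ and $rt=(rt_1,t_2,\dots,t_\ell)$. Let $e_{s,t}$ ($s,t\in\Gamma^\infty$) be the matrix units of $\mathbb B(\ell^2(\Gamma^\infty))$.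 For finite $F\subseteq\Gamma^\infty$, $P_F$ is the orthogonal projection of $\ell^2(\Gamma^\infty)$ onto $\ell^2(F)$, and $\mathbb M_F(\mathcal A)=\mathrm{span}\{a\otimes e_{s,t}:a\in\mathcal A,\ s,t\in F\}\subseteq\mathcal A\otimes\mathbb B(\ell^2(\Gamma^\infty))$. Modules. An operator $\mathcal A$-$\Gamma$-module is an operator system $\mathcal B$ with a $\Gamma$-action $\beta$ by surjective complete isometries and a right $\mathcal A$-module action such that $\beta_t(b\cdot a)=\beta_t(b)\cdot\alpha_t(a)$; when $\mathcal B$ is a C$^*$-algebra, $\Gamma$ is moreover assumed to act by automorphisms. The structures used are as follows. On $\mathcal A\rtimes_r\Gamma$: right multiplication by $\mathcal A$, i.e. $as\cdot b=a\alpha_s(b)s$, and $r\cdot(as)=rasr^{-1}$ for $r\in\Gamma$. On $\mathcal A\otimes\mathbb B(\ell^2(\Gamma^\infty))$: the structures extending $(a\otimes e_{s,t})\cdot b=(a\otimes e_{s,t})\pi(b)=a\alpha_{\bar t^{-1}}(b)\otimes e_{s,t}$, where $\pi(b)=\sum_{s\in\Gamma^\infty}\alpha_{\bar s^{-1}}(b)\otimes e_{s,s}$, and $r\cdot(a\otimes e_{s,t})=U_r(a\otimes e_{s,t})U_r^*=a\otimes e_{rs,rt}$, where $U_r\delta_s=\delta_{rs}$. Each $\mathbb M_F(\mathcal A)$ gets its $\mathcal A$-module structure as a subspace of $\mathcal A\otimes\mathbb B(\ell^2(\Gamma^\infty))$, and $r\cdot\mathbb M_F(\mathcal A)=\mathbb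 M_{rF}(\mathcal A)$. $\mathcal A$-admissible maps. For operator systems $\mathcal B,\mathcal D$ with right $\mathcal A$-module structures, the class of $\mathcal A$-admissible c.p. maps is determined by the rules: (1) every c.p. $\mathcal A$-module map $\mathcal B\to\mathcal D$ is $\mathcal A$-admissible; (2) if $\varphi:\mathcal B\to\mathcal D$ is $\mathcal A$-admissible, so are $x\mapsto\varphi(bxb^* )$ and $x\mapsto d\varphi(x)d^*$ for $b\in\mathcal B$, $d\in\mathcal D$; (3) the maps $x\mapsto\rho(x)d$ with $\rho$ a positive functional on $\mathcal B$ and $d\in\mathcal D^+$ are $\mathcal A$-admissible; (4) compositions, positive multiples and finite sums of $\mathcal A$-admissible maps are $\mathcal A$-admissible. $\Gamma$-families. Let $\mathcal B,\mathcal D$ be operator systems with $\Gamma$-actions $\alpha^{\mathcal B},\alpha^{\mathcal D}$. A $\Gamma$-family of operator subsystems of $\mathcal B$ is a family $\{\mathcal B_i\}_{i\in I}$ with an action of $\Gamma$ on the set $I$ such that $\alpha^{\mathcal B}_t(\mathcal B_i)\subseteq\mathcal B_{t\cdot i}$. A $\Gamma$-family of maps on it is a family of c.p. maps $\psi_i:\mathcal B_i\to\mathcal D$ with $\psi_{t\cdot i}(\alpha^{\mathcal B}_t(b))=\alpha^{\mathcal D}_t(\psi_i(b))$ for $i\in I$, $b\in\mathcal B_i$, $t\in\Gamma$. For $\{\mathbb M_F(\mathcal A)\}_F$ the index set is the set of finite subsets $F\subseteq\Gamma^\infty$ with action $F\mapsto rF$. Admissible families. The class of $\Gamma$-admissible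 families of c.p. maps is determined by the rules: (i) every $\Gamma$-family of maps is $\Gamma$-admissible; (ii) a $\Gamma$-admissible family $\{\psi_i:\mathcal B_i\to\mathcal D\}_{i\in I}$ stays $\Gamma$-admissible if one adds to it a map of one of the forms $x\mapsto\psi_i(bxb^* )$ or $x\mapsto d\psi_i(x)d^*$ ($b\in\mathcal B$, $d\in\mathcal D$), a finite sum of maps in the family, or $x\mapsto\alpha^{\mathcal D}_t(\psi_i(x))$ or $x\mapsto\psi_{t\cdot i}(\alpha^{\mathcal B}_t(x))$ ($t\in\Gamma$); (iii) for $\Gamma$-admissible families $\{\phi_i:\mathcal B_i\to\mathcal D\}$ and $\{\psi_j:\mathcal D_j\to\mathcal C\}$, the family of all compositions $\psi_j\circ\phi_i$ with $\phi_i(\mathcal B_i)\subseteq\mathcal D_j$ is $\Gamma$-admissible; (iv) the union of two $\Gamma$-admissible families is $\Gamma$-admissible. A family is admissible if it is $\Gamma$-admissible and all its members are $\mathcal A$-admissible; a single map is admissible if it belongs to an admissible family. Nuclearity. $\mathcal B=\mathcal A\rtimes_r\Gamma$ is $\mathcal A$-$\Gamma$-nuclear as an $\mathcal A$-$\Gamma$-module if for every $\varepsilon>0$ and finite $S\subseteq\mathcal B$ there are an admissible c.c.p. map $\varphi:\mathcal B\to\mathcal A\otimes\mathbb B(\ell^2(\Gamma^\infty))$ and an admissible family $\{\psi_F:\mathbb M_F(\mathcal A)\to\mathcal B\}_F$ ($F$ ranging over the finite subsets of $\Gamma^\infty$) of c.c.p. maps such that, for some $F$, $\|\psi_F\varphi_F(b)-b\|\le\varepsilon$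 for all $b\in S$, where the c.c.p. admissible map $\varphi_F:\mathcal B\to\mathbb M_F(\mathcal A)$ is $\varphi_F(b)=(1\otimes P_F)\varphi(b)(1\otimes P_F)$.
   Formalization: The right action x·b = xπ(b) on A⊗B(ℓ²(Γ^∞)) can leave that algebra (e.g. 1·b = π(b)), so it is not a module action in general; it is taken as the operator product in a larger algebra, and module maps out of A⊗B(ℓ²(Γ^∞)) need only respect it where x·b stays inside. *)

theory Defs
  imports "HOL-Analysis.Analysis" "HOL-Library.Groups_Big_Fun"
begin

section \<open>Complex vector spaces and C*-algebras\<close>

class complex_vector = real_vector +
  fixes scaleC :: "complex \<Rightarrow> 'a \<Rightarrow> 'a"  (infixr \<open>*\<^sub>C\<close> 75)
  assumes scaleC_add_right: "c *\<^sub>C (x + y) = c *\<^sub>C x + c *\<^sub>C y"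
    and scaleC_add_left: "(c + d) *\<^sub>C x = c *\<^sub>C x + d *\<^sub>C x"
    and scaleC_scaleC: "c *\<^sub>C d *\<^sub>C x = (c * d) *\<^sub>C x"
    and scaleC_of_real: "complex_of_real r *\<^sub>C x = r *\<^sub>R x"

lemma scaleC_zero_right [simp]: "c *\<^sub>C (0 :: 'a::complex_vector) = 0"
  using scaleC_add_right[of c 0 "0 :: 'a"] by simp

lemma scaleC_minus_right: "c *\<^sub>C (- x) = - (c *\<^sub>C (x :: 'a::complex_vector))"
  using scaleC_add_right[of c x "- x"] by (simp add: eq_neg_iff_add_eq_0 add.commute)

lemma scaleC_diff_right: "c *\<^sub>C (x - y) = c *\<^sub>C x - c *\<^sub>C (y :: 'a::complex_vector)"
  using scaleC_add_right[of c x "- y"] by (simp add: scaleC_minus_right)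

lemma scaleC_scaleR: "c *\<^sub>C r *\<^sub>R x = r *\<^sub>R c *\<^sub>C (x :: 'a::complex_vector)"
  by (simp add: scaleC_of_real[symmetric] scaleC_scaleC mult.commute)

class star =
  fixes star :: "'a \<Rightarrow> 'a"

text \<open>Unital C*-algebras; \<^class>\<open>real_normed_algebra_1\<close> excludes the zero algebra.\<close>

class cstar_algebra = complex_vector + real_normed_algebra_1 + complete_space + star +
  assumes scaleC_mult_left: "(c *\<^sub>C x) * y = c *\<^sub>C (x * y)"
    and scaleC_mult_right: "x * (c *\<^sub>C y) = c *\<^sub>C (x * y)"
    and star_star: "star (star x) = x"
    and star_add: "star (x + y) = star x + star y"
    and star_scaleC: "star (c *\<^sub>C x) = cnj c *\<^sub>C star x"
    and star_mult: "star (x * y) = star y * star x"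
    and norm_star_mult: "norm (star x * x) = (norm x)\<^sup>2"

abbreviation csubspace :: "'a::complex_vector set \<Rightarrow> bool" where
  "csubspace \<equiv> module.subspace scaleC"

abbreviation cspan :: "'a::complex_vector set \<Rightarrow> 'a set" where
  "cspan \<equiv> module.span scaleC"

definition clinear_on :: "'a::complex_vector set \<Rightarrow> ('a \<Rightarrow> 'b::complex_vector) \<Rightarrow> bool" where
  "clinear_on E f \<longleftrightarrow>
     (\<forall>x\<in>E. \<forall>y\<in>E. f (x + y) = f x + f y) \<and> (\<forall>c. \<forall>x\<in>E. f (c *\<^sub>C x) = c *\<^sub>C f x)"

instantiation complex :: complex_vector
begin
definition scaleC_complex :: "complex \<Rightarrow> complex \<Rightarrow> complex" where
  "scaleC_complex c x = c * x"
instance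
  by standard (auto simp: scaleC_complex_def algebra_simps scaleR_conv_of_real)
end

section \<open>The Hilbert space of square-summable families\<close>

typedef 'x ell2 = "{f :: 'x \<Rightarrow> complex. (\<lambda>x. (cmod (f x))\<^sup>2) summable_on UNIV}"
  morphisms coord Abs_ell2
  by (rule exI[of _ "\<lambda>_. 0"]) simp

setup_lifting type_definition_ell2

lemma ell2_prod_summable:
  assumes "(\<lambda>x. (cmod (f x))\<^sup>2) summable_on UNIV" "(\<lambda>x. (cmod (g x))\<^sup>2) summable_on UNIV"
  shows "(\<lambda>x. cnj (f x) * g x) summable_on UNIV"
proof -
  have "(\<lambda>x. (cmod (f x))\<^sup>2 + (cmod (g x))\<^sup>2) summable_on UNIV"
    using assms by (rule summable_on_add)
  then have "(\<lambda>x. cmod (cnj (f x) * g x)) summable_on UNIV"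
  proof (rule summable_on_comparison_test)
    fix x
    show "cmod (cnj (f x) * g x) \<le> (cmod (f x))\<^sup>2 + (cmod (g x))\<^sup>2"
      using sum_squares_bound[of "cmod (f x)" "cmod (g x)"]
        mult_nonneg_nonneg[OF norm_ge_zero[of "f x"] norm_ge_zero[of "g x"]]
      unfolding norm_mult complex_mod_cnj by linarith
  qed auto
  then show ?thesis by (rule abs_summable_summable)
qed

lemma ell2_add_summable:
  assumes "(\<lambda>x. (cmod (f x))\<^sup>2) summable_on UNIV" "(\<lambda>x. (cmod (g x))\<^sup>2) summable_on UNIV"
  shows "(\<lambda>x. (cmod (f x + g x))\<^sup>2) summable_on UNIV"
proof -
  have "(\<lambda>x. 2 * (cmod (f x))\<^sup>2 + 2 * (cmod (g x))\<^sup>2) summable_on UNIV"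
    using assms by (intro summable_on_add summable_on_cmult_right)
  then show ?thesis
  proof (rule summable_on_comparison_test)
    fix x
    have "(cmod (f x + g x))\<^sup>2 \<le> (cmod (f x) + cmod (g x))\<^sup>2"
      by (intro power_mono norm_triangle_ineq) auto
    also have "\<dots> \<le> 2 * (cmod (f x))\<^sup>2 + 2 * (cmod (g x))\<^sup>2"
      using sum_squares_bound[of "cmod (f x)" "cmod (g x)"] by (simp add: power2_sum)
    finally show "(cmod (f x + g x))\<^sup>2 \<le> 2 * (cmod (f x))\<^sup>2 + 2 * (cmod (g x))\<^sup>2" .
  qed auto
qed

lemma ell2_scale_summable:
  assumes "(\<lambda>x. (cmod (f x))\<^sup>2) summable_on UNIV"
  shows "(\<lambda>x. (cmod (c * f x))\<^sup>2) summable_on UNIV"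
  using assms by (simp add: norm_mult power_mult_distrib summable_on_cmult_right)

instantiation ell2 :: (type) complex_vector
begin

lift_definition zero_ell2 :: "'a ell2" is "\<lambda>_. 0" by simp

lift_definition plus_ell2 :: "'a ell2 \<Rightarrow> 'a ell2 \<Rightarrow> 'a ell2" is "\<lambda>f g x. f x + g x"
  by (rule ell2_add_summable)

lift_definition uminus_ell2 :: "'a ell2 \<Rightarrow> 'a ell2" is "\<lambda>f x. - f x" by simp

lift_definition minus_ell2 :: "'a ell2 \<Rightarrow> 'a ell2 \<Rightarrow> 'a ell2" is "\<lambda>f g x. f x - g x"
  by (subst diff_conv_add_uminus) (rule ell2_add_summable, auto)

lift_definition scaleR_ell2 :: "real \<Rightarrow> 'a ell2 \<Rightarrow> 'a ell2" is "\<lambda>r f x. complex_of_real r * f x"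
  by (rule ell2_scale_summable)

lift_definition scaleC_ell2 :: "complex \<Rightarrow> 'a ell2 \<Rightarrow> 'a ell2" is "\<lambda>c f x. c * f x"
  by (rule ell2_scale_summable)

instance
  by standard (transfer, auto simp: algebra_simps)+

end

text \<open>The inner product is linear in the second argument.\<close>

definition cinner :: "'x ell2 \<Rightarrow> 'x ell2 \<Rightarrow> complex" where
  "cinner \<xi> \<eta> = (\<Sum>\<^sub>\<infinity>x. cnj (coord \<xi> x) * coord \<eta> x)"

lemma cinner_summable: "(\<lambda>x. cnj (coord \<xi> x) * coord \<eta> x) summable_on UNIV"
  using coord[of \<xi>] coord[of \<eta>] by (intro ell2_prod_summable) auto

lemma cinner_commute: "cinner \<xi> \<eta> = cnj (cinner \<eta> \<xi>)"
  unfolding cinner_def by (subst infsum_cnj[symmetric]) (simp add: mult.commute)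

lemma cinner_add_left: "cinner (\<xi> + \<zeta>) \<eta> = cinner \<xi> \<eta> + cinner \<zeta> \<eta>"
  unfolding cinner_def
  by (simp add: plus_ell2.rep_eq distrib_right infsum_add cinner_summable)

lemma cinner_scaleC_left: "cinner (c *\<^sub>C \<xi>) \<eta> = cnj c * cinner \<xi> \<eta>"
  unfolding cinner_def
  by (simp add: scaleC_ell2.rep_eq mult.assoc infsum_cmult_right')

lemma cinner_scaleR_left: "cinner (r *\<^sub>R \<xi>) \<eta> = complex_of_real r * cinner \<xi> \<eta>"
  using cinner_scaleC_left[of "complex_of_real r"] by (simp add: scaleC_of_real)

lemma cinner_self: "cinner \<xi> \<xi> = complex_of_real (\<Sum>\<^sub>\<infinity>x. (cmod (coord \<xi> x))\<^sup>2)"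
proof -
  have "(\<lambda>x. (cmod (coord \<xi> x))\<^sup>2) summable_on UNIV" using coord[of \<xi>] by simp
  from has_sum_bounded_linear[OF bounded_linear_of_real[where 'a = complex] has_sum_infsum[OF this]]
  have "((\<lambda>x. complex_of_real ((cmod (coord \<xi> x))\<^sup>2)) has_sum
      complex_of_real (\<Sum>\<^sub>\<infinity>x. (cmod (coord \<xi> x))\<^sup>2)) UNIV" .
  then have "((\<lambda>x. cnj (coord \<xi> x) * coord \<xi> x) has_sum
      complex_of_real (\<Sum>\<^sub>\<infinity>x. (cmod (coord \<xi> x))\<^sup>2)) UNIV"
    unfolding complex_norm_square by (simp only: mult.commute)
  then show ?thesis
    unfolding cinner_def by (rule infsumI)
qed

instantiation ell2 :: (type) real_inner
begin

definition inner_ell2 :: "'a ell2 \<Rightarrow> 'a ell2 \<Rightarrow> real" where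
  "inner_ell2 \<xi> \<eta> = Re (cinner \<xi> \<eta>)"

definition norm_ell2 :: "'a ell2 \<Rightarrow> real" where
  "norm_ell2 \<xi> = sqrt (Re (cinner \<xi> \<xi>))"

definition sgn_ell2 :: "'a ell2 \<Rightarrow> 'a ell2" where
  "sgn_ell2 \<xi> = inverse (norm \<xi>) *\<^sub>R \<xi>"

definition dist_ell2 :: "'a ell2 \<Rightarrow> 'a ell2 \<Rightarrow> real" where
  "dist_ell2 \<xi> \<eta> = norm (\<xi> - \<eta>)"

definition uniformity_ell2 :: "('a ell2 \<times> 'a ell2) filter" where
  "uniformity_ell2 = (INF e\<in>{0 <..}. principal {(x, y). dist x y < e})"

definition open_ell2 :: "'a ell2 set \<Rightarrow> bool" where
  "open_ell2 S = (\<forall>x\<in>S. \<forall>\<^sub>F (x', y) in uniformity. x' = x \<longrightarrow> y \<in> S)"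

instance
proof
  fix x y z :: "'a ell2" and r :: real
  show "inner x y = inner y x"
    unfolding inner_ell2_def by (subst cinner_commute) simp
  show "inner (x + y) z = inner x z + inner y z"
    by (simp add: inner_ell2_def cinner_add_left)
  show "inner (r *\<^sub>R x) y = r * inner x y"
    by (simp add: inner_ell2_def cinner_scaleR_left)
  show "0 \<le> inner x x"
    by (simp add: inner_ell2_def cinner_self infsum_nonneg)
  show "inner x x = 0 \<longleftrightarrow> x = 0"
  proof
    assume "inner x x = 0"
    then have *: "(\<Sum>\<^sub>\<infinity>a. (cmod (coord x a))\<^sup>2) = 0"
      by (simp add: inner_ell2_def cinner_self)
    have "(cmod (coord x a))\<^sup>2 = 0" for a
      by (rule nonneg_infsum_le_0D[where A = UNIV]) (use * coord[of x] in auto)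
    then show "x = 0"
      by (auto simp: coord_inject[symmetric] zero_ell2.rep_eq)
  next
    assume "x = 0"
    then show "inner x x = 0" by (simp add: inner_ell2_def cinner_self zero_ell2.rep_eq)
  qed
  show "norm x = sqrt (inner x x)" by (simp add: norm_ell2_def inner_ell2_def)
qed (simp_all add: sgn_ell2_def dist_ell2_def uniformity_ell2_def open_ell2_def)

end

lift_definition ket :: "'x \<Rightarrow> 'x ell2" is "\<lambda>x y. if y = x then 1 else 0"
proof -
  fix x :: 'x
  have "(\<lambda>y. (cmod (if y = x then 1 else 0))\<^sup>2) summable_on {x}"
    by (rule summable_on_finite) simp
  then show "(\<lambda>y. (cmod (if y = x then 1 else 0))\<^sup>2) summable_on UNIV"
    by (rule summable_on_cong_neutral[THEN iffD1, rotated -1]) auto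
qed

lemma ket_nonzero: "ket x \<noteq> 0"
  by transfer (metis zero_neq_one)

lemma ell2_norm_scaleC: "norm (c *\<^sub>C \<xi>) = cmod c * norm (\<xi> :: 'x ell2)"
proof -
  have "cinner (c *\<^sub>C \<xi>) (c *\<^sub>C \<xi>) = complex_of_real ((cmod c)\<^sup>2) * cinner \<xi> \<xi>"
    by (subst cinner_scaleC_left, subst cinner_commute, subst cinner_scaleC_left)
      (simp add: cinner_commute[of \<xi> \<xi>, symmetric] complex_norm_square mult.commute
        del: of_real_power)
  then show ?thesis
    by (simp add: norm_ell2_def real_sqrt_mult del: of_real_power)
qed

lemma bounded_linear_scaleC_ell2: "bounded_linear (\<lambda>\<xi>::'x ell2. c *\<^sub>C \<xi>)"
proof (rule bounded_linear_intro)
  fix x y :: "'x ell2" and r :: real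
  show "c *\<^sub>C (x + y) = c *\<^sub>C x + c *\<^sub>C y" by (rule scaleC_add_right)
  show "c *\<^sub>C r *\<^sub>R x = r *\<^sub>R c *\<^sub>C x"
    by (rule scaleC_scaleR)
  show "norm (c *\<^sub>C x) \<le> norm x * cmod c" by (simp add: ell2_norm_scaleC mult.commute)
qed

lifting_forget ell2.lifting

section \<open>Bounded operators\<close>

text \<open>\<open>'x bop\<close> is the algebra of bounded complex-linear operators on \<open>'x ell2\<close>.\<close>

typedef 'x bop = "{T :: 'x ell2 \<Rightarrow>\<^sub>L 'x ell2. \<forall>c \<xi>. T (c *\<^sub>C \<xi>) = c *\<^sub>C T \<xi>}"
  morphisms blinfun_of_bop Abs_bop
  by (rule exI[of _ id_blinfun]) simp

setup_lifting type_definition_bop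

lift_definition bapply :: "'x bop \<Rightarrow> 'x ell2 \<Rightarrow> 'x ell2"  (infixr \<open>\<cdot>\<close> 90) is "blinfun_apply" .

lemma bapply_eqI: "(\<And>\<xi>. S \<cdot> \<xi> = T \<cdot> \<xi>) \<Longrightarrow> S = T"
  by (metis bapply.rep_eq blinfun_eqI blinfun_of_bop_inject)

lemma bapply_simps:
  "T \<cdot> (\<xi> + \<eta>) = T \<cdot> \<xi> + T \<cdot> \<eta>"
  "T \<cdot> (r *\<^sub>R \<xi>) = r *\<^sub>R (T \<cdot> \<xi>)"
  "T \<cdot> (c *\<^sub>C \<xi>) = c *\<^sub>C (T \<cdot> \<xi>)"
  using blinfun_of_bop[of T] by (simp_all add: bapply.rep_eq blinfun.bilinear_simps)

instantiation bop :: (type) "{complex_vector, real_normed_algebra_1, star}"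
begin

lift_definition zero_bop :: "'a bop" is 0
  by simp

lift_definition one_bop :: "'a bop" is id_blinfun by simp

lift_definition plus_bop :: "'a bop \<Rightarrow> 'a bop \<Rightarrow> 'a bop" is "(+)"
  by (simp add: blinfun.add_left scaleC_add_right)

lift_definition uminus_bop :: "'a bop \<Rightarrow> 'a bop" is uminus
  by (simp add: blinfun.minus_left scaleC_minus_right)

lift_definition minus_bop :: "'a bop \<Rightarrow> 'a bop \<Rightarrow> 'a bop" is "(-)"
  by (simp add: blinfun.diff_left scaleC_diff_right)

lift_definition times_bop :: "'a bop \<Rightarrow> 'a bop \<Rightarrow> 'a bop" is "blinfun_compose"
  by simp

lift_definition scaleR_bop :: "real \<Rightarrow> 'a bop \<Rightarrow> 'a bop" is scaleR
  by (simp add: blinfun.scaleR_left scaleC_scaleR)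

lift_definition scaleC_bop :: "complex \<Rightarrow> 'a bop \<Rightarrow> 'a bop" is
  "\<lambda>c T. Blinfun (\<lambda>\<xi>. c *\<^sub>C blinfun_apply T \<xi>)"
  by (simp add: bounded_linear_Blinfun_apply scaleC_scaleC mult.commute
      bounded_linear_compose[OF bounded_linear_scaleC_ell2 blinfun.bounded_linear_right])

lift_definition norm_bop :: "'a bop \<Rightarrow> real" is norm .

definition sgn_bop :: "'a bop \<Rightarrow> 'a bop" where
  "sgn_bop T = inverse (norm T) *\<^sub>R T"

definition dist_bop :: "'a bop \<Rightarrow> 'a bop \<Rightarrow> real" where
  "dist_bop S T = norm (S - T)"

definition uniformity_bop :: "('a bop \<times> 'a bop) filter" where
  "uniformity_bop = (INF e\<in>{0 <..}. principal {(x, y). dist x y < e})"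

definition open_bop :: "'a bop set \<Rightarrow> bool" where
  "open_bop S = (\<forall>x\<in>S. \<forall>\<^sub>F (x', y) in uniformity. x' = x \<longrightarrow> y \<in> S)"

definition star_bop :: "'a bop \<Rightarrow> 'a bop" where
  "star_bop T = (THE S. \<forall>\<xi> \<eta>. cinner (S \<cdot> \<xi>) \<eta> = cinner \<xi> (T \<cdot> \<eta>))"

lemma bop_apply_simps:
  fixes S T :: "'a bop"
  shows "(S + T) \<cdot> \<xi> = S \<cdot> \<xi> + T \<cdot> \<xi>"
  and "(S - T) \<cdot> \<xi> = S \<cdot> \<xi> - T \<cdot> \<xi>"
  and "(- T) \<cdot> \<xi> = - (T \<cdot> \<xi>)"
  and "(0 :: 'a bop) \<cdot> \<xi> = 0"
  and "(1 :: 'a bop) \<cdot> \<xi> = \<xi>"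
  and "(S * T) \<cdot> \<xi> = S \<cdot> T \<cdot> \<xi>"
  and "(r *\<^sub>R T) \<cdot> \<xi> = r *\<^sub>R (T \<cdot> \<xi>)"
  and "(c *\<^sub>C T) \<cdot> \<xi> = c *\<^sub>C (T \<cdot> \<xi>)"
  by (simp_all add: bapply.rep_eq plus_bop.rep_eq minus_bop.rep_eq uminus_bop.rep_eq
      zero_bop.rep_eq one_bop.rep_eq times_bop.rep_eq scaleR_bop.rep_eq scaleC_bop.rep_eq
      blinfun.bilinear_simps bounded_linear_Blinfun_apply
      bounded_linear_compose[OF bounded_linear_scaleC_ell2 blinfun.bounded_linear_right])

instance
proof
  fix S T R :: "'a bop" and r s :: real and c d :: complex
  show "S + T + R = S + (T + R)" "S + T = T + S" "0 + S = S" "- S + S = 0" "S - T = S + - T"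
    "r *\<^sub>R (S + T) = r *\<^sub>R S + r *\<^sub>R T" "(r + s) *\<^sub>R S = r *\<^sub>R S + s *\<^sub>R S"
    "r *\<^sub>R s *\<^sub>R S = (r * s) *\<^sub>R S" "1 *\<^sub>R S = S"
    "c *\<^sub>C (S + T) = c *\<^sub>C S + c *\<^sub>C T" "(c + d) *\<^sub>C S = c *\<^sub>C S + d *\<^sub>C S"
    "c *\<^sub>C d *\<^sub>C S = (c * d) *\<^sub>C S" "complex_of_real r *\<^sub>C S = r *\<^sub>R S"
    "S * T * R = S * (T * R)" "(S + T) * R = S * R + T * R" "S * (T + R) = S * T + S * R"
    "(r *\<^sub>R S) * T = r *\<^sub>R (S * T)" "S * (r *\<^sub>R T) = r *\<^sub>R (S * T)"
    "1 * S = S" "S * 1 = S"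
    by (auto intro!: bapply_eqI simp: bop_apply_simps bapply_simps scaleC_add_right
        scaleC_add_left scaleC_scaleC scaleC_of_real scaleR_add_right scaleR_add_left)
  show "(0 :: 'a bop) \<noteq> 1"
  proof
    assume "(0 :: 'a bop) = 1"
    then have "(0 :: 'a bop) \<cdot> ket undefined = (1 :: 'a bop) \<cdot> ket undefined" by simp
    then show False by (simp add: bop_apply_simps ket_nonzero)
  qed
  show "norm S = 0 \<longleftrightarrow> S = 0"
    by (simp add: norm_bop.rep_eq zero_bop.rep_eq flip: blinfun_of_bop_inject)
  show "norm (S + T) \<le> norm S + norm T"
    by (simp add: norm_bop.rep_eq plus_bop.rep_eq norm_triangle_ineq)
  show "norm (r *\<^sub>R S) = \<bar>r\<bar> * norm S"
    by (simp add: norm_bop.rep_eq scaleR_bop.rep_eq)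
  show "norm (S * T) \<le> norm S * norm T"
    by (simp add: norm_bop.rep_eq times_bop.rep_eq norm_blinfun_compose)
  show "norm (1 :: 'a bop) = 1"
    unfolding norm_bop.rep_eq one_bop.rep_eq
    by (rule norm_blinfun_eqI[where x = "ket undefined"]) (simp_all add: ket_nonzero)
qed (simp_all add: sgn_bop_def dist_bop_def uniformity_bop_def open_bop_def)

end

text \<open>\<open>of_matrix m\<close> is the operator with matrix \<open>m\<close> with respect to the orthonormal basis \<^const>\<open>ket\<close>;
  it is only applied to matrices of bounded operators.\<close>

definition entry :: "'x bop \<Rightarrow> 'x \<Rightarrow> 'x \<Rightarrow> complex" where
  "entry T x y = cinner (ket x) (T \<cdot> ket y)"

definition of_matrix :: "('x \<Rightarrow> 'x \<Rightarrow> complex) \<Rightarrow> 'x bop" where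
  "of_matrix m = (THE T. \<forall>x y. entry T x y = m x y)"

definition matrix_unit :: "'y \<Rightarrow> 'y \<Rightarrow> 'y bop" where
  "matrix_unit s t = of_matrix (\<lambda>p q. if p = s \<and> q = t then 1 else 0)"

definition coord_proj :: "'y set \<Rightarrow> 'y bop" where
  "coord_proj F = of_matrix (\<lambda>p q. if p = q \<and> p \<in> F then 1 else 0)"

text \<open>The tensor product of operators, where \<open>'h ell2 \<otimes> 'y ell2\<close> is \<open>('h \<times> 'y) ell2\<close>.\<close>

definition tensor :: "'h bop \<Rightarrow> 'y bop \<Rightarrow> ('h \<times> 'y) bop"  (infixr \<open>\<otimes>\<^sub>o\<close> 75) where
  "S \<otimes>\<^sub>o T = of_matrix (\<lambda>(h, s) (k, t). entry S h k * entry T s t)"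

section \<open>Group actions, representations, amenability\<close>

text \<open>The group is a type of class \<^class>\<open>group_add\<close>, which is not assumed commutative:
  \<open>s + t\<close>, \<open>0\<close> and \<open>- s\<close> are the product, the identity and the inverse.\<close>

definition star_hom ::
  "('a::{complex_vector, times, one, star} \<Rightarrow> 'b::{complex_vector, times, one, star}) \<Rightarrow> bool"
where
  "star_hom f \<longleftrightarrow> clinear_on UNIV f \<and> (\<forall>x y. f (x * y) = f x * f y) \<and> f 1 = 1 \<and>
     (\<forall>x. f (star x) = star (f x))"

definition cstar_action :: "('g::group_add \<Rightarrow> 'a::cstar_algebra \<Rightarrow> 'a) \<Rightarrow> bool" where
  "cstar_action \<alpha> \<longleftrightarrow> (\<forall>s. star_hom (\<alpha> s) \<and> bij (\<alpha> s)) \<and>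
     \<alpha> 0 = id \<and> (\<forall>s t. \<alpha> (s + t) = \<alpha> s \<circ> \<alpha> t)"

definition faithful_rep :: "('a::cstar_algebra \<Rightarrow> 'h bop) \<Rightarrow> bool" where
  "faithful_rep \<rho> \<longleftrightarrow> star_hom \<rho> \<and> inj \<rho>"

definition central_positive :: "'a::cstar_algebra \<Rightarrow> bool" where
  "central_positive z \<longleftrightarrow> (\<forall>x. z * x = x * z) \<and> (\<exists>y. z = star y * y)"

text \<open>Nets are indexed by a type \<open>'i\<close> and converge along a proper filter on it.  The sums have finite
  support.\<close>

definition amenable_action ::
  "'i itself \<Rightarrow> ('g::group_add \<Rightarrow> 'a::cstar_algebra \<Rightarrow> 'a) \<Rightarrow> bool"
where
  "amenable_action _ \<alpha> \<longleftrightarrow> (\<exists>(\<F> :: 'i filter) (T :: 'i \<Rightarrow> 'g \<Rightarrow> 'a). \<F> \<noteq> bot \<and>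
     (\<forall>i. finite {s. T i s \<noteq> 0} \<and> (\<forall>s. central_positive (T i s)) \<and> Sum_any (\<lambda>s. (T i s)\<^sup>2) = 1) \<and>
     (\<forall>t. ((\<lambda>i. Sum_any (\<lambda>s.
         star (T i s - \<alpha> t (T i (- t + s))) * (T i s - \<alpha> t (T i (- t + s))))) \<longlongrightarrow> 0) \<F>))"

section \<open>Operator systems and completely positive maps\<close>

text \<open>Operator systems are concrete, sitting in a corner \<open>e * B * e\<close> of the operators \<open>B\<close> on a
  Hilbert space; the unit \<open>e\<close> need not be the identity operator.\<close>

definition opsys :: "'x bop set \<Rightarrow> bool" where
  "opsys E \<longleftrightarrow> csubspace E \<and> (\<forall>x\<in>E. star x \<in> E) \<and>
     (\<exists>e\<in>E. star e = e \<and> e * e = e \<and> (\<forall>x\<in>E. e * x = x \<and> x * e = x))"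

definition cstar_sys :: "'x bop set \<Rightarrow> bool" where
  "cstar_sys E \<longleftrightarrow> opsys E \<and> closed E \<and> (\<forall>x\<in>E. \<forall>y\<in>E. x * y \<in> E)"

text \<open>Matrices over the operators on \<open>K = 'x ell2\<close> act on \<open>K\<^sup>n\<close>.\<close>

definition mat_pos :: "nat \<Rightarrow> (nat \<Rightarrow> nat \<Rightarrow> 'x bop) \<Rightarrow> bool" where
  "mat_pos n X \<longleftrightarrow> (\<forall>\<xi>. 0 \<le> (\<Sum>i<n. \<Sum>j<n. cinner (\<xi> i) (X i j \<cdot> \<xi> j)))"

definition mat_norm :: "nat \<Rightarrow> (nat \<Rightarrow> nat \<Rightarrow> 'x bop) \<Rightarrow> real" where
  "mat_norm n X = Sup {cmod (\<Sum>i<n. \<Sum>j<n. cinner (\<eta> i) (X i j \<cdot> \<xi> j)) |\<xi> \<eta>.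
     (\<Sum>i<n. (norm (\<xi> i))\<^sup>2) \<le> 1 \<and> (\<Sum>i<n. (norm (\<eta> i))\<^sup>2) \<le> 1}"

definition op_pos :: "'x bop \<Rightarrow> bool" where
  "op_pos x \<longleftrightarrow> (\<forall>\<xi>. 0 \<le> cinner \<xi> (x \<cdot> \<xi>))"

text \<open>Maps with domain \<open>E\<close> are represented by functions that are \<^const>\<open>undefined\<close> outside \<open>E\<close>.\<close>

definition cp :: "'x bop set \<Rightarrow> 'x bop set \<Rightarrow> ('x bop \<Rightarrow> 'x bop) \<Rightarrow> bool" where
  "cp E D \<phi> \<longleftrightarrow> \<phi> \<in> E \<rightarrow>\<^sub>E D \<and> clinear_on E \<phi> \<and>
     (\<forall>n X. (\<forall>i<n. \<forall>j<n. X i j \<in> E) \<longrightarrow> mat_pos n X \<longrightarrow> mat_pos n (\<lambda>i j. \<phi> (X i j)))"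

definition ccp :: "'x bop set \<Rightarrow> 'x bop set \<Rightarrow> ('x bop \<Rightarrow> 'x bop) \<Rightarrow> bool" where
  "ccp E D \<phi> \<longleftrightarrow> cp E D \<phi> \<and> (\<forall>x\<in>E. norm (\<phi> x) \<le> norm x)"

definition pos_functional :: "'x bop set \<Rightarrow> ('x bop \<Rightarrow> complex) \<Rightarrow> bool" where
  "pos_functional E f \<longleftrightarrow> clinear_on E f \<and> (\<forall>x\<in>E. op_pos x \<longrightarrow> 0 \<le> f x)"

section \<open>Actions and modules on operator systems\<close>

definition gamma_action :: "'x bop set \<Rightarrow> ('g::group_add \<Rightarrow> 'x bop \<Rightarrow> 'x bop) \<Rightarrow> bool" where
  "gamma_action E \<beta> \<longleftrightarrow>
     (\<forall>t. clinear_on E (\<beta> t) \<and> \<beta> t ` E = E \<and>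
        (\<forall>n X. (\<forall>i<n. \<forall>j<n. X i j \<in> E) \<longrightarrow> mat_norm n (\<lambda>i j. \<beta> t (X i j)) = mat_norm n X)) \<and>
     (\<forall>x\<in>E. \<beta> 0 x = x) \<and> (\<forall>s t. \<forall>x\<in>E. \<beta> (s + t) x = \<beta> s (\<beta> t x)) \<and>
     (cstar_sys E \<longrightarrow>
        (\<forall>t. \<forall>x\<in>E. \<beta> t (star x) = star (\<beta> t x) \<and> (\<forall>y\<in>E. \<beta> t (x * y) = \<beta> t x * \<beta> t y)))"

definition right_module :: "'x bop set \<Rightarrow> ('x bop \<Rightarrow> 'a::cstar_algebra \<Rightarrow> 'x bop) \<Rightarrow> bool" where
  "right_module E m \<longleftrightarrow>
     (\<forall>x\<in>E. \<forall>a. m x a \<in> E) \<and>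
     (\<forall>a. clinear_on E (\<lambda>x. m x a)) \<and> (\<forall>x\<in>E. clinear_on UNIV (m x)) \<and>
     (\<forall>x\<in>E. \<forall>a b. m (m x a) b = m x (a * b)) \<and> (\<forall>x\<in>E. m x 1 = x)"

definition operator_module ::
  "('g::group_add \<Rightarrow> 'a::cstar_algebra \<Rightarrow> 'a) \<Rightarrow> 'x bop set \<Rightarrow>
    ('g \<Rightarrow> 'x bop \<Rightarrow> 'x bop) \<Rightarrow> ('x bop \<Rightarrow> 'a \<Rightarrow> 'x bop) \<Rightarrow> bool"
where
  "operator_module \<alpha> E \<beta> m \<longleftrightarrow> opsys E \<and> gamma_action E \<beta> \<and> right_module E m \<and>
     (\<forall>t. \<forall>x\<in>E. \<forall>a. \<beta> t (m x a) = m (\<beta> t x) (\<alpha> t a))"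

section \<open>The reduced crossed product and the tensor product with the bounded operators\<close>

text \<open>The pair \<open>(t\<^sub>1, [t\<^sub>2, \<dots>, t\<^sub>l])\<close> stands for the nonempty tuple \<open>(t\<^sub>1, \<dots>, t\<^sub>l)\<close>.\<close>

type_synonym 'g tuples = "'g \<times> 'g list"

definition tbar :: "'g::group_add tuples \<Rightarrow> 'g" where
  "tbar t = fst t + sum_list (snd t)"

definition tshift :: "'g::group_add \<Rightarrow> 'g tuples \<Rightarrow> 'g tuples" where
  "tshift r t = (r + fst t, snd t)"

definition pi_rep ::
  "('g::group_add \<Rightarrow> 'a::cstar_algebra \<Rightarrow> 'a) \<Rightarrow> ('a \<Rightarrow> 'h bop) \<Rightarrow> 'a \<Rightarrow> ('h \<times> 'g tuples) bop"
where
  "pi_rep \<alpha> \<rho> b =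
     of_matrix (\<lambda>(h, s) (k, t). if s = t then entry (\<rho> (\<alpha> (- tbar s) b)) h k else 0)"

definition U_op :: "'g::group_add \<Rightarrow> ('h \<times> 'g tuples) bop" where
  "U_op r = 1 \<otimes>\<^sub>o of_matrix (\<lambda>s t. if s = tshift r t then 1 else 0)"

definition conj_action :: "'g::group_add \<Rightarrow> ('h \<times> 'g tuples) bop \<Rightarrow> ('h \<times> 'g tuples) bop" where
  "conj_action r x = U_op r * x * star (U_op r)"

definition pi_mult ::
  "('g::group_add \<Rightarrow> 'a::cstar_algebra \<Rightarrow> 'a) \<Rightarrow> ('a \<Rightarrow> 'h bop) \<Rightarrow>
    ('h \<times> 'g tuples) bop \<Rightarrow> 'a \<Rightarrow> ('h \<times> 'g tuples) bop"
where
  "pi_mult \<alpha> \<rho> x b = x * pi_rep \<alpha> \<rho> b"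

text \<open>The regular representation acts on \<open>H \<otimes> \<ell>\<^sup>2(\<Gamma>)\<close>, which is taken here as the subspace
  \<open>H \<otimes> \<ell>\<^sup>2(\<Gamma>\<^sup>1)\<close> of \<open>H \<otimes> \<ell>\<^sup>2(\<Gamma>\<^sup>\<infinity>)\<close>; operators on it are extended by 0 to the complement.
  On this subspace \<^const>\<open>pi_rep\<close> and \<^const>\<open>U_op\<close> restrict to
  \<open>a (\<xi> \<otimes> \<delta>\<^sub>p) = \<alpha>\<^sub>p\<^sup>-\<^sup>1(a) \<xi> \<otimes> \<delta>\<^sub>p\<close> and \<open>s (\<xi> \<otimes> \<delta>\<^sub>p) = \<xi> \<otimes> \<delta>\<^sub>s\<^sub>p\<close>.\<close>

definition reduced_crossed_product ::
  "('g::group_add \<Rightarrow> 'a::cstar_algebra \<Rightarrow> 'a) \<Rightarrow> ('a \<Rightarrow> 'h bop) \<Rightarrow> ('h \<times> 'g tuples) bop set"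
where
  "reduced_crossed_product \<alpha> \<rho> = closure (cspan
     {pi_rep \<alpha> \<rho> a * U_op s * (1 \<otimes>\<^sub>o coord_proj {t. snd t = []}) |a s. True})"

definition min_tensor_B :: "('a::cstar_algebra \<Rightarrow> 'h bop) \<Rightarrow> ('h \<times> 'y) bop set" where
  "min_tensor_B \<rho> = closure (cspan {\<rho> a \<otimes>\<^sub>o T |a T. True})"

definition matrix_sys :: "('a::cstar_algebra \<Rightarrow> 'h bop) \<Rightarrow> 'y set \<Rightarrow> ('h \<times> 'y) bop set" where
  "matrix_sys \<rho> F = cspan {\<rho> a \<otimes>\<^sub>o matrix_unit s t |a s t. s \<in> F \<and> t \<in> F}"

section \<open>Admissible maps\<close>

text \<open>The operator systems with right module structure between which admissible maps are formed.
  They range over all operator systems on \<open>H \<otimes> \<ell>\<^sup>2(\<Gamma>\<^sup>\<infinity>)\<close>, where \<open>H\<close> may be arbitrarily large.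
  \<open>A \<otimes> B(\<ell>\<^sup>2(\<Gamma>\<^sup>\<infinity>))\<close> is listed separately: its module structure is right multiplication by
  \<open>\<pi>(b)\<close>, but \<open>\<pi>(b)\<close> is in general only a multiplier of \<open>A \<otimes> K(\<ell>\<^sup>2(\<Gamma>\<^sup>\<infinity>))\<close>, so that
  \<open>x \<pi>(b)\<close> is an operator on \<open>H \<otimes> \<ell>\<^sup>2(\<Gamma>\<^sup>\<infinity>)\<close> that can lie outside \<open>A \<otimes> B(\<ell>\<^sup>2(\<Gamma>\<^sup>\<infinity>))\<close>.\<close>

definition module_systems ::
  "('g::group_add \<Rightarrow> 'a::cstar_algebra \<Rightarrow> 'a) \<Rightarrow> ('a \<Rightarrow> 'h bop) \<Rightarrow>
    (('h \<times> 'g tuples) bop set \<times> (('h \<times> 'g tuples) bop \<Rightarrow> 'a \<Rightarrow> ('h \<times> 'g tuples) bop)) set"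
where
  "module_systems \<alpha> \<rho> =
     insert (min_tensor_B \<rho>, pi_mult \<alpha> \<rho>) {(E, m). opsys E \<and> right_module E m}"

definition module_map :: "'x bop set \<times> ('x bop \<Rightarrow> 'a \<Rightarrow> 'x bop) \<Rightarrow>
    'x bop set \<times> ('x bop \<Rightarrow> 'a \<Rightarrow> 'x bop) \<Rightarrow> ('x bop \<Rightarrow> 'x bop) \<Rightarrow> bool" where
  "module_map = (\<lambda>(E, m) (D, n) \<phi>. \<forall>x\<in>E. \<forall>a. m x a \<in> E \<longrightarrow> \<phi> (m x a) = n (\<phi> x) a)"

inductive A_admissible ::
  "('x bop set \<times> ('x bop \<Rightarrow> 'a \<Rightarrow> 'x bop)) set \<Rightarrow>
    'x bop set \<times> ('x bop \<Rightarrow> 'a \<Rightarrow> 'x bop) \<Rightarrow> 'x bop set \<times> ('x bop \<Rightarrow> 'a \<Rightarrow> 'x bop) \<Rightarrow>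
    ('x bop \<Rightarrow> 'x bop) \<Rightarrow> bool"
  for M :: "('x bop set \<times> ('x bop \<Rightarrow> 'a \<Rightarrow> 'x bop)) set"
where
  module_map: "(E, m) \<in> M \<Longrightarrow> (D, n) \<in> M \<Longrightarrow> cp E D \<phi> \<Longrightarrow> module_map (E, m) (D, n) \<phi> \<Longrightarrow>
    A_admissible M (E, m) (D, n) \<phi>"
| conj_dom: "A_admissible M (E, m) (D, n) \<phi> \<Longrightarrow> b \<in> E \<Longrightarrow> (\<forall>x\<in>E. b * x * star b \<in> E) \<Longrightarrow>
    A_admissible M (E, m) (D, n) (\<lambda>x\<in>E. \<phi> (b * x * star b))"
| conj_ran: "A_admissible M (E, m) (D, n) \<phi> \<Longrightarrow> d \<in> D \<Longrightarrow> (\<forall>x\<in>E. d * \<phi> x * star d \<in> D) \<Longrightarrow>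
    A_admissible M (E, m) (D, n) (\<lambda>x\<in>E. d * \<phi> x * star d)"
| functional: "(E, m) \<in> M \<Longrightarrow> (D, n) \<in> M \<Longrightarrow> pos_functional E f \<Longrightarrow> d \<in> D \<Longrightarrow> op_pos d \<Longrightarrow>
    A_admissible M (E, m) (D, n) (\<lambda>x\<in>E. f x *\<^sub>C d)"
| comp: "A_admissible M (E, m) (C, k) \<phi> \<Longrightarrow> A_admissible M (C, k) (D, n) \<psi> \<Longrightarrow>
    A_admissible M (E, m) (D, n) (compose E \<psi> \<phi>)"
| scale: "A_admissible M (E, m) (D, n) \<phi> \<Longrightarrow> 0 < c \<Longrightarrow>
    A_admissible M (E, m) (D, n) (\<lambda>x\<in>E. c *\<^sub>R \<phi> x)"
| add: "A_admissible M (E, m) (D, n) \<phi> \<Longrightarrow> A_admissible M (E, m) (D, n) \<psi> \<Longrightarrow>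
    A_admissible M (E, m) (D, n) (\<lambda>x\<in>E. \<phi> x + \<psi> x)"

section \<open>Admissible families\<close>

definition gamma_family ::
  "'x bop set \<times> ('g::group_add \<Rightarrow> 'x bop \<Rightarrow> 'x bop) \<Rightarrow> 'x bop set \<times> ('g \<Rightarrow> 'x bop \<Rightarrow> 'x bop) \<Rightarrow>
    'i set \<Rightarrow> ('g \<Rightarrow> 'i \<Rightarrow> 'i) \<Rightarrow> ('i \<Rightarrow> 'x bop set) \<Rightarrow> ('i \<Rightarrow> 'x bop \<Rightarrow> 'x bop) \<Rightarrow> bool"
where
  "gamma_family = (\<lambda>(B, \<beta>) (D, \<delta>) I \<sigma> Bs \<psi>.
     (\<forall>i\<in>I. \<sigma> 0 i = i \<and> (\<forall>s t. \<sigma> t i \<in> I \<and> \<sigma> (s + t) i = \<sigma> s (\<sigma> t i))) \<and>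
     (\<forall>i\<in>I. opsys (Bs i) \<and> Bs i \<subseteq> B \<and> (\<forall>t. \<beta> t ` Bs i \<subseteq> Bs (\<sigma> t i))) \<and>
     (\<forall>i\<in>I. cp (Bs i) D (\<psi> i) \<and> (\<forall>t. \<forall>b\<in>Bs i. \<psi> (\<sigma> t i) (\<beta> t b) = \<delta> t (\<psi> i b))))"

text \<open>A family of maps is represented by the set of its members, each paired with its domain.
  In the rule \<open>family\<close> the indices can therefore be taken to be such pairs; families with other
  index types are covered by the lemma \<open>Gamma_admissible_family\<close> below.\<close>

inductive Gamma_admissible ::
  "'x bop set \<times> ('g::group_add \<Rightarrow> 'x bop \<Rightarrow> 'x bop) \<Rightarrow> 'x bop set \<times> ('g \<Rightarrow> 'x bop \<Rightarrow> 'x bop) \<Rightarrow>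
    ('x bop set \<times> ('x bop \<Rightarrow> 'x bop)) set \<Rightarrow> bool"
where
  family: "opsys B \<Longrightarrow> gamma_action B \<beta> \<Longrightarrow> opsys D \<Longrightarrow> gamma_action D \<delta> \<Longrightarrow>
    gamma_family (B, \<beta>) (D, \<delta>) (I :: ('x bop set \<times> ('x bop \<Rightarrow> 'x bop)) set) \<sigma> Bs \<psi> \<Longrightarrow>
    Gamma_admissible (B, \<beta>) (D, \<delta>) ((\<lambda>i. (Bs i, \<psi> i)) ` I)"
| conj_dom: "Gamma_admissible (B, \<beta>) (D, \<delta>) \<P> \<Longrightarrow> (E, \<psi>) \<in> \<P> \<Longrightarrow> b \<in> B \<Longrightarrow>
    (\<forall>x\<in>E. b * x * star b \<in> E) \<Longrightarrow>
    Gamma_admissible (B, \<beta>) (D, \<delta>) (insert (E, \<lambda>x\<in>E. \<psi> (b * x * star b)) \<P>)"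
| conj_ran: "Gamma_admissible (B, \<beta>) (D, \<delta>) \<P> \<Longrightarrow> (E, \<psi>) \<in> \<P> \<Longrightarrow> d \<in> D \<Longrightarrow>
    (\<forall>x\<in>E. d * \<psi> x * star d \<in> D) \<Longrightarrow>
    Gamma_admissible (B, \<beta>) (D, \<delta>) (insert (E, \<lambda>x\<in>E. d * \<psi> x * star d) \<P>)"
| sum: "Gamma_admissible (B, \<beta>) (D, \<delta>) \<P> \<Longrightarrow> \<psi>s \<noteq> [] \<Longrightarrow> (\<forall>\<psi>\<in>set \<psi>s. (E, \<psi>) \<in> \<P>) \<Longrightarrow>
    Gamma_admissible (B, \<beta>) (D, \<delta>) (insert (E, \<lambda>x\<in>E. \<Sum>\<psi>\<leftarrow>\<psi>s. \<psi> x) \<P>)"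
| act_ran: "Gamma_admissible (B, \<beta>) (D, \<delta>) \<P> \<Longrightarrow> (E, \<psi>) \<in> \<P> \<Longrightarrow>
    Gamma_admissible (B, \<beta>) (D, \<delta>) (insert (E, \<lambda>x\<in>E. \<delta> t (\<psi> x)) \<P>)"
| act_dom: "Gamma_admissible (B, \<beta>) (D, \<delta>) \<P> \<Longrightarrow> (E, \<phi>) \<in> \<P> \<Longrightarrow> (E', \<psi>) \<in> \<P> \<Longrightarrow> \<beta> t ` E = E' \<Longrightarrow>
    Gamma_admissible (B, \<beta>) (D, \<delta>) (insert (E, \<lambda>x\<in>E. \<psi> (\<beta> t x)) \<P>)"
| comp: "Gamma_admissible (B, \<beta>) (D, \<delta>) \<P> \<Longrightarrow> Gamma_admissible (D, \<delta>) (C, \<gamma>) \<Q> \<Longrightarrow>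
    Gamma_admissible (B, \<beta>) (C, \<gamma>)
      {(E, compose E \<psi> \<phi>) |E \<phi> G \<psi>. (E, \<phi>) \<in> \<P> \<and> (G, \<psi>) \<in> \<Q> \<and> \<phi> ` E \<subseteq> G}"
| union: "Gamma_admissible (B, \<beta>) (D, \<delta>) \<P> \<Longrightarrow> Gamma_admissible (B, \<beta>) (D, \<delta>) \<Q> \<Longrightarrow>
    Gamma_admissible (B, \<beta>) (D, \<delta>) (\<P> \<union> \<Q>)"

lemma Gamma_admissible_family:
  fixes I :: "'i set" and B :: "'x bop set"
  assumes B: "opsys B" "gamma_action B \<beta>" and D: "opsys D" "gamma_action D \<delta>"
    and fam: "gamma_family (B, \<beta>) (D, \<delta>) I \<sigma> Bs \<psi>"
  shows "Gamma_admissible (B, \<beta>) (D, \<delta>) ((\<lambda>i. (Bs i, \<psi> i)) ` I)"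
proof -
  let ?p = "\<lambda>i. (Bs i, \<psi> i)"
  define \<tau> where
    "\<tau> t p = (\<beta> t ` fst p, \<lambda>y\<in>\<beta> t ` fst p. \<delta> t (snd p (\<beta> (- t) y)))"
    for t and p :: "'x bop set \<times> ('x bop \<Rightarrow> 'x bop)"
  have \<beta>0: "\<beta> 0 x = x" and \<beta>add: "\<beta> (s + t) x = \<beta> s (\<beta> t x)" if "x \<in> B" for x s t
    using B(2) that unfolding gamma_action_def by blast+
  have \<sigma>: "\<sigma> 0 i = i" "\<sigma> t i \<in> I" "\<sigma> (s + t) i = \<sigma> s (\<sigma> t i)" if "i \<in> I" for i s t
    using fam that unfolding gamma_family_def by auto
  have sub: "opsys (Bs i)" "Bs i \<subseteq> B" "\<beta> t ` Bs i \<subseteq> Bs (\<sigma> t i)" "cp (Bs i) D (\<psi> i)"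
    "b \<in> Bs i \<Longrightarrow> \<psi> (\<sigma> t i) (\<beta> t b) = \<delta> t (\<psi> i b)" if "i \<in> I" for i t b
    using fam that unfolding gamma_family_def by auto
  have inv: "\<beta> (- t) (\<beta> t x) = x" "\<beta> t (\<beta> (- t) x) = x" if "x \<in> B" for x t
    using \<beta>add[OF that, of "- t" t] \<beta>add[OF that, of t "- t"] \<beta>0[OF that] by simp_all
  have img: "\<beta> t ` Bs i = Bs (\<sigma> t i)" if i: "i \<in> I" for i t
  proof
    show "\<beta> t ` Bs i \<subseteq> Bs (\<sigma> t i)" using sub(3)[OF i] .
    show "Bs (\<sigma> t i) \<subseteq> \<beta> t ` Bs i"
    proof
      fix y assume y: "y \<in> Bs (\<sigma> t i)"
      have "\<sigma> (- t) (\<sigma> t i) = i"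
        using \<sigma>(3)[OF i, of "- t" t] \<sigma>(1)[OF i] by simp
      then have "\<beta> (- t) y \<in> Bs i"
        using sub(3)[OF \<sigma>(2)[OF i, of t], of "- t"] y by auto
      moreover have "y = \<beta> t (\<beta> (- t) y)"
        using inv(2)[of y t] sub(2)[OF \<sigma>(2)[OF i, of t]] y by auto
      ultimately show "y \<in> \<beta> t ` Bs i" by blast
    qed
  qed
  have \<tau>: "\<tau> t (?p i) = ?p (\<sigma> t i)" if i: "i \<in> I" for i t
  proof -
    have "(\<lambda>y\<in>Bs (\<sigma> t i). \<delta> t (\<psi> i (\<beta> (- t) y))) = \<psi> (\<sigma> t i)"
    proof (rule extensionalityI[where A = "Bs (\<sigma> t i)"])
      show "\<psi> (\<sigma> t i) \<in> extensional (Bs (\<sigma> t i))"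
        using sub(4)[OF \<sigma>(2)[OF i]] by (auto simp: cp_def PiE_def)
      fix y assume y: "y \<in> Bs (\<sigma> t i)"
      then obtain b where b: "b \<in> Bs i" "y = \<beta> t b" using img[OF i] by blast
      moreover have "b \<in> B" using b(1) sub(2)[OF i] by blast
      ultimately show "(\<lambda>y\<in>Bs (\<sigma> t i). \<delta> t (\<psi> i (\<beta> (- t) y))) y = \<psi> (\<sigma> t i) y"
        using y sub(5)[OF i b(1), of t] inv(1) by simp
    qed simp
    then show ?thesis by (simp add: \<tau>_def img[OF i])
  qed
  have "gamma_family (B, \<beta>) (D, \<delta>) (?p ` I) \<tau> fst snd"
    unfolding gamma_family_def using \<sigma> sub \<tau> by auto
  from Gamma_admissible.family[OF B D this] show ?thesis by simp
qed

text \<open>All subsystems of a module carry the restricted module structure.\<close>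

definition admissible_family ::
  "('x bop set \<times> ('x bop \<Rightarrow> 'a \<Rightarrow> 'x bop)) set \<Rightarrow>
    'x bop set \<Rightarrow> ('g::group_add \<Rightarrow> 'x bop \<Rightarrow> 'x bop) \<Rightarrow> ('x bop \<Rightarrow> 'a \<Rightarrow> 'x bop) \<Rightarrow>
    'x bop set \<Rightarrow> ('g \<Rightarrow> 'x bop \<Rightarrow> 'x bop) \<Rightarrow> ('x bop \<Rightarrow> 'a \<Rightarrow> 'x bop) \<Rightarrow>
    ('x bop set \<times> ('x bop \<Rightarrow> 'x bop)) set \<Rightarrow> bool"
where
  "admissible_family M B \<beta> m D \<delta> n \<P> \<longleftrightarrow> Gamma_admissible (B, \<beta>) (D, \<delta>) \<P> \<and>
     (\<forall>(E, \<psi>) \<in> \<P>. A_admissible M (E, m) (D, n) \<psi>)"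

definition admissible_map ::
  "('x bop set \<times> ('x bop \<Rightarrow> 'a \<Rightarrow> 'x bop)) set \<Rightarrow>
    'x bop set \<Rightarrow> ('g::group_add \<Rightarrow> 'x bop \<Rightarrow> 'x bop) \<Rightarrow> ('x bop \<Rightarrow> 'a \<Rightarrow> 'x bop) \<Rightarrow>
    'x bop set \<Rightarrow> ('g \<Rightarrow> 'x bop \<Rightarrow> 'x bop) \<Rightarrow> ('x bop \<Rightarrow> 'a \<Rightarrow> 'x bop) \<Rightarrow>
    ('x bop \<Rightarrow> 'x bop) \<Rightarrow> bool"
where
  "admissible_map M B \<beta> m D \<delta> n \<phi> \<longleftrightarrow>
     (\<exists>\<P>. admissible_family M B \<beta> m D \<delta> n \<P> \<and> (B, \<phi>) \<in> \<P>)"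

section \<open>Nuclearity\<close>

definition A_Gamma_nuclear ::
  "('g::group_add \<Rightarrow> 'a::cstar_algebra \<Rightarrow> 'a) \<Rightarrow> ('a \<Rightarrow> 'h bop) \<Rightarrow> ('h \<times> 'g tuples) bop set \<Rightarrow>
    ('g \<Rightarrow> ('h \<times> 'g tuples) bop \<Rightarrow> ('h \<times> 'g tuples) bop) \<Rightarrow>
    (('h \<times> 'g tuples) bop \<Rightarrow> 'a \<Rightarrow> ('h \<times> 'g tuples) bop) \<Rightarrow> bool"
where
  "A_Gamma_nuclear \<alpha> \<rho> B \<beta> m \<longleftrightarrow> operator_module \<alpha> B \<beta> m \<and>
     (\<forall>\<epsilon>>0. \<forall>S. finite S \<longrightarrow> S \<subseteq> B \<longrightarrow>
       (\<exists>\<phi> \<psi>.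
          ccp B (min_tensor_B \<rho>) \<phi> \<and>
          admissible_map (module_systems \<alpha> \<rho>) B \<beta> m
            (min_tensor_B \<rho>) conj_action (pi_mult \<alpha> \<rho>) \<phi> \<and>
          (\<forall>F. finite F \<longrightarrow> ccp (matrix_sys \<rho> F) B (\<psi> F)) \<and>
          admissible_family (module_systems \<alpha> \<rho>)
            (min_tensor_B \<rho>) conj_action (pi_mult \<alpha> \<rho>) B \<beta> m
            {(matrix_sys \<rho> F, \<psi> F) |F. finite F} \<and>
          (\<exists>F. finite F \<and> (\<forall>b\<in>S.
             norm (\<psi> F ((1 \<otimes>\<^sub>o coord_proj F) * \<phi> b * (1 \<otimes>\<^sub>o coord_proj F)) - b) \<le> \<epsilon>))))"

end

theory Submission
  imports Defs
begin

text \<open>Let \<open>T\<close> be a function from the net that witnesses amenability, with finite support \<open>K\<close>. Compression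
  to \<open>H \<otimes> \<ell>\<^sup>2(K)\<close> is followed by the averaging map \<open>a \<otimes> e\<^sub>p\<^sub>,\<^sub>q \<mapsto> T(p) \<alpha>\<^sub>p(a) p q\<^sup>-\<^sup>1 T(q)\<close>. The compression is a
  module map because \<open>\<pi>(b)\<close> is diagonal, the averaging map because \<open>T\<close> is central. The composite
  multiplies \<open>as\<close> by \<open>\<Sum>\<^sub>p T(p) \<alpha>\<^sub>s(T(s\<^sup>-\<^sup>1p)) = 1 - \<onehalf> \<Sum>\<^sub>p (T(p) - \<alpha>\<^sub>s(T(s\<^sup>-\<^sup>1p)))\<^sup>2\<close>, which tends to 1.
  Complete positivity of the averaging map says that a matrix over \<open>A\<close> that is positive in one faithful
  representation is positive in every representation.

  The averaging map is not equivariant. However, if a tuple of length 2 is added to \<open>K\<close>, the stabilizer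
  of the resulting finite set \<open>F\<close> is trivial. The translates of the averaging map on the sets
  \<open>rF\<close>, together with 0 on the remaining finite sets, then form a \<open>\<Gamma>\<close>-family.\<close>

section \<open>Square-summable families\<close>

text \<open>With V_p = T(p) p, the averaging map is X \<mapsto> sum over p, q of V_p \<pi>(X_pq)
  V_q^*: the amplification of \<pi> to matrices, followed by conjugation with a row. The difficulty
  lies in the amplification, because the algebra is abstract while positivity of matrices is tested
  on vectors of one concrete representation. Positivity is therefore traded for norms: a
  self-adjoint Y is positive if 1 - Y/M is a contraction, and conversely once M bounds the norm of
  Y. Norms of matrices are compared between representations through their entries, and entries
  through the fact that faithful representations are isometric, which in turn rests on square roots
  found by iteration.

  The set K itself may be stabilized by translations: if \<Gamma> is finite and K = \<Gamma>, its
  averaging map would have to be equivariant. Translations keep the length of tuples, so a single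
  tuple of length two pins them down, and weight 0 on it leaves the averaging formula as it was.

  Both maps are contractive, so convergence on the elements as passes to the closed span.\<close>

lemma coord_simps [simp]:
  "coord (\<xi> + \<eta>) x = coord \<xi> x + coord \<eta> x"
  "coord (\<xi> - \<eta>) x = coord \<xi> x - coord \<eta> x"
  "coord (- \<xi>) x = - coord \<xi> x"
  "coord 0 x = 0"
  "coord (c *\<^sub>C \<xi>) x = c * coord \<xi> x"
  "coord (r *\<^sub>R \<xi>) x = complex_of_real r * coord \<xi> x"
  by (simp_all add: plus_ell2.rep_eq minus_ell2.rep_eq uminus_ell2.rep_eq zero_ell2.rep_eq
      scaleC_ell2.rep_eq scaleR_ell2.rep_eq)

lemma coord_sum: "coord (\<Sum>i\<in>I. f i) x = (\<Sum>i\<in>I. coord (f i) x)"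
  by (induction I rule: infinite_finite_induct) auto

lemma coord_ket: "coord (ket x) y = (if y = x then 1 else 0)"
  by (simp add: ket.rep_eq)

lemma ell2_eqI: "(\<And>x. coord \<xi> x = coord \<eta> x) \<Longrightarrow> \<xi> = \<eta>"
  by (metis coord_inject ext)

lemma coord_summable: "(\<lambda>x. (cmod (coord \<xi> x))\<^sup>2) summable_on A"
  using coord[of \<xi>] by (auto intro: summable_on_subset_banach)

lemma norm_ell2_sq: "(norm (\<xi> :: 'x ell2))\<^sup>2 = (\<Sum>\<^sub>\<infinity>x. (cmod (coord \<xi> x))\<^sup>2)"
  by (simp add: norm_ell2_def cinner_self infsum_nonneg)

lemma cinner_self_norm: "cinner \<xi> \<xi> = complex_of_real ((norm \<xi>)\<^sup>2)"
  by (simp add: cinner_self norm_ell2_sq)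

lemma cinner_add_right: "cinner \<xi> (\<eta> + \<zeta>) = cinner \<xi> \<eta> + cinner \<xi> \<zeta>"
  by (metis cinner_add_left cinner_commute complex_cnj_add)

lemma cinner_scaleC_right: "cinner \<xi> (c *\<^sub>C \<eta>) = c * cinner \<xi> \<eta>"
  by (metis cinner_scaleC_left cinner_commute complex_cnj_cnj complex_cnj_mult)

lemma cinner_scaleR_right: "cinner \<xi> (r *\<^sub>R \<eta>) = complex_of_real r * cinner \<xi> \<eta>"
  using cinner_scaleC_right[of _ "complex_of_real r"] by (simp add: scaleC_of_real)

lemma cinner_zero [simp]: "cinner 0 \<xi> = 0" "cinner \<xi> 0 = 0"
  by (simp_all add: cinner_def)

lemma cinner_minus: "cinner (- \<xi>) \<eta> = - cinner \<xi> \<eta>" "cinner \<xi> (- \<eta>) = - cinner \<xi> \<eta>"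
  by (simp_all add: cinner_def infsum_uminus)

lemma cinner_diff_left: "cinner (\<xi> - \<eta>) \<zeta> = cinner \<xi> \<zeta> - cinner \<eta> \<zeta>"
  using cinner_add_left[of \<xi> "- \<eta>" \<zeta>] by (simp add: cinner_minus)

lemma cinner_diff_right: "cinner \<zeta> (\<xi> - \<eta>) = cinner \<zeta> \<xi> - cinner \<zeta> \<eta>"
  using cinner_add_right[of \<zeta> \<xi> "- \<eta>"] by (simp add: cinner_minus)

lemma cinner_sum_left: "cinner (\<Sum>i\<in>I. f i) \<eta> = (\<Sum>i\<in>I. cinner (f i) \<eta>)"
  by (induction I rule: infinite_finite_induct) (auto simp: cinner_add_left)

lemma cinner_sum_right: "cinner \<eta> (\<Sum>i\<in>I. f i) = (\<Sum>i\<in>I. cinner \<eta> (f i))"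
  by (induction I rule: infinite_finite_induct) (auto simp: cinner_add_right)

lemmas cinner_simps = cinner_add_left cinner_add_right cinner_diff_left cinner_diff_right
  cinner_minus cinner_scaleC_left cinner_scaleC_right cinner_scaleR_left cinner_scaleR_right
  cinner_sum_left cinner_sum_right

text \<open>Multiplying \<eta> by a phase c makes the inner product real and nonnegative, after
  which the real Cauchy-Schwarz inequality of the \<open>real_inner\<close> instance
  applies.\<close>

lemma cinner_bound: "cmod (cinner \<xi> \<eta>) \<le> norm \<xi> * norm \<eta>"
proof (cases "cinner \<xi> \<eta> = 0")
  case False
  define c where "c = cnj (cinner \<xi> \<eta>) / cmod (cinner \<xi> \<eta>)"
  have c: "cmod c = 1" using False by (simp add: c_def norm_divide)
  have "c * cinner \<xi> \<eta> = complex_of_real ((cmod (cinner \<xi> \<eta>))\<^sup>2) / cmod (cinner \<xi> \<eta>)"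
    unfolding c_def complex_norm_square by (simp add: mult.commute)
  then have "c * cinner \<xi> \<eta> = cmod (cinner \<xi> \<eta>)"
    by (simp add: power2_eq_square)
  then have "cmod (cinner \<xi> \<eta>) = Re (cinner \<xi> (c *\<^sub>C \<eta>))"
    by (simp add: cinner_scaleC_right)
  also have "\<dots> \<le> norm \<xi> * norm (c *\<^sub>C \<eta>)"
    using norm_cauchy_schwarz[of \<xi> "c *\<^sub>C \<eta>"] by (simp add: inner_ell2_def)
  also have "\<dots> = norm \<xi> * norm \<eta>" by (simp add: ell2_norm_scaleC c)
  finally show ?thesis .
qed simp

lemma bounded_linear_cinner_right: "bounded_linear (cinner \<xi>)"
  by (rule bounded_linear_intro[where K = "norm \<xi>"])
    (auto simp: cinner_simps scaleR_conv_of_real cinner_bound mult.commute[of "norm _" "norm \<xi>"])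

lemma cinner_ket: "cinner (ket x) \<xi> = coord \<xi> x"
proof -
  have "((\<lambda>y. cnj (coord (ket x) y) * coord \<xi> y) has_sum (\<Sum>y\<in>{x}. cnj (coord (ket x) y) * coord \<xi> y)) UNIV"
    by (rule has_sum_finite_neutralI[where B = "{x}"]) (auto simp: coord_ket)
  then show ?thesis
    unfolding cinner_def by (simp add: infsumI coord_ket)
qed

lemma cinner_ket_right: "cinner \<xi> (ket x) = cnj (coord \<xi> x)"
  by (subst cinner_commute) (simp add: cinner_ket)

lemma norm_ket [simp]: "norm (ket x) = 1"
proof -
  have "cinner (ket x) (ket x) = 1" by (simp add: cinner_ket coord_ket)
  then show ?thesis by (simp add: norm_ell2_def)
qed

lemma ell2_finite_norm:
  "finite F \<Longrightarrow> (norm (\<Sum>y\<in>F. c y *\<^sub>C ket y))\<^sup>2 = (\<Sum>y\<in>F. (cmod (c y))\<^sup>2)"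
proof -
  assume F: "finite F"
  have "cinner (\<Sum>y\<in>F. c y *\<^sub>C ket y) (\<Sum>y\<in>F. c y *\<^sub>C ket y) = (\<Sum>y\<in>F. c y * cnj (c y))"
    using F by (simp add: cinner_simps cinner_ket coord_ket coord_sum sum_distrib_left
         if_distrib cong: if_cong)
  also have "\<dots> = complex_of_real (\<Sum>y\<in>F. (cmod (c y))\<^sup>2)"
    by (simp only: complex_norm_square of_real_sum)
  finally show ?thesis
    unfolding cinner_self_norm by (simp only: of_real_eq_iff)
qed

text \<open>A finite partial sum is orthogonal to the remainder, so by Pythagoras its squared error
  is the squared norm minus finitely many squared coordinates, which tends to 0.\<close>

lemma ket_expansion: "((\<lambda>y. coord \<xi> y *\<^sub>C ket y) has_sum \<xi>) UNIV"
  unfolding has_sum_def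
proof (rule tendsto_norm_zero_cancel[THEN LIM_zero_cancel])
  let ?s = "\<lambda>F. (\<Sum>y\<in>F. coord \<xi> y *\<^sub>C ket y)"
  have co: "coord (?s F) x = (if x \<in> F then coord \<xi> x else 0)" if "finite F" for F x
    using that by (simp add: coord_sum coord_ket if_distrib cong: if_cong)
  have eq: "(norm (?s F - \<xi>))\<^sup>2 = (norm \<xi>)\<^sup>2 - (\<Sum>x\<in>F. (cmod (coord \<xi> x))\<^sup>2)" if F: "finite F" for F
  proof -
    have "cinner (?s F) (\<xi> - ?s F) = 0"
      by (simp add: cinner_sum_left cinner_scaleC_left cinner_ket co F)
    then have "inner (?s F) (\<xi> - ?s F) = 0" by (simp add: inner_ell2_def)
    then have "(norm (\<xi> - ?s F))\<^sup>2 = (norm \<xi>)\<^sup>2 - (norm (?s F))\<^sup>2"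
      by (simp add: power2_norm_eq_inner inner_diff_right inner_diff_left inner_commute)
    then show ?thesis by (simp only: norm_minus_commute[of _ \<xi>] ell2_finite_norm[OF F])
  qed
  have "((\<lambda>F. (norm \<xi>)\<^sup>2 - (\<Sum>x\<in>F. (cmod (coord \<xi> x))\<^sup>2)) \<longlongrightarrow> (norm \<xi>)\<^sup>2 - (norm \<xi>)\<^sup>2)
      (finite_subsets_at_top UNIV)"
    using has_sum_infsum[OF coord_summable[of \<xi> UNIV]] unfolding norm_ell2_sq has_sum_def
    by (intro tendsto_intros)
  then have "((\<lambda>F. sqrt ((norm \<xi>)\<^sup>2 - (\<Sum>x\<in>F. (cmod (coord \<xi> x))\<^sup>2))) \<longlongrightarrow> sqrt 0)
      (finite_subsets_at_top UNIV)"
    by (intro tendsto_real_sqrt) simp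
  then show "((\<lambda>F. norm (?s F - \<xi>)) \<longlongrightarrow> 0) (finite_subsets_at_top UNIV)"
    unfolding real_sqrt_zero
  proof (rule Lim_transform_eventually)
    show "\<forall>\<^sub>F F in finite_subsets_at_top UNIV.
        sqrt ((norm \<xi>)\<^sup>2 - (\<Sum>x\<in>F. (cmod (coord \<xi> x))\<^sup>2)) = norm (?s F - \<xi>)"
      by (rule eventually_finite_subsets_at_top_weakI) (simp add: eq[symmetric])
  qed
qed

text \<open>Both sides send the norm-convergent expansion in \<open>ket\<close> to the same series.
  The codomain is left general, since functionals, operators and slices are all compared in this
  way.\<close>

lemma ell2_functional_eqI:
  assumes "bounded_linear f" "bounded_linear g"
    and "\<And>c \<xi>. f (c *\<^sub>C \<xi>) = c *\<^sub>C f \<xi>" "\<And>c \<xi>. g (c *\<^sub>C \<xi>) = c *\<^sub>C g \<xi>"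
    and "\<And>x. f (ket x) = g (ket x)"
  shows "f \<xi> = (g \<xi> :: 'b::{complex_vector,real_normed_vector})"
proof -
  have "((\<lambda>y. coord \<xi> y *\<^sub>C f (ket y)) has_sum f \<xi>) UNIV"
    using has_sum_bounded_linear[OF assms(1) ket_expansion[of \<xi>]] by (simp add: assms)
  moreover have "((\<lambda>y. coord \<xi> y *\<^sub>C f (ket y)) has_sum g \<xi>) UNIV"
    using has_sum_bounded_linear[OF assms(2) ket_expansion[of \<xi>]] by (simp add: assms)
  ultimately show ?thesis by (rule has_sum_unique)
qed

lemma coord_of_abs:
  assumes "\<And>F. finite F \<Longrightarrow> (\<Sum>x\<in>F. (cmod (f x))\<^sup>2) \<le> C"
  shows "\<exists>\<xi>. coord \<xi> = f \<and> (norm \<xi>)\<^sup>2 \<le> C"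
proof -
  have s: "(\<lambda>x. (cmod (f x))\<^sup>2) summable_on UNIV"
    by (rule nonneg_bounded_partial_sums_imp_summable_on[where C = C])
       (simp, rule eventually_finite_subsets_at_top_weakI, rule assms)
  then have c: "coord (Abs_ell2 f) = f" by (simp add: Abs_ell2_inverse)
  have "(norm (Abs_ell2 f))\<^sup>2 \<le> C"
    unfolding norm_ell2_sq c by (rule infsum_le_finite_sums[OF s]) (use assms in auto)
  with c show ?thesis by blast
qed

lemma finite_sum_le_norm: "finite F \<Longrightarrow> (\<Sum>x\<in>F. (cmod (coord \<xi> x))\<^sup>2) \<le> (norm \<xi>)\<^sup>2"
  unfolding norm_ell2_sq by (rule finite_sum_le_infsum) (auto simp: coord_summable)

text \<open>The candidate v has coordinates \<open>cnj (f (ket y))\<close>. Evaluating f on a finite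
  section of v gives the squared norm of that section, so each section has norm at most
  \<open>onorm f\<close>.\<close>

lemma riesz:
  fixes f :: "'x ell2 \<Rightarrow> complex"
  assumes f: "bounded_linear f" and c: "\<And>c \<xi>. f (c *\<^sub>C \<xi>) = c * f \<xi>"
  shows "\<exists>v. norm v \<le> onorm f \<and> (\<forall>\<xi>. f \<xi> = cinner v \<xi>)"
proof -
  interpret bounded_linear f by fact
  have "(\<Sum>y\<in>F. (cmod (cnj (f (ket y))))\<^sup>2) \<le> (onorm f)\<^sup>2" if F: "finite F" for F
  proof -
    let ?S = "\<Sum>y\<in>F. (cmod (f (ket y)))\<^sup>2"
    let ?v = "\<Sum>y\<in>F. cnj (f (ket y)) *\<^sub>C ket y"
    have "f ?v = (\<Sum>y\<in>F. f (ket y) * cnj (f (ket y)))"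
      by (simp add: sum c mult.commute)
    also have "\<dots> = complex_of_real ?S"
      by (simp only: complex_norm_square of_real_sum)
    finally have "cmod (f ?v) = cmod (complex_of_real ?S)" by (rule arg_cong)
    then have "?S = cmod (f ?v)" unfolding norm_of_real by (simp add: sum_nonneg)
    also have "\<dots> \<le> onorm f * norm ?v" by (rule onorm[OF f])
    finally have "?S \<le> onorm f * norm ?v" .
    moreover have "(norm ?v)\<^sup>2 = ?S" using ell2_finite_norm[OF F] by simp
    ultimately have "norm ?v * norm ?v \<le> onorm f * norm ?v" by (simp add: power2_eq_square)
    then have "norm ?v \<le> onorm f"
      using onorm_pos_le[OF f] by (cases "?v = 0") (simp_all add: mult_le_cancel_right)
    then have "(norm ?v)\<^sup>2 \<le> (onorm f)\<^sup>2" by (intro power_mono) auto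
    then show ?thesis using \<open>(norm ?v)\<^sup>2 = ?S\<close> by simp
  qed
  then obtain v where v: "coord v = (\<lambda>y. cnj (f (ket y)))" "(norm v)\<^sup>2 \<le> (onorm f)\<^sup>2"
    using coord_of_abs by metis
  have "f \<xi> = cinner v \<xi>" for \<xi>
    by (rule ell2_functional_eqI[OF f bounded_linear_cinner_right])
      (auto simp: c scaleC_complex_def cinner_scaleC_right cinner_ket_right v)
  moreover have "norm v \<le> onorm f" using v(2) onorm_pos_le[OF f] by (simp add: power2_le_iff_abs_le)
  ultimately show ?thesis by blast
qed

section \<open>Bounded operators\<close>

lemma bapply_bounded_linear: "bounded_linear (bapply T)"
  unfolding bapply.rep_eq by (rule blinfun.bounded_linear_right)

lemma norm_bapply: "norm (T \<cdot> \<xi>) \<le> norm T * norm \<xi>"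
  unfolding bapply.rep_eq norm_bop.rep_eq by (rule norm_blinfun)

lemma norm_bop_bound: "0 \<le> b \<Longrightarrow> (\<And>\<xi>. norm (T \<cdot> \<xi>) \<le> b * norm \<xi>) \<Longrightarrow> norm T \<le> b"
  unfolding bapply.rep_eq norm_bop.rep_eq by (rule norm_blinfun_bound)

lemma bapply_zero [simp]: "T \<cdot> 0 = 0" using bapply_simps(2)[of T 0 0] by simp

lemma bapply_minus: "T \<cdot> (- \<xi>) = - (T \<cdot> \<xi>)" "T \<cdot> (\<xi> - \<eta>) = T \<cdot> \<xi> - T \<cdot> \<eta>"
  using bounded_linear.linear[OF bapply_bounded_linear, of T] by (simp_all add: linear_neg linear_diff)

lemma bapply_sum: "T \<cdot> (\<Sum>i\<in>I. f i) = (\<Sum>i\<in>I. T \<cdot> f i)"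
  by (induction I rule: infinite_finite_induct) (auto simp: bapply_simps)

lemma bop_sum_apply: "(\<Sum>i\<in>I. f i) \<cdot> \<xi> = (\<Sum>i\<in>I. f i \<cdot> \<xi>)"
  by (induction I rule: infinite_finite_induct) (auto simp: bop_apply_simps)

lemma bop_exists:
  assumes "\<And>\<xi> \<eta>. f (\<xi> + \<eta>) = f \<xi> + f \<eta>" "\<And>c \<xi>. f (c *\<^sub>C \<xi>) = c *\<^sub>C f \<xi>"
    "\<And>\<xi>. norm (f \<xi>) \<le> K * norm \<xi>"
  shows "\<exists>T. \<forall>\<xi>. T \<cdot> \<xi> = f \<xi>"
proof -
  have bl: "bounded_linear f"
    by (rule bounded_linear_intro[where K = K])
      (use assms in \<open>auto simp: scaleC_of_real[symmetric] mult.commute\<close>)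
  have "Abs_bop (Blinfun f) \<cdot> \<xi> = f \<xi>" for \<xi>
    by (simp add: bapply.rep_eq Abs_bop_inverse bounded_linear_Blinfun_apply bl assms)
  then show ?thesis by blast
qed

lemma bop_eq_ketI: "(\<And>x. S \<cdot> ket x = T \<cdot> ket x) \<Longrightarrow> S = T"
  by (rule bapply_eqI, rule ell2_functional_eqI)
    (auto simp: bapply_bounded_linear bapply_simps)

lemma entry_coord: "entry T x y = coord (T \<cdot> ket y) x"
  by (simp add: entry_def cinner_ket)

lemma bop_eq_entryI: "(\<And>x y. entry S x y = entry T x y) \<Longrightarrow> S = T"
  by (rule bop_eq_ketI, rule ell2_eqI) (simp add: entry_coord)

lemma of_matrix_eq: "(\<And>x y. entry T x y = m x y) \<Longrightarrow> of_matrix m = T"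
  unfolding of_matrix_def by (rule the_equality) (auto intro: bop_eq_entryI)

lemma cinner_eq_leftI: "(\<And>\<xi>. cinner \<xi> \<eta> = cinner \<xi> \<zeta>) \<Longrightarrow> \<eta> = \<zeta>"
  by (rule ell2_eqI) (metis cinner_ket)

lemma cinner_eq_rightI: "(\<And>\<xi>. cinner \<eta> \<xi> = cinner \<zeta> \<xi>) \<Longrightarrow> \<eta> = \<zeta>"
  by (rule cinner_eq_leftI) (metis cinner_commute)

text \<open>As \<open>star_bop\<close> is a definite description, an adjoint must first be produced:
  \<open>riesz\<close> represents \<eta> \<mapsto> <\<xi>, T\<eta>> by a vector, and its norm bound
  makes the dependence on \<xi> bounded.\<close>

lemma cinner_star: "cinner (star T \<cdot> \<xi>) \<eta> = cinner \<xi> (T \<cdot> \<eta>)"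
proof -
  have "\<exists>v. norm v \<le> norm T * norm \<xi> \<and> (\<forall>\<eta>. cinner \<xi> (T \<cdot> \<eta>) = cinner v \<eta>)" for \<xi>
  proof -
    have bl: "bounded_linear (\<lambda>\<eta>. cinner \<xi> (T \<cdot> \<eta>))"
      by (rule bounded_linear_compose[OF bounded_linear_cinner_right bapply_bounded_linear])
    have "onorm (\<lambda>\<eta>. cinner \<xi> (T \<cdot> \<eta>)) \<le> norm T * norm \<xi>"
    proof (rule onorm_bound)
      fix \<eta>
      have "cmod (cinner \<xi> (T \<cdot> \<eta>)) \<le> norm \<xi> * norm (T \<cdot> \<eta>)" by (rule cinner_bound)
      also have "\<dots> \<le> norm \<xi> * (norm T * norm \<eta>)" by (intro mult_left_mono norm_bapply) auto
      finally show "cmod (cinner \<xi> (T \<cdot> \<eta>)) \<le> norm T * norm \<xi> * norm \<eta>" by (simp add: mult_ac)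
    qed simp
    then show ?thesis
      using riesz[OF bl] by (metis bapply_simps(3) cinner_scaleC_right order_trans)
  qed
  then obtain s where s: "norm (s \<xi>) \<le> norm T * norm \<xi>"
      "cinner \<xi> (T \<cdot> \<eta>) = cinner (s \<xi>) \<eta>" for \<xi> \<eta> by metis
  obtain S where S: "S \<cdot> \<xi> = s \<xi>" for \<xi>
    using bop_exists[of s, OF _ _ s(1)]
    by (metis cinner_eq_rightI s(2) cinner_add_left cinner_scaleC_left)
  have "star T = S"
    unfolding star_bop_def
  proof (rule the_equality)
    show "\<forall>\<xi> \<eta>. cinner (S \<cdot> \<xi>) \<eta> = cinner \<xi> (T \<cdot> \<eta>)" by (simp add: S s)
    show "R = S" if "\<forall>\<xi> \<eta>. cinner (R \<cdot> \<xi>) \<eta> = cinner \<xi> (T \<cdot> \<eta>)" for R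
      by (rule bapply_eqI, rule cinner_eq_rightI) (simp add: S s that)
  qed
  then show ?thesis by (simp add: S s)
qed

lemma cinner_star_right: "cinner \<xi> (star T \<cdot> \<eta>) = cinner (T \<cdot> \<xi>) \<eta>"
  by (metis cinner_commute cinner_star)

lemma star_eqI: "(\<And>\<xi> \<eta>. cinner (S \<cdot> \<xi>) \<eta> = cinner \<xi> (T \<cdot> \<eta>)) \<Longrightarrow> star T = S"
  by (rule bapply_eqI, rule cinner_eq_rightI) (simp add: cinner_star)

lemma bop_star_simps [simp]:
  fixes S T :: "'x bop"
  shows "star (star T) = T" "star (S + T) = star S + star T" "star (S - T) = star S - star T"
    "star (c *\<^sub>C T) = cnj c *\<^sub>C star T" "star (r *\<^sub>R T) = r *\<^sub>R star T"
    "star (S * T) = star T * star S"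
    "star (1 :: 'x bop) = 1" "star (0 :: 'x bop) = 0" "star (- T) = - star T"
  by (rule star_eqI;
      simp add: bop_apply_simps cinner_simps cinner_star cinner_star_right)+

lemma bop_star_sum: "star (\<Sum>i\<in>I. f i :: 'x bop) = (\<Sum>i\<in>I. star (f i))"
  by (induction I rule: infinite_finite_induct) auto

lemma entry_star: "entry (star T) x y = cnj (entry T y x)"
  by (simp add: entry_def cinner_star_right) (metis cinner_commute)

lemma norm_star_bop_le: "norm (star T) \<le> norm (T :: 'x bop)"
proof (rule norm_bop_bound)
  fix \<xi>
  have "(norm (star T \<cdot> \<xi>))\<^sup>2 = cmod (cinner (star T \<cdot> \<xi>) (star T \<cdot> \<xi>))"
    by (simp add: cinner_self_norm norm_power)
  also have "\<dots> = cmod (cinner \<xi> (T \<cdot> star T \<cdot> \<xi>))" by (simp add: cinner_star)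
  also have "\<dots> \<le> norm \<xi> * (norm T * norm (star T \<cdot> \<xi>))"
    by (intro order_trans[OF cinner_bound] mult_left_mono norm_bapply) auto
  finally have "norm (star T \<cdot> \<xi>) * norm (star T \<cdot> \<xi>) \<le> (norm T * norm \<xi>) * norm (star T \<cdot> \<xi>)"
    by (simp add: power2_eq_square mult_ac)
  then show "norm (star T \<cdot> \<xi>) \<le> norm T * norm \<xi>"
    by (cases "star T \<cdot> \<xi> = 0") (simp_all add: mult_le_cancel_right)
qed auto

lemma norm_star_bop [simp]: "norm (star T) = norm (T :: 'x bop)"
  using norm_star_bop_le[of T] norm_star_bop_le[of "star T"] by simp

lemma norm_star_mult_bop: "norm (star T * T) = (norm (T :: 'x bop))\<^sup>2"
proof (rule antisym)
  show "norm (star T * T) \<le> (norm T)\<^sup>2"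
    using norm_mult_ineq[of "star T" T] by (simp add: power2_eq_square)
  have "norm T \<le> sqrt (norm (star T * T))"
  proof (rule norm_bop_bound)
    fix \<xi>
    have "(norm (T \<cdot> \<xi>))\<^sup>2 = cmod (cinner \<xi> ((star T * T) \<cdot> \<xi>))"
      by (simp add: bop_apply_simps cinner_star_right cinner_self_norm norm_power)
    also have "\<dots> \<le> norm \<xi> * (norm (star T * T) * norm \<xi>)"
      by (intro order_trans[OF cinner_bound] mult_left_mono norm_bapply) auto
    also have "\<dots> = (sqrt (norm (star T * T)) * norm \<xi>)\<^sup>2"
      by (simp add: power_mult_distrib) (simp add: power2_eq_square)
    finally show "norm (T \<cdot> \<xi>) \<le> sqrt (norm (star T * T)) * norm \<xi>"
      by (rule power2_le_imp_le) simp
  qed simp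
  then show "(norm T)\<^sup>2 \<le> norm (star T * T)"
    by (metis norm_ge_zero power_mono real_sqrt_pow2)
qed

lemma norm_scaleC_bop: "norm (c *\<^sub>C (T :: 'x bop)) = cmod c * norm T"
proof -
  have le: "norm (c *\<^sub>C T) \<le> cmod c * norm T" for c and T :: "'x bop"
    by (rule norm_bop_bound)
      (auto simp: bop_apply_simps ell2_norm_scaleC mult.assoc intro!: mult_left_mono norm_bapply)
  show ?thesis
  proof (cases "c = 0")
    case True
    have "0 *\<^sub>C T = 0" using scaleC_of_real[of 0 T] by simp
    with True show ?thesis by simp
  next
    case False
    have "norm T = norm (inverse c *\<^sub>C c *\<^sub>C T)"
      using False scaleC_of_real[of 1 T] by (simp add: scaleC_scaleC)
    also have "\<dots> \<le> inverse (cmod c) * norm (c *\<^sub>C T)" using le[of "inverse c"] by (simp add: norm_inverse)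
    finally have "cmod c * norm T \<le> norm (c *\<^sub>C T)" using False by (simp add: field_simps)
    with le[of c T] show ?thesis by simp
  qed
qed

lemma scaleC_bop_mult:
  fixes S T :: "'x bop"
  shows "(c *\<^sub>C S) * T = c *\<^sub>C (S * T)" "S * (c *\<^sub>C T) = c *\<^sub>C (S * T)"
  by (auto intro!: bapply_eqI simp: bop_apply_simps bapply_simps)

lemma scaleC_one [simp]: "1 *\<^sub>C x = (x :: 'a::complex_vector)"
  using scaleC_of_real[of 1 x] by simp

lemma scaleC_zero_left [simp]: "0 *\<^sub>C x = (0 :: 'a::complex_vector)"
  using scaleC_of_real[of 0 x] by simp

lemma scaleC_sum_right: "c *\<^sub>C (\<Sum>i\<in>I. f i) = (\<Sum>i\<in>I. c *\<^sub>C (f i :: 'a::complex_vector))"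
  by (induction I rule: infinite_finite_induct) (auto simp: scaleC_add_right)

text \<open>Polarization writes 4 Re <\<eta>, D\<xi>> as a difference of two values of the quadratic
  form, and the parallelogram law bounds these when \<eta> has the norm of \<xi>. Choosing \<eta>
  parallel to D\<xi> turns this into a bound on the operator norm.\<close>

lemma norm_selfadjoint_le:
  fixes D :: "'x bop"
  assumes "star D = D" "0 \<le> c" and b: "\<And>\<xi>. \<bar>Re (cinner \<xi> (D \<cdot> \<xi>))\<bar> \<le> c * (norm \<xi>)\<^sup>2"
  shows "norm D \<le> c"
proof (rule norm_bop_bound[OF assms(2)])
  fix \<xi>
  let ?x = "norm \<xi>" and ?d = "norm (D \<cdot> \<xi>)"
  have sym: "Re (cinner \<xi> (D \<cdot> \<eta>)) = Re (cinner \<eta> (D \<cdot> \<xi>))" for \<xi> \<eta>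
    by (metis assms(1) cinner_commute cinner_star complex_cnj(1) complex.sel(1) complex_surj)
  show "?d \<le> c * ?x"
  proof (cases "\<xi> = 0 \<or> D \<cdot> \<xi> = 0")
    case True then show ?thesis using assms(2) by auto
  next
    case False
    define \<eta> where "\<eta> = (?x / ?d) *\<^sub>R (D \<cdot> \<xi>)"
    have n\<eta>: "norm \<eta> = ?x" using False by (simp add: \<eta>_def)
    have "4 * Re (cinner \<eta> (D \<cdot> \<xi>)) =
        Re (cinner (\<xi> + \<eta>) (D \<cdot> (\<xi> + \<eta>))) - Re (cinner (\<xi> - \<eta>) (D \<cdot> (\<xi> - \<eta>)))"
      using sym[of \<xi> \<eta>] by (simp add: bapply_simps bapply_minus cinner_simps)
    also have "\<dots> \<le> c * (norm (\<xi> + \<eta>))\<^sup>2 + c * (norm (\<xi> - \<eta>))\<^sup>2"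
      using b[of "\<xi> + \<eta>"] b[of "\<xi> - \<eta>"] by linarith
    also have "\<dots> = c * ((norm (\<xi> + \<eta>))\<^sup>2 + (norm (\<xi> - \<eta>))\<^sup>2)" by (simp add: algebra_simps)
    also have "(norm (\<xi> + \<eta>))\<^sup>2 + (norm (\<xi> - \<eta>))\<^sup>2 = 4 * ?x\<^sup>2"
    proof -
      have "(norm (\<xi> + \<eta>))\<^sup>2 + (norm (\<xi> - \<eta>))\<^sup>2 = 2 * ?x\<^sup>2 + 2 * (norm \<eta>)\<^sup>2"
        by (simp add: power2_norm_eq_inner inner_simps)
      then show ?thesis by (simp add: n\<eta>)
    qed
    finally have "Re (cinner \<eta> (D \<cdot> \<xi>)) \<le> c * ?x\<^sup>2" by simp
    moreover have "Re (cinner \<eta> (D \<cdot> \<xi>)) = ?x * ?d"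
      using False by (simp add: \<eta>_def cinner_scaleR_left cinner_self_norm power2_eq_square)
    ultimately have "?x * ?d \<le> ?x * (c * ?x)" by (simp add: power2_eq_square mult_ac)
    then show ?thesis using False by simp
  qed
qed

text \<open>Nonnegativity in the order of the complex numbers includes a vanishing imaginary part.
  Reality of the form at \<xi> + \<eta> and at \<xi> + \<i>\<eta> fixes both parts of the
  off-diagonal values.\<close>

lemma op_pos_selfadjoint:
  assumes "op_pos T" shows "star T = T"
proof -
  have real: "cnj (cinner \<xi> (T \<cdot> \<xi>)) = cinner \<xi> (T \<cdot> \<xi>)" for \<xi>
    using assms by (simp add: op_pos_def less_eq_complex_def complex_eq_iff)
  have "cinner \<xi> (T \<cdot> \<eta>) = cinner (T \<cdot> \<xi>) \<eta>" for \<xi> \<eta>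
  proof -
    have 1: "cnj (cinner \<xi> (T \<cdot> \<eta>)) + cnj (cinner \<eta> (T \<cdot> \<xi>)) = cinner \<xi> (T \<cdot> \<eta>) + cinner \<eta> (T \<cdot> \<xi>)"
      using real[of "\<xi> + \<eta>"] real[of \<xi>] real[of \<eta>]
      by (simp add: bapply_simps cinner_simps algebra_simps)
    have 2: "cnj (\<i> * cinner \<xi> (T \<cdot> \<eta>)) + cnj (- \<i> * cinner \<eta> (T \<cdot> \<xi>))
        = \<i> * cinner \<xi> (T \<cdot> \<eta>) + - \<i> * cinner \<eta> (T \<cdot> \<xi>)"
      using real[of "\<xi> + \<i> *\<^sub>C \<eta>"] real[of \<xi>] real[of \<eta>]
      by (simp add: bapply_simps cinner_simps algebra_simps)
    have "cinner \<xi> (T \<cdot> \<eta>) = cnj (cinner \<eta> (T \<cdot> \<xi>))"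
      using 1 2 by (auto simp: complex_eq_iff)
    then show ?thesis by (metis cinner_commute)
  qed
  then show ?thesis by (intro star_eqI) simp
qed

section \<open>Slices and tensor products\<close>

text \<open>The component of a vector at the basis element s of the second factor; as a map it is
  the adjoint of \<open>\<lambda>\<xi>. ten \<xi> (ket s)\<close>. Operators on the product space
  are compared slice by slice.\<close>

definition slice :: "'y \<Rightarrow> ('h \<times> 'y) ell2 \<Rightarrow> 'h ell2" where
  "slice s \<zeta> = Abs_ell2 (\<lambda>h. coord \<zeta> (h, s))"

lemma coord_slice: "coord (slice s \<zeta>) h = coord \<zeta> (h, s)"
  and norm_slice: "norm (slice s \<zeta>) \<le> norm \<zeta>"
proof -
  have "(\<Sum>h\<in>F. (cmod (coord \<zeta> (h, s)))\<^sup>2) \<le> (norm \<zeta>)\<^sup>2" if "finite F" for F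
  proof -
    have "(\<Sum>h\<in>F. (cmod (coord \<zeta> (h, s)))\<^sup>2) = (\<Sum>p\<in>(\<lambda>h. (h, s)) ` F. (cmod (coord \<zeta> p))\<^sup>2)"
      by (subst sum.reindex) (auto simp: inj_on_def)
    also have "\<dots> \<le> (norm \<zeta>)\<^sup>2" using that by (intro finite_sum_le_norm) auto
    finally show ?thesis .
  qed
  then obtain \<xi> where \<xi>: "coord \<xi> = (\<lambda>h. coord \<zeta> (h, s))" "(norm \<xi>)\<^sup>2 \<le> (norm \<zeta>)\<^sup>2"
    using coord_of_abs[of "\<lambda>h. coord \<zeta> (h, s)"] by blast
  then have "slice s \<zeta> = \<xi>" by (simp add: slice_def coord_inverse flip: \<xi>(1))
  with \<xi> show "coord (slice s \<zeta>) h = coord \<zeta> (h, s)" "norm (slice s \<zeta>) \<le> norm \<zeta>"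
    by (simp_all add: power2_le_iff_abs_le)
qed

lemma slice_simps [simp]:
  "slice s (\<zeta> + \<eta>) = slice s \<zeta> + slice s \<eta>"
  "slice s (\<zeta> - \<eta>) = slice s \<zeta> - slice s \<eta>"
  "slice s (- \<zeta>) = - slice s \<zeta>"
  "slice s 0 = 0"
  "slice s (c *\<^sub>C \<zeta>) = c *\<^sub>C slice s \<zeta>"
  "slice s (r *\<^sub>R \<zeta>) = r *\<^sub>R slice s \<zeta>"
  by (auto intro!: ell2_eqI simp: coord_slice)

lemma slice_sum: "slice s (\<Sum>i\<in>I. f i) = (\<Sum>i\<in>I. slice s (f i))"
  by (induction I rule: infinite_finite_induct) auto

lemma slice_bounded_linear: "bounded_linear (slice s)"
  by (rule bounded_linear_intro[where K = 1]) (auto simp: norm_slice)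

lemma slice_eqI: "(\<And>s. slice s \<zeta> = slice s \<eta>) \<Longrightarrow> \<zeta> = \<eta>"
  by (rule ell2_eqI) (metis coord_slice prod.collapse)

definition ten :: "'h ell2 \<Rightarrow> 'y ell2 \<Rightarrow> ('h \<times> 'y) ell2" where
  "ten \<xi> \<eta> = Abs_ell2 (\<lambda>(h, s). coord \<xi> h * coord \<eta> s)"

lemma coord_ten: "coord (ten \<xi> \<eta>) (h, s) = coord \<xi> h * coord \<eta> s"
  and norm_ten: "norm (ten \<xi> \<eta>) \<le> norm \<xi> * norm \<eta>"
proof -
  let ?f = "\<lambda>(h, s). coord \<xi> h * coord \<eta> s"
  have "(\<Sum>p\<in>F. (cmod (?f p))\<^sup>2) \<le> (norm \<xi> * norm \<eta>)\<^sup>2" if "finite F" for F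
  proof -
    have "(\<Sum>p\<in>F. (cmod (?f p))\<^sup>2) \<le> (\<Sum>p\<in>fst ` F \<times> snd ` F. (cmod (?f p))\<^sup>2)"
      using that by (intro sum_mono2) (auto intro: rev_image_eqI)
    also have "\<dots> = (\<Sum>h\<in>fst ` F. (cmod (coord \<xi> h))\<^sup>2) * (\<Sum>s\<in>snd ` F. (cmod (coord \<eta> s))\<^sup>2)"
      by (simp add: sum_product sum.cartesian_product norm_mult power_mult_distrib case_prod_unfold)
    also have "\<dots> \<le> (norm \<xi>)\<^sup>2 * (norm \<eta>)\<^sup>2"
      using that by (intro mult_mono finite_sum_le_norm) (auto intro: sum_nonneg)
    finally show ?thesis by (simp add: power_mult_distrib)
  qed
  then obtain \<zeta> where \<zeta>: "coord \<zeta> = ?f" "(norm \<zeta>)\<^sup>2 \<le> (norm \<xi> * norm \<eta>)\<^sup>2"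
    using coord_of_abs[of ?f] by blast
  then have "ten \<xi> \<eta> = \<zeta>" by (simp add: ten_def coord_inverse flip: \<zeta>(1))
  with \<zeta> show "coord (ten \<xi> \<eta>) (h, s) = coord \<xi> h * coord \<eta> s" "norm (ten \<xi> \<eta>) \<le> norm \<xi> * norm \<eta>"
    by (auto intro: power2_le_imp_le)
qed

lemma slice_ten: "slice s (ten \<xi> \<eta>) = coord \<eta> s *\<^sub>C \<xi>"
  by (rule ell2_eqI) (simp add: coord_slice coord_ten)

lemma ket_ten: "ket (h, s) = ten (ket h) (ket s)"
  by (rule ell2_eqI) (auto simp: coord_ten coord_ket split: if_splits)

lemma ten_linear_left:
  "ten (\<xi> + \<xi>') \<eta> = ten \<xi> \<eta> + ten \<xi>' \<eta>" "ten (c *\<^sub>C \<xi>) \<eta> = c *\<^sub>C ten \<xi> \<eta>"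
  "ten 0 \<eta> = 0"
  by (auto intro!: slice_eqI simp: slice_ten scaleC_add_right scaleC_scaleC mult.commute)

lemma cinner_ten_ket: "cinner (ten \<xi> (ket t)) \<zeta> = cinner \<xi> (slice t \<zeta>)"
proof (rule ell2_functional_eqI[OF bounded_linear_cinner_right])
  show "bounded_linear (\<lambda>\<zeta>. cinner \<xi> (slice t \<zeta>))"
    by (rule bounded_linear_compose[OF bounded_linear_cinner_right slice_bounded_linear])
  show "cinner (ten \<xi> (ket t)) (ket x) = cinner \<xi> (slice t (ket x))" for x
  proof (cases x)
    case (Pair h s)
    have "slice t (ket x) = coord (ket s) t *\<^sub>C ket h" by (simp add: Pair ket_ten slice_ten)
    then show ?thesis by (simp add: Pair cinner_ket_right coord_ten cinner_scaleC_right coord_ket)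
  qed
qed (auto simp: cinner_simps scaleC_complex_def)

text \<open>The vector ?v is the projection of \<zeta> onto the slices in F. Its inner product with
  \<zeta> is its own squared norm, so Cauchy-Schwarz gives Bessel's inequality for slices.\<close>

lemma slice_finite_norm: "finite F \<Longrightarrow> (\<Sum>t\<in>F. (norm (slice t \<zeta>))\<^sup>2) \<le> (norm \<zeta>)\<^sup>2"
proof -
  assume F: "finite F"
  let ?v = "\<Sum>t\<in>F. ten (slice t \<zeta>) (ket t)"
  have sl: "slice t ?v = (if t \<in> F then slice t \<zeta> else 0)" for t
    using F by (simp add: slice_sum slice_ten coord_ket if_distrib[of "\<lambda>c. c *\<^sub>C _"] cong: if_cong)
  have "cinner ?v \<zeta> = complex_of_real (\<Sum>t\<in>F. (norm (slice t \<zeta>))\<^sup>2)"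
    by (simp add: cinner_sum_left cinner_ten_ket cinner_self_norm)
  moreover have "cinner ?v ?v = complex_of_real (\<Sum>t\<in>F. (norm (slice t \<zeta>))\<^sup>2)"
  proof -
    have "cinner ?v ?v = (\<Sum>t\<in>F. cinner (slice t \<zeta>) (slice t ?v))"
      by (subst cinner_sum_left) (simp add: cinner_ten_ket)
    also have "\<dots> = (\<Sum>t\<in>F. cinner (slice t \<zeta>) (slice t \<zeta>))"
      by (rule sum.cong) (simp_all add: sl)
    finally show ?thesis by (simp add: cinner_self_norm)
  qed
  then have eq: "(norm ?v)\<^sup>2 = (\<Sum>t\<in>F. (norm (slice t \<zeta>))\<^sup>2)"
    unfolding cinner_self_norm of_real_eq_iff .
  ultimately have "cmod (cinner ?v \<zeta>) = (norm ?v)\<^sup>2"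
    unfolding eq[symmetric] by (simp only: norm_of_real) simp
  have "norm ?v * norm ?v \<le> norm ?v * norm \<zeta>"
    using cinner_bound[of ?v \<zeta>] by (simp add: \<open>cmod _ = _\<close> power2_eq_square)
  then have "norm ?v \<le> norm \<zeta>" by (cases "?v = 0") (simp_all add: mult_le_cancel_left)
  then show ?thesis unfolding eq[symmetric] by (intro power_mono) auto
qed

text \<open>The block-diagonal operator with blocks S t. Since slices determine a vector, the
  specification has at most one solution; it has one whenever the blocks are uniformly
  bounded.\<close>

definition bdiag :: "('y \<Rightarrow> 'h bop) \<Rightarrow> ('h \<times> 'y) bop" where
  "bdiag S = (SOME T. \<forall>\<zeta> t. slice t (T \<cdot> \<zeta>) = S t \<cdot> slice t \<zeta>)"

lemma slice_bdiag:
  assumes "\<And>t. norm (S t) \<le> M"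
  shows "slice t (bdiag S \<cdot> \<zeta>) = S t \<cdot> slice t \<zeta>"
    and norm_bdiag: "norm (bdiag S) \<le> M"
proof -
  have M: "0 \<le> M" using order_trans[OF norm_ge_zero assms] .
  have "\<exists>v. (\<forall>t. slice t v = S t \<cdot> slice t \<zeta>) \<and> norm v \<le> M * norm \<zeta>" for \<zeta>
  proof -
    let ?f = "\<lambda>(h, t). coord (S t \<cdot> slice t \<zeta>) h"
    have "(\<Sum>p\<in>F. (cmod (?f p))\<^sup>2) \<le> (M * norm \<zeta>)\<^sup>2" if F: "finite F" for F
    proof -
      have "(\<Sum>p\<in>F. (cmod (?f p))\<^sup>2) \<le> (\<Sum>p\<in>fst ` F \<times> snd ` F. (cmod (?f p))\<^sup>2)"
        using that by (intro sum_mono2) (auto intro: rev_image_eqI)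
      also have "\<dots> = (\<Sum>t\<in>snd ` F. \<Sum>h\<in>fst ` F. (cmod (coord (S t \<cdot> slice t \<zeta>) h))\<^sup>2)"
        by (subst sum.swap) (simp add: sum.cartesian_product case_prod_unfold)
      also have "\<dots> \<le> (\<Sum>t\<in>snd ` F. (norm (S t \<cdot> slice t \<zeta>))\<^sup>2)"
        using F by (intro sum_mono finite_sum_le_norm) auto
      also have "\<dots> \<le> (\<Sum>t\<in>snd ` F. (M * norm (slice t \<zeta>))\<^sup>2)"
        by (intro sum_mono power_mono order_trans[OF norm_bapply] mult_right_mono assms) auto
      also have "\<dots> = M\<^sup>2 * (\<Sum>t\<in>snd ` F. (norm (slice t \<zeta>))\<^sup>2)"
        by (simp add: power_mult_distrib sum_distrib_left)
      also have "\<dots> \<le> M\<^sup>2 * (norm \<zeta>)\<^sup>2"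
        using F by (intro mult_left_mono slice_finite_norm) auto
      finally show ?thesis by (simp add: power_mult_distrib)
    qed
    then have "\<exists>v. coord v = ?f \<and> (norm v)\<^sup>2 \<le> (M * norm \<zeta>)\<^sup>2" by (intro coord_of_abs)
    then obtain v where v: "coord v = ?f" "(norm v)\<^sup>2 \<le> (M * norm \<zeta>)\<^sup>2" by (elim exE conjE)
    have "slice t v = S t \<cdot> slice t \<zeta>" for t by (rule ell2_eqI) (simp add: coord_slice v)
    moreover have "norm v \<le> M * norm \<zeta>" by (rule power2_le_imp_le[OF v(2)]) (simp add: M)
    ultimately show ?thesis by (intro exI conjI allI)
  qed
  from choice[OF allI[OF this]]
  obtain f where "\<forall>\<zeta>. (\<forall>t. slice t (f \<zeta>) = S t \<cdot> slice t \<zeta>) \<and> norm (f \<zeta>) \<le> M * norm \<zeta>" ..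
  then have f: "slice t (f \<zeta>) = S t \<cdot> slice t \<zeta>" "norm (f \<zeta>) \<le> M * norm \<zeta>" for t \<zeta>
    by simp_all
  have "f (\<xi> + \<eta>) = f \<xi> + f \<eta>" "f (c *\<^sub>C \<xi>) = c *\<^sub>C f \<xi>" for \<xi> \<eta> c
    by (auto intro!: slice_eqI simp: f bapply_simps)
  then obtain T where T: "T \<cdot> \<xi> = f \<xi>" for \<xi> using bop_exists[of f M] f(2) by blast
  have "\<exists>T. \<forall>\<zeta> t. slice t (T \<cdot> \<zeta>) = S t \<cdot> slice t \<zeta>" by (rule exI[of _ T]) (simp add: T f)
  from someI_ex[OF this] show sl: "slice t (bdiag S \<cdot> \<zeta>) = S t \<cdot> slice t \<zeta>" for t \<zeta>
    unfolding bdiag_def by (elim allE)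
  have "bdiag S \<cdot> \<zeta> = f \<zeta>" for \<zeta> by (rule slice_eqI) (simp add: sl f)
  then show "norm (bdiag S) \<le> M" by (intro norm_bop_bound M) (simp add: f)
qed

text \<open>Pullback of coordinates along f, a contraction for injective f. It provides both the
  flip of the tensor factors and the permutation operators.\<close>

definition rx :: "('x \<Rightarrow> 'y) \<Rightarrow> 'y ell2 \<Rightarrow> 'x ell2" where
  "rx f \<xi> = Abs_ell2 (\<lambda>x. coord \<xi> (f x))"

lemma coord_rx: "inj f \<Longrightarrow> coord (rx f \<xi>) x = coord \<xi> (f x)"
  and norm_rx: "inj f \<Longrightarrow> norm (rx f \<xi>) \<le> norm \<xi>"
proof -
  assume f: "inj f"
  have "(\<Sum>x\<in>F. (cmod (coord \<xi> (f x)))\<^sup>2) \<le> (norm \<xi>)\<^sup>2" if "finite F" for F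
  proof -
    have "(\<Sum>x\<in>F. (cmod (coord \<xi> (f x)))\<^sup>2) = (\<Sum>p\<in>f ` F. (cmod (coord \<xi> p))\<^sup>2)"
      using f by (subst sum.reindex) (auto simp: inj_on_def)
    also have "\<dots> \<le> (norm \<xi>)\<^sup>2" using that by (intro finite_sum_le_norm) auto
    finally show ?thesis .
  qed
  then obtain \<eta> where \<eta>: "coord \<eta> = (\<lambda>x. coord \<xi> (f x))" "(norm \<eta>)\<^sup>2 \<le> (norm \<xi>)\<^sup>2"
    using coord_of_abs[of "\<lambda>x. coord \<xi> (f x)"] by blast
  then have "rx f \<xi> = \<eta>" by (simp add: rx_def coord_inverse flip: \<eta>(1))
  with \<eta> show "coord (rx f \<xi>) x = coord \<xi> (f x)" "norm (rx f \<xi>) \<le> norm \<xi>"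
    by (simp_all add: power2_le_iff_abs_le)
qed

lemma bdiag_const_ten: "bdiag (\<lambda>_. X) \<cdot> ten \<xi> \<eta> = ten (X \<cdot> \<xi>) \<eta>"
  by (rule slice_eqI) (simp add: slice_bdiag[where M = "norm X"] slice_ten bapply_simps)

text \<open>S \<otimes> T is the product of S \<otimes> 1, a constant \<open>bdiag\<close>, and 1
  \<otimes> T, a constant \<open>bdiag\<close> conjugated by the flip of the two factors. This is
  the boundedness that the matrix definition of \<open>tensor\<close> presupposes.\<close>

lemma tensor_exists: "\<exists>V :: ('h \<times> 'y) bop. \<forall>\<xi> \<eta>. V \<cdot> ten \<xi> \<eta> = ten (S \<cdot> \<xi>) (T \<cdot> \<eta>)"
proof -
  let ?w = "prod.swap :: 'h \<times> 'y \<Rightarrow> 'y \<times> 'h" and ?w' = "prod.swap :: 'y \<times> 'h \<Rightarrow> 'h \<times> 'y"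
  have w: "rx ?w (rx ?w' \<zeta>) = \<zeta>" "rx ?w (ten \<eta> \<xi>) = ten \<xi> \<eta>" "rx ?w' (ten \<xi> \<eta>) = ten \<eta> \<xi>" for \<zeta> \<xi> \<eta>
    by (auto intro!: ell2_eqI simp: coord_rx coord_ten mult.commute)
  have "\<exists>R. \<forall>\<zeta>. R \<cdot> \<zeta> = rx ?w (bdiag (\<lambda>_. T) \<cdot> rx ?w' \<zeta>)"
  proof (rule bop_exists[where K = "norm (bdiag (\<lambda>_::'h. T))"])
    show "norm (rx ?w (bdiag (\<lambda>_. T) \<cdot> rx ?w' \<zeta>)) \<le> norm (bdiag (\<lambda>_::'h. T)) * norm \<zeta>" for \<zeta>
      by (intro order_trans[OF norm_rx] order_trans[OF norm_bapply] mult_left_mono norm_rx) auto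
    have rl: "rx ?w' (\<zeta> + \<eta>) = rx ?w' \<zeta> + rx ?w' \<eta>" "rx ?w' (c *\<^sub>C \<zeta>) = c *\<^sub>C rx ?w' \<zeta>" for \<zeta> \<eta> c
      by (auto intro!: ell2_eqI simp: coord_rx)
    show "rx ?w (bdiag (\<lambda>_. T) \<cdot> rx ?w' (\<zeta> + \<eta>)) =
        rx ?w (bdiag (\<lambda>_. T) \<cdot> rx ?w' \<zeta>) + rx ?w (bdiag (\<lambda>_. T) \<cdot> rx ?w' \<eta>)"
      "rx ?w (bdiag (\<lambda>_. T) \<cdot> rx ?w' (c *\<^sub>C \<zeta>)) = c *\<^sub>C rx ?w (bdiag (\<lambda>_. T) \<cdot> rx ?w' \<zeta>)" for \<zeta> \<eta> c
      unfolding rl bapply_simps by (auto intro!: ell2_eqI simp: coord_rx)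
  qed
  then obtain R where R: "R \<cdot> \<zeta> = rx ?w (bdiag (\<lambda>_. T) \<cdot> rx ?w' \<zeta>)" for \<zeta> by blast
  have "(bdiag (\<lambda>_. S) * R) \<cdot> ten \<xi> \<eta> = ten (S \<cdot> \<xi>) (T \<cdot> \<eta>)" for \<xi> \<eta>
    by (simp only: bop_apply_simps R w bdiag_const_ten)
  then show ?thesis by auto
qed

lemma tensor_ten: "(S \<otimes>\<^sub>o T) \<cdot> ten \<xi> \<eta> = ten (S \<cdot> \<xi>) (T \<cdot> \<eta>)"
proof -
  obtain V where V: "V \<cdot> ten \<xi> \<eta> = ten (S \<cdot> \<xi>) (T \<cdot> \<eta>)" for \<xi> \<eta> using tensor_exists[of S T] by blast
  have "S \<otimes>\<^sub>o T = V" unfolding tensor_def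
    by (rule of_matrix_eq) (auto simp: entry_coord ket_ten V coord_ten)
  then show ?thesis by (simp add: V)
qed

lemma entry_tensor: "entry (S \<otimes>\<^sub>o T) (h, s) (k, t) = entry S h k * entry T s t"
  by (simp add: entry_coord ket_ten tensor_ten coord_ten)

lemma bop_eq_tenI: "(\<And>\<xi> t. S \<cdot> ten \<xi> (ket t) = T \<cdot> ten \<xi> (ket t)) \<Longrightarrow> S = T"
  by (rule bop_eq_ketI) (metis ket_ten prod.collapse)

lemma tensor_mult: "(S \<otimes>\<^sub>o T) * (S' \<otimes>\<^sub>o T') = (S * S') \<otimes>\<^sub>o (T * T')"
  by (rule bop_eq_tenI) (simp add: bop_apply_simps tensor_ten)

lemma entry_simps:
  "entry (S + T) x y = entry S x y + entry T x y"
  "entry (c *\<^sub>C S) x y = c * entry S x y"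
  "entry 0 x y = 0"
  by (simp_all add: entry_coord bop_apply_simps)

lemma tensor_star: "star (S \<otimes>\<^sub>o T) = star S \<otimes>\<^sub>o star T"
  by (rule bop_eq_entryI) (auto simp: entry_star entry_tensor)

lemma tensor_add_left: "(S + S') \<otimes>\<^sub>o T = S \<otimes>\<^sub>o T + S' \<otimes>\<^sub>o T"
  by (rule bop_eq_entryI) (auto simp: entry_simps entry_tensor algebra_simps)

lemma tensor_scaleC_left: "(c *\<^sub>C S) \<otimes>\<^sub>o T = c *\<^sub>C (S \<otimes>\<^sub>o T)"
  by (rule bop_eq_entryI) (auto simp: entry_simps entry_tensor algebra_simps)

lemma tensor_one: "(1 :: 'h bop) \<otimes>\<^sub>o (1 :: 'y bop) = 1"
  by (rule bop_eq_tenI) (simp add: bop_apply_simps tensor_ten)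

text \<open>The assumption says that row s of T has at most one nonzero entry, c in column t. Matrix
  units, coordinate projections and permutations are all of this kind.\<close>

lemma slice_tensor:
  assumes "\<And>\<eta>. coord (T \<cdot> \<eta>) s = c * coord \<eta> t"
  shows "slice s ((S \<otimes>\<^sub>o T) \<cdot> \<zeta>) = c *\<^sub>C (S \<cdot> slice t \<zeta>)"
proof (rule ell2_functional_eqI[where f = "\<lambda>\<zeta>. slice s ((S \<otimes>\<^sub>o T) \<cdot> \<zeta>)" and g = "\<lambda>\<zeta>. c *\<^sub>C (S \<cdot> slice t \<zeta>)"])
  show "bounded_linear (\<lambda>\<zeta>. slice s ((S \<otimes>\<^sub>o T) \<cdot> \<zeta>))"
    by (rule bounded_linear_compose[OF slice_bounded_linear bapply_bounded_linear])
  show "bounded_linear (\<lambda>\<zeta>. c *\<^sub>C (S \<cdot> slice t \<zeta>))"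
    by (intro bounded_linear_compose[OF bounded_linear_scaleC_ell2]
        bounded_linear_compose[OF bapply_bounded_linear] slice_bounded_linear)
  show "slice s ((S \<otimes>\<^sub>o T) \<cdot> ket x) = c *\<^sub>C S \<cdot> slice t (ket x)" for x
    by (cases x) (simp add: ket_ten tensor_ten slice_ten assms bapply_simps scaleC_scaleC)
qed (auto simp: bapply_simps scaleC_scaleC mult.commute)

section \<open>Permutation operators, coordinate projections and matrix units\<close>

lemma coord_perm:
  assumes "bij f"
  shows "coord (of_matrix (\<lambda>s t. if s = f t then 1 else 0) \<cdot> \<xi>) s = coord \<xi> (inv f s)"
proof -
  have i: "inj (inv f)" using assms by (simp add: bij_imp_bij_inv bij_is_inj)
  have "\<exists>T. \<forall>\<xi>. T \<cdot> \<xi> = rx (inv f) \<xi>"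
    by (rule bop_exists[where K = 1]) (auto intro!: ell2_eqI simp: coord_rx[OF i] norm_rx[OF i])
  then obtain T where T: "T \<cdot> \<xi> = rx (inv f) \<xi>" for \<xi> by blast
  have "of_matrix (\<lambda>s t. if s = f t then 1 else 0) = T"
    by (rule of_matrix_eq)
      (auto simp: entry_coord T coord_rx[OF i] coord_ket assms bij_is_inj bij_is_surj
        inv_f_f surj_f_inv_f bij_inv_eq_iff)
  then show ?thesis by (simp add: T coord_rx[OF i])
qed

lemma coord_coord_proj: "coord (coord_proj F \<cdot> \<xi>) s = (if s \<in> F then coord \<xi> s else 0)"
proof -
  have ex: "\<exists>v. (\<forall>s. coord v s = (if s \<in> F then coord \<xi> s else 0)) \<and> norm v \<le> norm \<xi>" for \<xi>
  proof -
    have "(\<Sum>s\<in>G. (cmod (if s \<in> F then coord \<xi> s else 0))\<^sup>2) \<le> (norm \<xi>)\<^sup>2" if "finite G" for G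
      by (rule order_trans[OF _ finite_sum_le_norm[OF that]]) (auto intro!: sum_mono)
    then have "\<exists>v. coord v = (\<lambda>s. if s \<in> F then coord \<xi> s else 0) \<and> (norm v)\<^sup>2 \<le> (norm \<xi>)\<^sup>2"
      by (intro coord_of_abs)
    then obtain v where v: "coord v = (\<lambda>s. if s \<in> F then coord \<xi> s else 0)" "(norm v)\<^sup>2 \<le> (norm \<xi>)\<^sup>2"
      by (elim exE conjE)
    show ?thesis by (rule exI[of _ v]) (simp add: v(1) power2_le_imp_le[OF v(2)])
  qed
  from choice[OF allI[OF this]]
  obtain f where "\<forall>\<xi>. (\<forall>s. coord (f \<xi>) s = (if s \<in> F then coord \<xi> s else 0)) \<and> norm (f \<xi>) \<le> norm \<xi>" ..
  then have f: "coord (f \<xi>) s = (if s \<in> F then coord \<xi> s else 0)" "norm (f \<xi>) \<le> norm \<xi>" for \<xi> s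
    by simp_all
  have "\<exists>T. \<forall>\<xi>. T \<cdot> \<xi> = f \<xi>"
    by (rule bop_exists[where K = 1]) (auto intro!: ell2_eqI simp: f)
  then obtain T where T: "T \<cdot> \<xi> = f \<xi>" for \<xi> by blast
  have "coord_proj F = T" unfolding coord_proj_def
    by (rule of_matrix_eq) (auto simp: entry_coord T f coord_ket)
  then show ?thesis by (simp add: T f)
qed

lemma matrix_unit_apply: "matrix_unit s t \<cdot> \<xi> = coord \<xi> t *\<^sub>C ket s"
proof -
  have "\<exists>T. \<forall>\<xi>. T \<cdot> \<xi> = coord \<xi> t *\<^sub>C ket s"
  proof (rule bop_exists[where K = 1])
    show "norm (coord \<xi> t *\<^sub>C ket s) \<le> 1 * norm \<xi>" for \<xi>
      using cinner_bound[of "ket t" \<xi>] by (simp add: ell2_norm_scaleC cinner_ket)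
  qed (auto simp: scaleC_add_left scaleC_scaleC)
  then obtain T where T: "T \<cdot> \<xi> = coord \<xi> t *\<^sub>C ket s" for \<xi> by blast
  have "matrix_unit s t = T" unfolding matrix_unit_def
    by (rule of_matrix_eq) (auto simp: entry_coord T coord_ket)
  then show ?thesis by (simp add: T)
qed

lemma slice_tensor_matrix_unit:
  "slice p ((S \<otimes>\<^sub>o matrix_unit s t) \<cdot> \<zeta>) = (if p = s then S \<cdot> slice t \<zeta> else 0)"
  using slice_tensor[of "matrix_unit s t" p "if p = s then 1 else 0" t S \<zeta>]
  by (auto simp: matrix_unit_apply coord_ket)

lemma slice_coord_proj: "slice s ((1 \<otimes>\<^sub>o coord_proj F) \<cdot> \<zeta>) = (if s \<in> F then slice s \<zeta> else 0)"
  using slice_tensor[of "coord_proj F" s "if s \<in> F then 1 else 0" s 1 \<zeta>]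
  by (auto simp: coord_coord_proj bop_apply_simps)

lemma matrix_unit_star: "star (matrix_unit s t) = matrix_unit t s"
  by (rule bop_eq_entryI) (simp add: entry_star, simp add: entry_coord matrix_unit_apply coord_ket)

section \<open>Operators as matrices of operators on the first factor\<close>

definition block :: "('h \<times> 'y) bop \<Rightarrow> 'y \<Rightarrow> 'y \<Rightarrow> 'h bop" where
  "block X s t = (SOME T. \<forall>\<xi>. T \<cdot> \<xi> = slice s (X \<cdot> ten \<xi> (ket t)))"

lemma block_apply: "block X s t \<cdot> \<xi> = slice s (X \<cdot> ten \<xi> (ket t))"
proof -
  have "\<exists>T. \<forall>\<xi>. T \<cdot> \<xi> = slice s (X \<cdot> ten \<xi> (ket t))"
  proof (rule bop_exists[where K = "norm X"])
    show "norm (slice s (X \<cdot> ten \<xi> (ket t))) \<le> norm X * norm \<xi>" for \<xi>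
      using norm_ten[of \<xi> "ket t"]
      by (intro order_trans[OF norm_slice] order_trans[OF norm_bapply] mult_left_mono) auto
  qed (auto simp: ten_linear_left bapply_simps)
  from someI_ex[OF this] show ?thesis unfolding block_def by (elim allE)
qed

lemma norm_block: "norm (block X s t) \<le> norm X"
proof (rule norm_bop_bound)
  fix \<xi>
  have "norm (block X s t \<cdot> \<xi>) \<le> norm X * norm (ten \<xi> (ket t))"
    unfolding block_apply by (rule order_trans[OF norm_slice norm_bapply])
  also have "\<dots> \<le> norm X * norm \<xi>"
    using norm_ten[of \<xi> "ket t"] by (intro mult_left_mono) auto
  finally show "norm (block X s t \<cdot> \<xi>) \<le> norm X * norm \<xi>" .
qed simp

lemma block_simps:
  "block (X + Y) s t = block X s t + block Y s t"
  "block (c *\<^sub>C X) s t = c *\<^sub>C block X s t"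
  "block 0 s t = 0"
  by (auto intro!: bapply_eqI simp: block_apply bop_apply_simps)

lemma block_sum: "block (\<Sum>i\<in>I. X i) s t = (\<Sum>i\<in>I. block (X i) s t)"
  by (induction I rule: infinite_finite_induct) (auto simp: block_simps)

lemma block_tensor: "block (S \<otimes>\<^sub>o T) s t = entry T s t *\<^sub>C S"
  by (rule bapply_eqI) (simp add: block_apply tensor_ten slice_ten bop_apply_simps entry_coord)

lemma block_tensor_matrix_unit:
  "block (S \<otimes>\<^sub>o matrix_unit p q) s t = (if s = p \<and> t = q then S else 0)"
  by (simp add: block_tensor entry_coord matrix_unit_apply coord_ket)

lemma bop_eq_blockI: "(\<And>s t. block X s t = block Y s t) \<Longrightarrow> X = Y"
  by (rule bop_eq_tenI, rule slice_eqI) (metis block_apply)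

section \<open>Square roots in C*-algebras\<close>

lemma star_zero [simp]: "star (0 :: 'a::cstar_algebra) = 0"
  using star_add[of "0 :: 'a" 0] by simp

lemma star_minus: "star (- x) = - star (x :: 'a::cstar_algebra)"
  using star_add[of x "- x"] by (simp add: eq_neg_iff_add_eq_0 add.commute)

lemma star_diff: "star (x - y) = star x - star (y :: 'a::cstar_algebra)"
  using star_add[of x "- y"] by (simp add: star_minus)

lemma star_one [simp]: "star (1 :: 'a::cstar_algebra) = 1"
  by (metis mult_1 mult_1_right star_mult star_star)

lemma star_scaleR: "star (r *\<^sub>R x) = r *\<^sub>R star (x :: 'a::cstar_algebra)"
  using star_scaleC[of "complex_of_real r" x] by (simp add: scaleC_of_real)

lemma norm_star: "norm (star x) = norm (x :: 'a::cstar_algebra)"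
proof -
  have le: "norm x \<le> norm (star x)" for x :: 'a
  proof (cases "x = 0")
    case False
    have "norm x * norm x \<le> norm (star x) * norm x"
      using norm_mult_ineq[of "star x" x] by (simp add: norm_star_mult power2_eq_square)
    then show ?thesis using False by simp
  qed simp
  show ?thesis using le[of x] le[of "star x"] by (simp add: star_star)
qed

lemma bounded_linear_star: "bounded_linear (star :: 'a::cstar_algebra \<Rightarrow> 'a)"
  by (rule bounded_linear_intro[where K = 1]) (auto simp: star_add star_scaleR norm_star)

text \<open>A fixed point y satisfies 2y = z + y^2, that is (1 - y)^2 = 1 - z, so the iteration aims
  at 1 minus a square root of 1 - z.\<close>

primrec sqrt_iter :: "'a::real_algebra_1 \<Rightarrow> nat \<Rightarrow> 'a" where
  "sqrt_iter z 0 = 0"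
| "sqrt_iter z (Suc n) = (1/2) *\<^sub>R (z + sqrt_iter z n * sqrt_iter z n)"

lemma sqrt_iter_commute: "x * z = z * x \<Longrightarrow> x * sqrt_iter z n = sqrt_iter z n * x"
proof (induction n)
  case (Suc n)
  then have "x * (sqrt_iter z n * sqrt_iter z n) = sqrt_iter z n * sqrt_iter z n * x"
    by (metis mult.assoc)
  with Suc.prems show ?case by (simp add: distrib_left distrib_right)
qed simp

lemma sqrt_iter_real: "0 \<le> sqrt_iter (1::real) n \<and> sqrt_iter (1::real) n \<le> 1"
proof (induction n)
  case (Suc n)
  then have "sqrt_iter (1::real) n * sqrt_iter 1 n \<le> 1" by (simp add: mult_le_one)
  with Suc show ?case by simp
qed simp

text \<open>The increments are polynomials in \<open>z\<close> with nonnegative coefficients, hence dominated by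
  those of the scalar iteration at \<open>1\<close>; this gives convergence on the closed unit ball.\<close>

lemma sqrt_iter_step:
  fixes z :: "'a::real_normed_algebra_1"
  assumes z: "norm z \<le> 1"
  shows "norm (sqrt_iter z n) \<le> sqrt_iter 1 n \<and>
    norm (sqrt_iter z (Suc n) - sqrt_iter z n) \<le> sqrt_iter 1 (Suc n) - sqrt_iter 1 n"
proof (induction n)
  case 0
  then show ?case using z by simp
next
  case (Suc n)
  let ?y = "sqrt_iter z" and ?t = "sqrt_iter (1::real)"
  have 1: "norm (?y (Suc n)) \<le> ?t (Suc n)"
  proof -
    have "norm (?y n * ?y n) \<le> ?t n * ?t n"
      using Suc sqrt_iter_real[of n] by (intro order_trans[OF norm_mult_ineq] mult_mono) auto
    then have "norm (z + ?y n * ?y n) \<le> 1 + ?t n * ?t n"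
      by (intro order_trans[OF norm_triangle_ineq] add_mono z)
    then show ?thesis by simp
  qed
  \<comment> \<open>Iterates commute, so the difference of squares factors into increment times sum.
    At z = 1 the resulting estimate is an equality, which closes the induction.\<close>
  have comm: "?y n * ?y (Suc n) = ?y (Suc n) * ?y n"
    by (intro sqrt_iter_commute sym[OF sqrt_iter_commute] refl)
  let ?d = "?y (Suc n) - ?y n" and ?s = "?y (Suc n) + ?y n"
  have "?y (Suc (Suc n)) - ?y (Suc n) = (1/2) *\<^sub>R (?y (Suc n) * ?y (Suc n) - ?y n * ?y n)"
    by (simp only: sqrt_iter.simps(2)[of z "Suc n"], subst sqrt_iter.simps(2)[of z n])
      (simp add: scaleR_diff_right[symmetric] del: sqrt_iter.simps)
  also have "\<dots> = (1/2) *\<^sub>R (?d * ?s)"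
    using comm by (simp add: algebra_simps del: sqrt_iter.simps)
  finally have "norm (?y (Suc (Suc n)) - ?y (Suc n)) = norm (?d * ?s) / 2"
    by (simp del: sqrt_iter.simps)
  moreover have "0 \<le> ?t (Suc n) - ?t n"
    using Suc norm_ge_zero[of ?d] by linarith
  then have "norm (?d * ?s) \<le> (?t (Suc n) - ?t n) * (?t (Suc n) + ?t n)"
    using Suc 1 sqrt_iter_real[of n] sqrt_iter_real[of "Suc n"]
    by (intro order_trans[OF norm_mult_ineq] mult_mono order_trans[OF norm_triangle_ineq] add_mono)
       (auto simp del: sqrt_iter.simps)
  moreover have "(?t (Suc n) - ?t n) * (?t (Suc n) + ?t n) / 2 = ?t (Suc (Suc n)) - ?t (Suc n)"
  proof -
    have alg: "(b - a) * (b + a) / 2 = c - b" if "2 * b = 1 + a * a" "2 * c = 1 + b * b" for a b c :: real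
    proof -
      have "(b - a) * (b + a) = 2 * c - 2 * b" unfolding that by (simp add: algebra_simps)
      then show ?thesis by simp
    qed
    show ?thesis by (rule alg) simp_all
  qed
  ultimately show ?case using 1 by (simp del: sqrt_iter.simps)
qed

text \<open>The increments telescope against those of the scalar iteration at 1, which is increasing
  and bounded, hence Cauchy.\<close>

lemma sqrt_iter_cauchy:
  fixes z :: "'a::{real_normed_algebra_1}"
  assumes z: "norm z \<le> 1"
  shows "Cauchy (sqrt_iter z)"
proof -
  let ?t = "sqrt_iter (1::real)"
  have mono: "norm (sqrt_iter z (n + k) - sqrt_iter z n) \<le> ?t (n + k) - ?t n" for n k
  proof (induction k)
    case (Suc k)
    have "norm (sqrt_iter z (n + Suc k) - sqrt_iter z n)
        \<le> norm (sqrt_iter z (Suc (n + k)) - sqrt_iter z (n + k)) + norm (sqrt_iter z (n + k) - sqrt_iter z n)"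
      using norm_triangle_ineq[of "sqrt_iter z (Suc (n + k)) - sqrt_iter z (n + k)"
          "sqrt_iter z (n + k) - sqrt_iter z n"] by simp
    also have "\<dots> \<le> (?t (Suc (n + k)) - ?t (n + k)) + (?t (n + k) - ?t n)"
      using Suc sqrt_iter_step[OF z, of "n + k"] by (intro add_mono) (auto simp del: sqrt_iter.simps)
    finally show ?case by simp
  qed simp
  have "incseq ?t"
  proof (rule incseq_SucI)
    show "?t n \<le> ?t (Suc n)" for n
      using sqrt_iter_step[of "1::real" n] norm_ge_zero[of "?t (Suc n) - ?t n"]
      unfolding norm_one by linarith
  qed
  then have "convergent ?t"
    using sqrt_iter_real by (intro Bseq_monoseq_convergent BseqI'[where K = 1]) (auto simp: incseq_imp_monoseq)
  then have C: "Cauchy ?t" by (rule convergent_Cauchy)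
  show ?thesis
  proof (rule CauchyI')
    fix e :: real assume "0 < e"
    with C obtain M where M: "\<And>m n. m \<ge> M \<Longrightarrow> n \<ge> M \<Longrightarrow> norm (?t m - ?t n) < e"
      using CauchyD[OF C \<open>0 < e\<close>] by blast
    have "dist (sqrt_iter z m) (sqrt_iter z n) < e" if "m \<ge> M" "n > m" for m n
    proof -
      obtain k where k: "n = m + k" using \<open>n > m\<close> less_imp_add_positive by blast
      have "norm (sqrt_iter z n - sqrt_iter z m) \<le> ?t n - ?t m" unfolding k by (rule mono)
      also have "\<dots> < e" using M[of n m] that by simp
      finally show ?thesis by (simp add: dist_norm norm_minus_commute)
    qed
    then show "\<exists>M. \<forall>m\<ge>M. \<forall>n>m. dist (sqrt_iter z m) (sqrt_iter z n) < e" by blast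
  qed
qed

text \<open>The clauses replace a functional calculus: 1 - y serves as a square root of 1 - z, y
  commutes with whatever commutes with z, and the norm bound allows the construction to be repeated
  with y in place of z.\<close>

lemma sqrt_one_minus:
  fixes z :: "'a::cstar_algebra"
  assumes z: "norm z \<le> 1"
  shows "\<exists>y. norm y \<le> 1 \<and> (1 - y) * (1 - y) = 1 - z \<and> (\<forall>x. x * z = z * x \<longrightarrow> x * y = y * x) \<and>
    (star z = z \<longrightarrow> star y = y)"
proof -
  let ?y = "sqrt_iter z"
  obtain y where y: "?y \<longlonglongrightarrow> y"
    using sqrt_iter_cauchy[OF z] Cauchy_convergent convergent_def by blast
  have "norm y \<le> 1"
    using sqrt_iter_step[OF z] sqrt_iter_real
    by (intro LIMSEQ_le_const2[OF tendsto_norm[OF y]]) (meson order_trans)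
  moreover have "(1 - y) * (1 - y) = 1 - z"
  proof -
    have "(\<lambda>n. ?y (Suc n)) \<longlonglongrightarrow> (1/2) *\<^sub>R (z + y * y)"
      unfolding sqrt_iter.simps by (intro tendsto_intros y)
    with LIMSEQ_Suc[OF y] have "y = (1/2) *\<^sub>R (z + y * y)" by (rule LIMSEQ_unique)
    then have "2 *\<^sub>R y = 2 *\<^sub>R (1/2) *\<^sub>R (z + y * y)" by (rule arg_cong)
    then have "y + y = z + y * y" by (simp add: scaleR_2)
    then show ?thesis by (simp add: algebra_simps)
  qed
  moreover have "x * y = y * x" if "x * z = z * x" for x
  proof (rule LIMSEQ_unique)
    show "(\<lambda>n. x * ?y n) \<longlonglongrightarrow> x * y" by (intro tendsto_intros y)
    show "(\<lambda>n. x * ?y n) \<longlonglongrightarrow> y * x"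
      unfolding sqrt_iter_commute[OF that] by (intro tendsto_intros y)
  qed
  moreover have "star y = y" if "star z = z"
  proof (rule LIMSEQ_unique[OF _ y])
    have "star (?y n) = ?y n" for n
      by (induction n) (auto simp: star_scaleR star_add star_mult that)
    then show "?y \<longlonglongrightarrow> star y"
      using bounded_linear.tendsto[OF bounded_linear_star y] by simp
  qed
  ultimately show ?thesis by blast
qed

text \<open>The element n = u + \<i>v satisfies n^* n = u^2 + v^2 because u and v commute, and u is
  its real part, so the norm of u is at most that of n. This stands in for monotonicity of the norm
  on positive elements.\<close>

lemma norm_square_le_sum_squares:
  fixes u v :: "'a::cstar_algebra"
  assumes "star u = u" "star v = v" "u * v = v * u"
  shows "norm (u * u) \<le> norm (u * u + v * v)"
proof -
  define n where "n = u + \<i> *\<^sub>C v"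
  have sn: "star n = u - \<i> *\<^sub>C v"
    using scaleC_add_left[of "\<i>" "- \<i>" v]
    by (simp add: n_def star_add star_scaleC assms eq_neg_iff_add_eq_0 add.commute)
  have "star n * n = u * u + v * v"
    unfolding sn unfolding n_def
    by (simp add: algebra_simps scaleC_mult_left scaleC_mult_right scaleC_scaleC scaleC_diff_right assms)
      (simp add: scaleC_of_real[of "-1" "v * v", simplified])
  then have n: "norm (u * u + v * v) = (norm n)\<^sup>2" by (metis norm_star_mult)
  have "u = (1/2) *\<^sub>R (n + star n)"
    unfolding sn unfolding n_def by (simp flip: scaleR_2)
  then have "norm u \<le> norm n"
    using norm_triangle_ineq[of n "star n"] by (simp add: norm_star)
  then have "(norm u)\<^sup>2 \<le> (norm n)\<^sup>2" by (intro power_mono) auto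
  then show ?thesis using norm_star_mult[of u] by (simp add: n assms)
qed

text \<open>Besides c^2, also 1 - c^2 is the square of a self-adjoint element commuting with c, and
  the two squares add up to 1.\<close>

lemma norm_one_minus_square:
  fixes c :: "'a::cstar_algebra"
  assumes c: "star c = c" "norm c \<le> 1"
  shows "norm (1 - c * c) \<le> 1"
proof -
  have "norm (c * c) \<le> 1"
    using norm_mult_ineq[of c c] c(2) by (meson mult_le_one norm_ge_zero order_trans)
  from sqrt_one_minus[OF this] obtain y where
    y: "(1 - y) * (1 - y) = 1 - c * c" "\<And>x. x * (c * c) = c * c * x \<Longrightarrow> x * y = y * x" "star y = y"
    by (auto simp: star_mult c)
  have "c * y = y * c" by (rule y(2)) (simp add: mult.assoc)
  then have "norm ((1 - y) * (1 - y)) \<le> norm ((1 - y) * (1 - y) + c * c)"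
    by (intro norm_square_le_sum_squares) (auto simp: star_diff y c algebra_simps)
  then show ?thesis by (simp add: y)
qed

section \<open>Homomorphisms of C*-algebras\<close>

lemma star_homD:
  assumes "star_hom f"
  shows "f (x + y) = f x + f y" "f (c *\<^sub>C x) = c *\<^sub>C f x" "f (x * y) = f x * f y" "f 1 = 1"
    "f (star x) = star (f x)"
  using assms by (auto simp: star_hom_def clinear_on_def)

lemma star_hom_linear:
  fixes f :: "'a::cstar_algebra \<Rightarrow> 'b::{complex_vector, times, one, star}"
  assumes "star_hom f"
  shows "f (r *\<^sub>R x) = r *\<^sub>R f x" "f 0 = 0" "f (x - y) = f x - f y" "f (- x) = - f x"
proof -
  show r: "f (r *\<^sub>R x) = r *\<^sub>R f x" for r x
    using star_homD(2)[OF assms, of "complex_of_real r" x] by (simp add: scaleC_of_real)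
  show "f 0 = 0" using r[of 0 0] by simp
  show m: "f (- x) = - f x" for x using r[of "-1" x] by simp
  show "f (x - y) = f x - f y" using star_homD(1)[OF assms, of x "- y"] m[of y] by simp
qed

lemma star_hom_sum:
  fixes f :: "'a::cstar_algebra \<Rightarrow> 'b::{complex_vector, times, one, star}"
  shows "star_hom f \<Longrightarrow> f (\<Sum>i\<in>I. g i) = (\<Sum>i\<in>I. f (g i))"
  by (induction I rule: infinite_finite_induct) (auto simp: star_hom_linear star_homD)

text \<open>After normalization 1 - b^* b is the square of a self-adjoint element, so its image is a
  positive operator, which says that \<sigma>(b) does not increase the norm of vectors.\<close>

lemma star_hom_norm_le:
  fixes \<sigma> :: "'a::cstar_algebra \<Rightarrow> 'x bop"
  assumes \<sigma>: "star_hom \<sigma>"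
  shows "norm (\<sigma> a) \<le> norm a"
proof (cases "a = 0")
  case True
  then show ?thesis by (simp add: star_hom_linear[OF \<sigma>])
next
  case False
  define b where "b = (1 / norm a) *\<^sub>R a"
  have "norm (star b * b) \<le> 1" using False unfolding norm_star_mult by (simp add: b_def)
  from sqrt_one_minus[OF this] obtain y where
    y: "(1 - y) * (1 - y) = 1 - star b * b" "star (star b * b) = star b * b \<longrightarrow> star y = y"
    by (elim exE conjE) (rule that)
  from y(2) have sy: "star y = y" by (simp add: star_mult star_star)
  have "norm (\<sigma> b) \<le> 1"
  proof (rule norm_bop_bound)
    fix \<xi>
    have "star (\<sigma> (1 - y)) * \<sigma> (1 - y) = \<sigma> (star (1 - y) * (1 - y))"
      by (simp only: star_homD(3,5)[OF \<sigma>])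
    also have "\<dots> = \<sigma> (1 - star b * b)" by (simp only: star_diff star_one sy y(1))
    also have "\<dots> = 1 - star (\<sigma> b) * \<sigma> b"
      by (simp only: star_hom_linear(3)[OF \<sigma>] star_homD(3-5)[OF \<sigma>])
    finally have "cinner \<xi> ((star (\<sigma> (1 - y)) * \<sigma> (1 - y)) \<cdot> \<xi>) = cinner \<xi> ((1 - star (\<sigma> b) * \<sigma> b) \<cdot> \<xi>)"
      by simp
    then have "complex_of_real ((norm (\<sigma> (1 - y) \<cdot> \<xi>))\<^sup>2) = complex_of_real ((norm \<xi>)\<^sup>2 - (norm (\<sigma> b \<cdot> \<xi>))\<^sup>2)"
      by (simp add: bop_apply_simps cinner_star_right cinner_self_norm cinner_simps)
    then have "(norm (\<sigma> b \<cdot> \<xi>))\<^sup>2 \<le> (norm \<xi>)\<^sup>2"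
      unfolding of_real_eq_iff using zero_le_power2[of "norm (\<sigma> (1 - y) \<cdot> \<xi>)"] by linarith
    then show "norm (\<sigma> b \<cdot> \<xi>) \<le> 1 * norm \<xi>" by (simp add: power2_le_imp_le[of "norm (\<sigma> b \<cdot> \<xi>)" "norm \<xi>"])
  qed simp
  then have "norm (\<sigma> a) / norm a \<le> 1" by (simp add: b_def star_hom_linear(1)[OF \<sigma>])
  then show ?thesis using False by (simp add: divide_le_eq)
qed

text \<open>Put W = V^2. The product of W + D and W - D is 0, so for u in the range of W - D the
  nonnegative numbers <u, Wu> and <u, Du> add up to 0. Hence Wu = 0 and Du = 0, and self-adjointness
  of W - D gives u = 0.\<close>

lemma positive_sqrt_unique:
  fixes V D :: "'x bop"
  assumes V: "star V = V" and D: "op_pos D"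
    and sq: "(V * V) * (V * V) = D * D" and comm: "(V * V) * D = D * (V * V)"
  shows "V * V = D"
proof (rule bapply_eqI)
  fix \<xi>
  let ?W = "V * V"
  define u where "u = (?W - D) \<cdot> \<xi>"
  have "(?W + D) * (?W - D) = 0" using sq comm by (simp add: algebra_simps)
  then have "(?W + D) \<cdot> u = 0" by (simp only: u_def bop_apply_simps(4) flip: bop_apply_simps(6))
  then have s: "?W \<cdot> u + D \<cdot> u = 0" by (simp add: bop_apply_simps)
  have "cinner u (?W \<cdot> u) = complex_of_real ((norm (V \<cdot> u))\<^sup>2)"
    using cinner_star_right[of u V "V \<cdot> u"] by (simp add: V bop_apply_simps cinner_self_norm)
  moreover have "cinner u (?W \<cdot> u) + cinner u (D \<cdot> u) = 0"
    by (simp only: s cinner_zero flip: cinner_add_right)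
  moreover have "0 \<le> cinner u (D \<cdot> u)" using D by (simp add: op_pos_def)
  ultimately have "(norm (V \<cdot> u))\<^sup>2 + Re (cinner u (D \<cdot> u)) = 0" "0 \<le> Re (cinner u (D \<cdot> u))"
    by (auto simp: less_eq_complex_def complex_eq_iff)
  then have "(norm (V \<cdot> u))\<^sup>2 \<le> 0" by linarith
  then have "?W \<cdot> u = 0" by (simp add: bop_apply_simps)
  with s have "(?W - D) \<cdot> u = 0" by (simp add: bop_apply_simps)
  moreover have sa: "star (?W - D) = ?W - D" using op_pos_selfadjoint[OF D] V by simp
  have "cinner u u = cinner \<xi> ((?W - D) \<cdot> u)"
    using cinner_star[of "?W - D" \<xi> u] unfolding sa by (simp only: u_def)
  ultimately have "u = 0" by (simp add: cinner_self_norm)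
  then show "?W \<cdot> \<xi> = D \<cdot> \<xi>" by (simp add: u_def bop_apply_simps)
qed

text \<open>With \<open>r = \<parallel>\<rho>(b\<^sup>2)\<parallel>\<close>, the operator \<open>\<rho>(b\<^sup>2 - r)\<close> is negative, so \<open>\<rho>\<close> identifies \<open>\<bar>b\<^sup>2 - r\<bar>\<close> with
  \<open>r - b\<^sup>2\<close>. By injectivity \<open>r - b\<^sup>2\<close> is a square already in the algebra.\<close>

lemma faithful_norm_square:
  fixes \<rho> :: "'a::cstar_algebra \<Rightarrow> 'x bop"
  assumes \<rho>: "star_hom \<rho>" "inj \<rho>" and b: "star b = b"
  shows "norm (b * b) \<le> norm (\<rho> (b * b))"
proof -
  \<comment> \<open>The scale M makes c a contraction; the summand 1 keeps M positive even if b^2 =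
    r.\<close>
  define r M where "r = norm (\<rho> (b * b))" and "M = norm (b * b - r *\<^sub>R 1) + 1"
  have M: "M > 0" by (simp add: M_def add_nonneg_pos)
  define c where "c = (1 / M) *\<^sub>R (b * b - r *\<^sub>R 1)"
  have c: "star c = c" "norm c \<le> 1"
    using M by (auto simp: c_def star_scaleR star_diff star_mult b M_def divide_le_eq)
  have bc: "b * c = c * b" by (simp add: c_def algebra_simps)
  \<comment> \<open>Here 1 - y is the absolute value of c. A second root below gives v with v^2 = 1
    - y, so that the image of 1 - y is the square of a self-adjoint operator, the form that
    \<open>positive_sqrt_unique\<close> takes.\<close>
  from sqrt_one_minus[OF norm_one_minus_square[OF c]] obtain y where
    y: "norm y \<le> 1" "(1 - y) * (1 - y) = c * c" "star y = y"
      "\<And>x. x * (1 - c * c) = (1 - c * c) * x \<Longrightarrow> x * y = y * x"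
    by (auto simp: star_mult star_diff c)
  have cy: "x * y = y * x" if "x * c = c * x" for x
  proof (rule y(4))
    have "x * (c * c) = c * c * x" using that by (metis mult.assoc)
    then show "x * (1 - c * c) = (1 - c * c) * x" by (simp add: algebra_simps)
  qed
  from sqrt_one_minus[OF y(1)] obtain y' where
    y': "(1 - y') * (1 - y') = 1 - y" "star y' = y'" "\<And>x. x * y = y * x \<Longrightarrow> x * y' = y' * x"
    using y(3) by auto
  define v where "v = 1 - y'"
  have v: "star v = v" "(v * v) * (v * v) = c * c" "(v * v) * c = c * (v * v)" "b * v = v * b"
  proof -
    have vv: "v * v = 1 - y" by (simp only: v_def y')
    show "star v = v" by (simp add: v_def star_diff y')
    show "(v * v) * (v * v) = c * c" by (simp only: vv y)
    show "(v * v) * c = c * (v * v)" unfolding vv using cy[of c] by (simp add: algebra_simps)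
    show "b * v = v * b" using y'(3)[OF cy[OF bc]] by (simp add: v_def algebra_simps)
  qed
  have "\<rho> v * \<rho> v = - \<rho> c"
  proof (rule positive_sqrt_unique)
    show "star (\<rho> v) = \<rho> v" by (simp add: star_homD(5)[OF \<rho>(1), symmetric] v)
    show "\<rho> v * \<rho> v * (\<rho> v * \<rho> v) = - \<rho> c * - \<rho> c" "\<rho> v * \<rho> v * - \<rho> c = - \<rho> c * (\<rho> v * \<rho> v)"
      by (simp_all add: star_homD(3)[OF \<rho>(1), symmetric] v)
    show "op_pos (- \<rho> c)"
      unfolding op_pos_def
    proof
      fix \<xi>
      have eq: "- \<rho> c = (1 / M) *\<^sub>R (r *\<^sub>R 1 - star (\<rho> b) * \<rho> b)"
        by (simp add: c_def star_hom_linear[OF \<rho>(1)] star_homD[OF \<rho>(1)] algebra_simps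
            star_homD(5)[OF \<rho>(1), symmetric] b)
      then have "cinner \<xi> ((- \<rho> c) \<cdot> \<xi>) = complex_of_real ((1 / M) * (r * (norm \<xi>)\<^sup>2 - (norm (\<rho> b \<cdot> \<xi>))\<^sup>2))"
        unfolding eq by (simp add: bop_apply_simps cinner_simps cinner_star_right cinner_self_norm)
      moreover have "(norm (\<rho> b \<cdot> \<xi>))\<^sup>2 \<le> r * (norm \<xi>)\<^sup>2"
      proof -
        have "r = (norm (\<rho> b))\<^sup>2"
          using norm_star_mult_bop[of "\<rho> b"] by (simp add: r_def star_homD[OF \<rho>(1)] star_homD(5)[OF \<rho>(1), symmetric] b)
        then show ?thesis
          using power_mono[OF norm_bapply[of "\<rho> b" \<xi>], of 2] by (simp add: power_mult_distrib)
      qed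
      ultimately show "0 \<le> cinner \<xi> ((- \<rho> c) \<cdot> \<xi>)" using M by (simp add: less_eq_complex_def)
    qed
  qed
  then have "\<rho> (v * v) = \<rho> (- c)" by (simp add: star_homD[OF \<rho>(1)] star_hom_linear[OF \<rho>(1)])
  then have "v * v = - c" using \<rho>(2) by (simp add: inj_eq)
  \<comment> \<open>Clearing the factor M exhibits r as a sum of two commuting squares, one of which
    is b^2.\<close>
  then have "r *\<^sub>R 1 = b * b + (sqrt M *\<^sub>R v) * (sqrt M *\<^sub>R v)"
    using M by (simp add: c_def)
  then have "norm (b * b) \<le> norm (r *\<^sub>R (1::'a))"
    using norm_square_le_sum_squares[of b "sqrt M *\<^sub>R v"] b v by (simp add: star_scaleR)
  then show ?thesis by (simp add: r_def)
qed

text \<open>For the self-adjoint element ?b the preceding bound compares the norms of its square,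
  and the C*-identity on both sides turns these into fourth powers of the norms of a and
  \<rho>(a).\<close>

lemma faithful_norm:
  fixes \<rho> :: "'a::cstar_algebra \<Rightarrow> 'x bop"
  assumes \<rho>: "star_hom \<rho>" "inj \<rho>"
  shows "norm (\<rho> a) = norm a"
proof (rule antisym[OF star_hom_norm_le[OF \<rho>(1)]])
  let ?b = "star a * a"
  have "star ?b = ?b" by (simp add: star_mult star_star)
  from faithful_norm_square[OF \<rho> this] have "norm (star ?b * ?b) \<le> norm (star (\<rho> ?b) * \<rho> ?b)"
    by (simp only: star_homD(3,5)[OF \<rho>(1)] star_mult star_star bop_star_simps(1,6))
  then have "((norm a)\<^sup>2)\<^sup>2 \<le> ((norm (\<rho> a))\<^sup>2)\<^sup>2"
    by (simp only: norm_star_mult norm_star_mult_bop star_homD(3,5)[OF \<rho>(1)])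
  then have "(norm a)\<^sup>2 \<le> (norm (\<rho> a))\<^sup>2" by (rule power2_le_imp_le) simp
  then show "norm a \<le> norm (\<rho> a)" by (rule power2_le_imp_le) simp
qed

section \<open>Amplification of homomorphisms to matrices\<close>

text \<open>The image of the matrix X under the amplification of \<sigma>, acting on the space of
  \<sigma> tensored with l2(J). Matrices stay plain functions without a norm of their own; only
  their images in representations have norms.\<close>

definition amp :: "('a \<Rightarrow> 'x bop) \<Rightarrow> 'j set \<Rightarrow> ('j \<Rightarrow> 'j \<Rightarrow> 'a) \<Rightarrow> ('x \<times> 'j) bop" where
  "amp \<sigma> J X = (\<Sum>k\<in>J. \<Sum>l\<in>J. \<sigma> (X k l) \<otimes>\<^sub>o matrix_unit k l)"

lemma slice_amp:
  assumes "finite J"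
  shows "slice p (amp \<sigma> J X \<cdot> \<zeta>) = (if p \<in> J then \<Sum>l\<in>J. \<sigma> (X p l) \<cdot> slice l \<zeta> else 0)"
proof -
  have "slice p (amp \<sigma> J X \<cdot> \<zeta>) = (\<Sum>l\<in>J. \<Sum>k\<in>J. if p = k then \<sigma> (X k l) \<cdot> slice l \<zeta> else 0)"
    unfolding amp_def by (subst sum.swap) (simp add: bop_sum_apply slice_sum slice_tensor_matrix_unit)
  then show ?thesis using assms by simp
qed

lemma block_amp:
  assumes "finite J"
  shows "block (amp \<sigma> J X) s t = (if s \<in> J \<and> t \<in> J then \<sigma> (X s t) else 0)"
proof -
  have "block (amp \<sigma> J X) s t = (\<Sum>k\<in>J. if s = k then (\<Sum>l\<in>J. if t = l then \<sigma> (X k l) else 0) else 0)"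
    unfolding amp_def block_sum block_tensor_matrix_unit by (intro sum.cong) auto
  then show ?thesis using assms by simp
qed

lemma tensor_matrix_unit_apply: "(S \<otimes>\<^sub>o matrix_unit k l) \<cdot> \<zeta> = ten (S \<cdot> slice l \<zeta>) (ket k)"
  by (rule slice_eqI) (simp add: slice_tensor_matrix_unit slice_ten coord_ket)

lemma cinner_ten_ket_right: "cinner \<zeta> (ten \<xi> (ket t)) = cinner (slice t \<zeta>) \<xi>"
  by (metis cinner_commute cinner_ten_ket)

lemma cinner_amp:
  "cinner \<zeta> (amp \<sigma> J X \<cdot> \<zeta>') = (\<Sum>k\<in>J. \<Sum>l\<in>J. cinner (slice k \<zeta>) (\<sigma> (X k l) \<cdot> slice l \<zeta>'))"
  by (simp add: amp_def bop_sum_apply cinner_sum_right tensor_matrix_unit_apply cinner_ten_ket_right)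

lemma amp_mult:
  assumes "finite J" and \<sigma>: "star_hom (\<sigma> :: 'a::cstar_algebra \<Rightarrow> 'x bop)"
  shows "amp \<sigma> J X * amp \<sigma> J Y = amp \<sigma> J (\<lambda>k l. \<Sum>m\<in>J. X k m * Y m l)"
proof (rule bapply_eqI, rule slice_eqI)
  fix \<zeta> p
  have "(\<Sum>m\<in>J. \<sigma> (X p m) \<cdot> (\<Sum>l\<in>J. \<sigma> (Y m l) \<cdot> slice l \<zeta>)) =
      (\<Sum>l\<in>J. \<sigma> (\<Sum>m\<in>J. X p m * Y m l) \<cdot> slice l \<zeta>)"
    unfolding star_hom_sum[OF \<sigma>] bapply_sum bop_sum_apply star_homD(3)[OF \<sigma>] bop_apply_simps
    by (rule sum.swap)
  then show "slice p ((amp \<sigma> J X * amp \<sigma> J Y) \<cdot> \<zeta>) = slice p (amp \<sigma> J (\<lambda>k l. \<Sum>m\<in>J. X k m * Y m l) \<cdot> \<zeta>)"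
    by (simp add: bop_apply_simps slice_amp[OF assms(1)])
qed

lemma amp_star:
  assumes \<sigma>: "star_hom (\<sigma> :: 'a::cstar_algebra \<Rightarrow> 'x bop)"
  shows "star (amp \<sigma> J X) = amp \<sigma> J (\<lambda>k l. star (X l k))"
  unfolding amp_def
  by (subst sum.swap) (simp add: bop_star_sum tensor_star matrix_unit_star star_homD(5)[OF \<sigma>])

lemma norm_tensor_matrix_unit: "norm (S \<otimes>\<^sub>o matrix_unit k l) \<le> norm S"
proof (rule norm_bop_bound)
  fix \<zeta>
  have "norm ((S \<otimes>\<^sub>o matrix_unit k l) \<cdot> \<zeta>) \<le> norm (S \<cdot> slice l \<zeta>)"
    unfolding tensor_matrix_unit_apply by (rule order_trans[OF norm_ten]) simp
  also have "\<dots> \<le> norm S * norm \<zeta>"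
    by (intro order_trans[OF norm_bapply] mult_left_mono norm_slice) simp
  finally show "norm ((S \<otimes>\<^sub>o matrix_unit k l) \<cdot> \<zeta>) \<le> norm S * norm \<zeta>" .
qed simp

lemma norm_amp: "norm (amp \<sigma> J X) \<le> (\<Sum>k\<in>J. \<Sum>l\<in>J. norm (\<sigma> (X k l)))"
  unfolding amp_def by (intro sum_norm_le norm_tensor_matrix_unit)

lemma amp_linear:
  assumes \<sigma>: "star_hom (\<sigma> :: 'a::cstar_algebra \<Rightarrow> 'x bop)"
  shows "amp \<sigma> J (\<lambda>k l. X k l + Y k l) = amp \<sigma> J X + amp \<sigma> J Y"
    "amp \<sigma> J (\<lambda>k l. c *\<^sub>C X k l) = c *\<^sub>C amp \<sigma> J X"
    "amp \<sigma> J (\<lambda>k l. r *\<^sub>R X k l) = r *\<^sub>R amp \<sigma> J X"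
    "amp \<sigma> J (\<lambda>k l. X k l - Y k l) = amp \<sigma> J X - amp \<sigma> J Y"
proof -
  show add: "amp \<sigma> J (\<lambda>k l. X k l + Y k l) = amp \<sigma> J X + amp \<sigma> J Y" for X Y
    by (simp add: amp_def star_homD(1)[OF \<sigma>] tensor_add_left sum.distrib)
  show sc: "amp \<sigma> J (\<lambda>k l. c *\<^sub>C X k l) = c *\<^sub>C amp \<sigma> J X" for c X
    by (simp add: amp_def star_homD(2)[OF \<sigma>] tensor_scaleC_left scaleC_sum_right)
  show sr: "amp \<sigma> J (\<lambda>k l. r *\<^sub>R X k l) = r *\<^sub>R amp \<sigma> J X" for r X
    using sc[of "complex_of_real r" X] by (simp add: scaleC_of_real)
  show "amp \<sigma> J (\<lambda>k l. X k l - Y k l) = amp \<sigma> J X - amp \<sigma> J Y"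
    using add[of X "\<lambda>k l. (-1) *\<^sub>R Y k l"] sr[of "-1" Y] by simp
qed

definition mat_one :: "'j \<Rightarrow> 'j \<Rightarrow> 'a::cstar_algebra" where
  "mat_one k l = (if k = l then 1 else 0)"

lemma slice_amp_one:
  assumes "finite J" and \<sigma>: "star_hom (\<sigma> :: 'a::cstar_algebra \<Rightarrow> 'x bop)"
  shows "slice p (amp \<sigma> J mat_one \<cdot> \<zeta>) = (if p \<in> J then slice p \<zeta> else 0)"
proof -
  have "\<sigma> (mat_one p l) \<cdot> slice l \<zeta> = (if p = l then slice l \<zeta> else 0)" for l
    by (simp add: mat_one_def star_homD(4)[OF \<sigma>] star_hom_linear(2)[OF \<sigma>] bop_apply_simps)
  then show ?thesis using assms(1) by (simp add: slice_amp)
qed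

lemma amp_one_mult:
  assumes "finite J" and \<sigma>: "star_hom (\<sigma> :: 'a::cstar_algebra \<Rightarrow> 'x bop)"
  shows "amp \<sigma> J mat_one * amp \<sigma> J X = amp \<sigma> J X" "amp \<sigma> J X * amp \<sigma> J mat_one = amp \<sigma> J X"
proof -
  show "amp \<sigma> J mat_one * amp \<sigma> J X = amp \<sigma> J X"
    by (rule bapply_eqI, rule slice_eqI)
      (simp add: bop_apply_simps slice_amp_one[OF assms] slice_amp[OF assms(1), of _ _ X])
  show "amp \<sigma> J X * amp \<sigma> J mat_one = amp \<sigma> J X"
    by (rule bapply_eqI, rule slice_eqI)
      (simp add: bop_apply_simps slice_amp_one[OF assms] slice_amp[OF assms(1), of _ _ X])
qed

lemma amp_one_star:
  assumes \<sigma>: "star_hom (\<sigma> :: 'a::cstar_algebra \<Rightarrow> 'x bop)"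
  shows "star (amp \<sigma> J mat_one) = amp \<sigma> J mat_one"
  unfolding amp_star[OF \<sigma>] by (rule arg_cong[where f = "amp \<sigma> J"]) (auto simp: mat_one_def fun_eq_iff)

lemma norm_projection_le:
  assumes "star (e :: 'x bop) = e" "e * e = e"
  shows "norm e \<le> 1"
proof -
  have "norm e * norm e = norm e" using norm_star_mult_bop[of e] assms by (simp add: power2_eq_square)
  then show ?thesis by (cases "norm e = 0") auto
qed

text \<open>In any representation, the norm of the \<open>2\<^sup>n\<close>-th power of a self-adjoint matrix is the \<open>2\<^sup>n\<close>-th power
  of its norm. A bound on these powers that is uniform in \<open>n\<close>, however crude, therefore forces the
  norm to be at most 1.\<close>

primrec square_power :: "'j set \<Rightarrow> ('j \<Rightarrow> 'j \<Rightarrow> 'a::cstar_algebra) \<Rightarrow> nat \<Rightarrow> 'j \<Rightarrow> 'j \<Rightarrow> 'a" where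
  "square_power J Z 0 = Z"
| "square_power J Z (Suc n) =
     (\<lambda>k l. \<Sum>m\<in>J. square_power J Z n k m * square_power J Z n m l)"

lemma norm_amp_square_power:
  assumes J: "finite J" and \<sigma>: "star_hom (\<sigma> :: 'a::cstar_algebra \<Rightarrow> 'x bop)"
    and Z: "star (amp \<sigma> J Z) = amp \<sigma> J Z"
  shows "star (amp \<sigma> J (square_power J Z n)) = amp \<sigma> J (square_power J Z n) \<and>
    norm (amp \<sigma> J (square_power J Z n)) = norm (amp \<sigma> J Z) ^ (2 ^ n)"
proof (induction n)
  case 0
  then show ?case using Z by simp
next
  case (Suc n)
  let ?A = "amp \<sigma> J (square_power J Z n)"
  have "amp \<sigma> J (square_power J Z (Suc n)) = ?A * ?A" by (simp add: amp_mult[OF J \<sigma>])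
  moreover have "norm (?A * ?A) = (norm ?A)\<^sup>2" using norm_star_mult_bop[of ?A] Suc by simp
  moreover have "(norm (amp \<sigma> J Z) ^ (2 ^ n))\<^sup>2 = norm (amp \<sigma> J Z) ^ (2 ^ Suc n)"
    unfolding power_mult[symmetric] by (simp add: mult.commute)
  ultimately show ?case using Suc by simp
qed

text \<open>The uniform bound is the number of entries: in \<rho> all the powers are contractions,
  hence so are their blocks, isometry of \<rho> passes this to the entries in the algebra, and
  \<sigma> does not increase norms.\<close>

lemma amp_contraction:
  fixes \<rho> :: "'a::cstar_algebra \<Rightarrow> 'h bop" and \<sigma> :: "'a \<Rightarrow> 'x bop"
  assumes J: "finite J" and \<rho>: "star_hom \<rho>" "inj \<rho>" and \<sigma>: "star_hom \<sigma>"
    and Z: "\<And>k l. star (Z l k) = Z k l" and le: "norm (amp \<rho> J Z) \<le> 1"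
  shows "norm (amp \<sigma> J Z) \<le> 1"
proof (rule ccontr)
  have sa: "star (amp \<tau> J Z) = amp \<tau> J Z" if "star_hom \<tau>" for \<tau> :: "'a \<Rightarrow> 'z bop"
    unfolding amp_star[OF that] Z ..
  let ?C = "real (card J * card J)"
  have bound: "norm (amp \<sigma> J Z) ^ (2 ^ n) \<le> ?C" for n
  proof -
    let ?S = "square_power J Z n"
    have "norm (amp \<rho> J ?S) \<le> 1"
      using norm_amp_square_power[OF J \<rho>(1) sa[OF \<rho>(1)], of n] le by (simp add: power_le_one)
    then have "norm (\<sigma> (?S k l)) \<le> 1" if "k \<in> J" "l \<in> J" for k l
      using norm_block[of "amp \<rho> J ?S" k l] star_hom_norm_le[OF \<sigma>, of "?S k l"] that
      by (simp add: block_amp[OF J] faithful_norm[OF \<rho>])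
    then have "norm (amp \<sigma> J ?S) \<le> (\<Sum>k\<in>J. \<Sum>l\<in>J. 1)"
      by (intro order_trans[OF norm_amp] sum_mono)
    then show ?thesis using norm_amp_square_power[OF J \<sigma> sa[OF \<sigma>], of n] by simp
  qed
  assume "\<not> norm (amp \<sigma> J Z) \<le> 1"
  then have gt: "1 < norm (amp \<sigma> J Z)" by simp
  then obtain n where "?C < norm (amp \<sigma> J Z) ^ n" using real_arch_pow by blast
  also have "\<dots> \<le> norm (amp \<sigma> J Z) ^ (2 ^ n)" using gt by (intro power_increasing) auto
  finally show False using bound[of n] by simp
qed

text \<open>For a self-adjoint matrix, positivity is equivalent to contractivity of 1 - Y/M for
  large M, and contractivity is what \<open>amp_contraction\<close> moves from \<rho> to
  \<sigma>.\<close>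

lemma amp_positive:
  fixes \<rho> :: "'a::cstar_algebra \<Rightarrow> 'h bop" and \<sigma> :: "'a \<Rightarrow> 'x bop" and J :: "'j set"
  assumes J: "finite J" and \<rho>: "star_hom \<rho>" "inj \<rho>" and \<sigma>: "star_hom \<sigma>"
    and pos: "\<And>\<eta>. 0 \<le> (\<Sum>k\<in>J. \<Sum>l\<in>J. cinner (\<eta> k) (\<rho> (X k l) \<cdot> \<eta> l))"
  shows "0 \<le> (\<Sum>k\<in>J. \<Sum>l\<in>J. cinner (\<eta> k) (\<sigma> (X k l) \<cdot> \<eta> l))"
proof -
  \<comment> \<open>Entries outside J are set to 0, so that the symmetry demanded by
    \<open>amp_contraction\<close> holds for all indices. Inside J it is read off from
    self-adjointness in \<rho> and injectivity.\<close>
  define Y where "Y k l = (if k \<in> J \<and> l \<in> J then X k l else 0)" for k l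
  have YX: "amp \<tau> J Y = amp \<tau> J X" for \<tau> :: "'a \<Rightarrow> 'z bop"
    unfolding amp_def by (intro sum.cong) (auto simp: Y_def)
  let ?H = "amp \<rho> J Y"
  have H: "op_pos ?H" unfolding op_pos_def YX cinner_amp by (rule allI, rule pos)
  have Y: "star (Y l k) = Y k l" for k l
  proof (cases "k \<in> J \<and> l \<in> J")
    case True
    have "block (star ?H) k l = block ?H k l" by (simp add: op_pos_selfadjoint[OF H])
    then have "\<rho> (star (Y l k)) = \<rho> (Y k l)"
      using True by (simp add: amp_star[OF \<rho>(1)] block_amp[OF J])
    then show ?thesis using \<rho>(2) by (simp add: inj_eq)
  qed (auto simp: Y_def)
  define M where "M = norm ?H + 1"
  have M: "M > 0" by (simp add: M_def add_nonneg_pos)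
  define Z where "Z k l = mat_one k l - (1 / M) *\<^sub>R Y k l" for k l
  have ampZ: "amp \<tau> J Z = amp \<tau> J mat_one - (1 / M) *\<^sub>R amp \<tau> J Y" if "star_hom \<tau>" for \<tau> :: "'a \<Rightarrow> 'z bop"
    unfolding Z_def by (simp only: amp_linear(3,4)[OF that])
  have Zs: "star (Z l k) = Z k l" for k l
    by (simp add: Z_def star_diff star_scaleR Y) (simp add: mat_one_def)
  have "norm (1 - (1 / M) *\<^sub>R ?H) \<le> 1"
  proof (rule norm_selfadjoint_le)
    fix \<xi>
    have nn: "0 \<le> Re (cinner \<xi> (?H \<cdot> \<xi>))" using H by (simp add: op_pos_def less_eq_complex_def)
    have "Re (cinner \<xi> (?H \<cdot> \<xi>)) \<le> norm \<xi> * (norm ?H * norm \<xi>)"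
      by (intro order_trans[OF complex_Re_le_cmod] order_trans[OF cinner_bound] mult_left_mono norm_bapply) simp
    also have "\<dots> \<le> M * (norm \<xi>)\<^sup>2"
      by (simp add: M_def power2_eq_square algebra_simps)
    finally have "Re (cinner \<xi> (?H \<cdot> \<xi>)) / M \<le> (norm \<xi>)\<^sup>2" using M by (simp add: field_simps)
    moreover have "0 \<le> Re (cinner \<xi> (?H \<cdot> \<xi>)) / M" using nn M by simp
    moreover have "Re (cinner \<xi> ((1 - (1 / M) *\<^sub>R ?H) \<cdot> \<xi>)) = (norm \<xi>)\<^sup>2 - Re (cinner \<xi> (?H \<cdot> \<xi>)) / M"
      by (simp add: bop_apply_simps cinner_simps cinner_self_norm)
    ultimately show "\<bar>Re (cinner \<xi> ((1 - (1 / M) *\<^sub>R ?H) \<cdot> \<xi>))\<bar> \<le> 1 * (norm \<xi>)\<^sup>2" by linarith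
  qed (simp_all add: op_pos_selfadjoint[OF H])
  \<comment> \<open>The amplified unit is in general only a projection; the amplification of Z is
    this projection times 1 - ?H/M.\<close>
  moreover have "norm (amp \<rho> J mat_one) \<le> 1"
    by (rule norm_projection_le) (simp_all add: amp_one_star[OF \<rho>(1)] amp_one_mult[OF J \<rho>(1)])
  moreover have "amp \<rho> J Z = amp \<rho> J mat_one * (1 - (1 / M) *\<^sub>R ?H)"
    by (simp add: ampZ[OF \<rho>(1)] algebra_simps amp_one_mult[OF J \<rho>(1)])
  ultimately have "norm (amp \<rho> J Z) \<le> 1"
    using norm_mult_ineq[of "amp \<rho> J mat_one" "1 - (1 / M) *\<^sub>R ?H"]
      mult_le_one[of "norm (amp \<rho> J mat_one)" "norm (1 - (1 / M) *\<^sub>R ?H)"] by simp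
  then have le: "norm (amp \<sigma> J Z) \<le> 1" by (rule amp_contraction[OF J \<rho> \<sigma> Zs])
  \<comment> \<open>The family \<eta> becomes one vector, fixed by the amplified unit, and the
    double sum becomes its quadratic form.\<close>
  define \<zeta> where "\<zeta> = (\<Sum>k\<in>J. ten (\<eta> k) (ket k))"
  have sl: "slice k \<zeta> = (if k \<in> J then \<eta> k else 0)" for k
    using J by (simp add: \<zeta>_def slice_sum slice_ten coord_ket if_distrib[of "\<lambda>c. c *\<^sub>C _"] cong: if_cong)
  have one: "amp \<sigma> J mat_one \<cdot> \<zeta> = \<zeta>"
    by (rule slice_eqI) (simp add: slice_amp_one[OF J \<sigma>] sl)
  let ?Q = "cinner \<zeta> (amp \<sigma> J Y \<cdot> \<zeta>)"
  have Q: "?Q = (\<Sum>k\<in>J. \<Sum>l\<in>J. cinner (\<eta> k) (\<sigma> (X k l) \<cdot> \<eta> l))"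
    unfolding YX cinner_amp by (intro sum.cong) (auto simp: sl)
  have "star (amp \<sigma> J Y) = amp \<sigma> J Y" unfolding amp_star[OF \<sigma>] Y ..
  then have "cnj ?Q = ?Q" by (metis cinner_commute cinner_star)
  then have "Im ?Q = 0" by (simp add: complex_eq_iff)
  moreover have "0 \<le> Re ?Q"
  proof -
    have "Re (cinner \<zeta> (amp \<sigma> J Z \<cdot> \<zeta>)) \<le> norm \<zeta> * (norm (amp \<sigma> J Z) * norm \<zeta>)"
      by (intro order_trans[OF complex_Re_le_cmod] order_trans[OF cinner_bound] mult_left_mono norm_bapply) simp
    also have "\<dots> \<le> norm \<zeta> * (1 * norm \<zeta>)" by (intro mult_left_mono mult_right_mono le) auto
    finally have "Re (cinner \<zeta> (amp \<sigma> J Z \<cdot> \<zeta>)) \<le> (norm \<zeta>)\<^sup>2" by (simp add: power2_eq_square)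
    moreover have "Re (cinner \<zeta> (amp \<sigma> J Z \<cdot> \<zeta>)) = (norm \<zeta>)\<^sup>2 - Re ?Q / M"
      by (simp add: ampZ[OF \<sigma>] bop_apply_simps cinner_simps cinner_self_norm one)
    ultimately have "0 \<le> Re ?Q / M" by linarith
    then show ?thesis using M by (simp add: zero_le_divide_iff)
  qed
  ultimately show ?thesis unfolding Q[symmetric] by (simp add: less_eq_complex_def)
qed

section \<open>Closed spans of operators\<close>

lemma module_scaleC: "module (scaleC :: complex \<Rightarrow> 'a \<Rightarrow> 'a::complex_vector)"
  by standard (simp_all add: scaleC_add_right scaleC_add_left scaleC_scaleC)

lemma csubspaceI:
  assumes "0 \<in> S" "\<And>x y. x \<in> S \<Longrightarrow> y \<in> S \<Longrightarrow> x + y \<in> S" "\<And>c x. x \<in> S \<Longrightarrow> c *\<^sub>C x \<in> S"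
  shows "csubspace S"
  using assms by (simp add: module.subspace_def[OF module_scaleC])

lemma csubspaceD:
  assumes "csubspace S"
  shows "0 \<in> S" "x \<in> S \<Longrightarrow> y \<in> S \<Longrightarrow> x + y \<in> S" "x \<in> S \<Longrightarrow> c *\<^sub>C x \<in> S"
  using assms by (simp_all add: module.subspace_def[OF module_scaleC])

lemma csubspace_sum: "csubspace S \<Longrightarrow> (\<And>i. i \<in> I \<Longrightarrow> f i \<in> S) \<Longrightarrow> (\<Sum>i\<in>I. f i) \<in> S"
  by (induction I rule: infinite_finite_induct) (auto intro: csubspaceD)

lemmas csubspace_span = module.subspace_span[OF module_scaleC]
  and cspan_base = module.span_base[OF module_scaleC]
  and cspan_minimal = module.span_minimal[OF module_scaleC]

lemma bounded_linear_scaleC_bop: "bounded_linear (\<lambda>T :: 'x bop. c *\<^sub>C T)"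
proof (rule bounded_linear_intro)
  fix x y :: "'x bop" and r :: real
  show "c *\<^sub>C (x + y) = c *\<^sub>C x + c *\<^sub>C y" by (rule scaleC_add_right)
  show "c *\<^sub>C r *\<^sub>R x = r *\<^sub>R c *\<^sub>C x" by (rule scaleC_scaleR)
  show "norm (c *\<^sub>C x) \<le> norm x * cmod c" by (simp add: norm_scaleC_bop)
qed

lemma bounded_linear_star_bop: "bounded_linear (star :: 'x bop \<Rightarrow> 'x bop)"
  by (rule bounded_linear_intro[where K = 1]) simp_all

lemma csubspace_closure:
  assumes S: "csubspace (S :: 'x bop set)"
  shows "csubspace (closure S)"
proof (rule csubspaceI)
  show "0 \<in> closure S" using csubspaceD(1)[OF S] closure_subset by blast
  show "x + y \<in> closure S" if xy: "x \<in> closure S" "y \<in> closure S" for x y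
  proof -
    obtain f g where "\<And>n. f n \<in> S" "f \<longlonglongrightarrow> x" "\<And>n. g n \<in> S" "g \<longlonglongrightarrow> y"
      using xy unfolding closure_sequential by blast
    then have "(\<lambda>n. f n + g n) \<longlonglongrightarrow> x + y" "\<And>n. f n + g n \<in> S"
      by (auto intro: tendsto_add csubspaceD(2)[OF S])
    then show ?thesis unfolding closure_sequential by (intro exI[of _ "\<lambda>n. f n + g n"]) simp
  qed
  show "c *\<^sub>C x \<in> closure S" if x: "x \<in> closure S" for c x
  proof -
    obtain f where f: "\<And>n. f n \<in> S" "f \<longlonglongrightarrow> x"
      using x unfolding closure_sequential by blast
    have "(\<lambda>n. c *\<^sub>C f n) \<longlonglongrightarrow> c *\<^sub>C x" "\<And>n. c *\<^sub>C f n \<in> S"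
      using bounded_linear.tendsto[OF bounded_linear_scaleC_bop f(2)] csubspaceD(3)[OF S f(1)] by auto
    then show ?thesis unfolding closure_sequential by (intro exI[of _ "\<lambda>n. c *\<^sub>C f n"]) simp
  qed
qed

text \<open>The scaling assumption asks for preservation of membership rather than complex
  linearity, so that the conjugate-linear \<open>star\<close> is covered too.\<close>

lemma closed_span_mapsto:
  fixes f :: "'x bop \<Rightarrow> 'x bop"
  assumes f: "bounded_linear f" and sc: "\<And>x c. f x \<in> C \<Longrightarrow> f (c *\<^sub>C x) \<in> C"
    and G: "\<And>x. x \<in> G \<Longrightarrow> f x \<in> C" and C: "csubspace C" "closed C"
    and x: "x \<in> closure (cspan G)"
  shows "f x \<in> C"
proof -
  interpret bounded_linear f by fact
  have "csubspace (f -` C)"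
    by (rule csubspaceI) (auto simp: zero add intro: csubspaceD[OF C(1)] sc)
  then have "cspan G \<subseteq> f -` C" using G by (intro cspan_minimal) auto
  moreover have "closed (f -` C)"
    using C(2) continuous_on[OF continuous_on_id] by (intro closed_vimage) simp_all
  ultimately have "closure (cspan G) \<subseteq> f -` C" by (rule closure_minimal)
  with x show ?thesis by auto
qed

lemma closed_span_csubspace: "csubspace (closure (cspan (G :: 'x bop set)))"
  by (intro csubspace_closure csubspace_span)

lemma closed_span_base: "x \<in> G \<Longrightarrow> x \<in> closure (cspan (G :: 'x bop set))"
  using closure_subset cspan_base by blast

section \<open>Translations and the regular representation\<close>

lemma tshift_add: "tshift (r + s) t = tshift r (tshift s t)"
  by (simp add: tshift_def add.assoc)

lemma tshift_diff: "tshift (r - s) t = tshift r (tshift (- s) t)"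
  using tshift_add[of r "- s"] by simp

lemma tshift_zero [simp]: "tshift 0 t = t"
  by (simp add: tshift_def)

lemma tshift_cancel [simp]: "tshift r (tshift (- r) t) = t" "tshift (- r) (tshift r t) = t"
  by (simp_all flip: tshift_add)

lemma bij_tshift: "bij (tshift r)"
  by (rule o_bij[where g = "tshift (- r)"]) (auto simp: fun_eq_iff)

lemma inv_tshift: "inv (tshift r) = tshift (- r)"
  by (rule inv_equality) auto

lemma slice_U: "slice s (U_op r \<cdot> \<zeta>) = slice (tshift (- r) s) (\<zeta> :: ('h \<times> 'g::group_add tuples) ell2)"
  using slice_tensor[of "of_matrix (\<lambda>s t. if s = tshift r t then 1 else 0)" s 1 "tshift (- r) s" "1 :: 'h bop" \<zeta>]
  by (simp add: U_op_def coord_perm[OF bij_tshift] inv_tshift bop_apply_simps)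

lemma U_zero: "(U_op 0 :: ('h \<times> 'g::group_add tuples) bop) = 1"
  by (rule bapply_eqI, rule slice_eqI) (simp add: slice_U bop_apply_simps)

lemma U_add: "(U_op (r + s) :: ('h \<times> 'g::group_add tuples) bop) = U_op r * U_op s"
  by (rule bapply_eqI, rule slice_eqI) (simp add: slice_U bop_apply_simps minus_add tshift_diff)

lemma U_diff: "(U_op (r - s) :: ('h \<times> 'g::group_add tuples) bop) = U_op r * U_op (- s)"
  using U_add[of r "- s"] by simp

lemma U_cancel [simp]:
  "(U_op r :: ('h \<times> 'g::group_add tuples) bop) * U_op (- r) = 1"
  "(U_op (- r) :: ('h \<times> 'g::group_add tuples) bop) * U_op r = 1"
  by (simp_all flip: U_add add: U_zero)

lemma U_cancel_assoc [simp]: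
  "(U_op r :: ('h \<times> 'g::group_add tuples) bop) * (U_op (- r) * x) = x"
  "(U_op (- r) :: ('h \<times> 'g::group_add tuples) bop) * (U_op r * x) = x"
  by (simp_all flip: mult.assoc)

lemma perm_star:
  "star (of_matrix (\<lambda>s t. if s = tshift r t then 1 else 0)) =
    of_matrix (\<lambda>s t. if s = tshift (- r) t then 1 else 0)"
proof (rule bop_eq_entryI)
  fix s t :: "'a tuples"
  have "tshift (- r) t = s \<longleftrightarrow> tshift r s = t" by auto
  then show "entry (star (of_matrix (\<lambda>s t. if s = tshift r t then 1 else 0))) s t =
      entry (of_matrix (\<lambda>s t. if s = tshift (- r) t then 1 else 0)) s t"
    by (simp add: entry_star) (simp add: entry_coord coord_perm[OF bij_tshift] inv_tshift coord_ket)
qed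

lemma U_star: "star (U_op r) = (U_op (- r) :: ('h \<times> 'g::group_add tuples) bop)"
  by (simp add: U_op_def tensor_star perm_star)

lemma conj_action_eq: "conj_action r x = U_op r * x * U_op (- r)"
  by (simp add: conj_action_def U_star)

lemma conj_action_zero: "conj_action 0 x = x"
  by (simp add: conj_action_eq U_zero)

lemma conj_action_add: "conj_action (r + s) x = conj_action r (conj_action s x)"
  by (simp add: conj_action_eq minus_add U_add U_diff mult.assoc)

lemma conj_action_inverse [simp]:
  "conj_action r (conj_action (- r) x) = x" "conj_action (- r) (conj_action r x) = x"
  by (simp_all add: conj_action_zero flip: conj_action_add)

lemma conj_action_linear:
  "conj_action r (x + y) = conj_action r x + conj_action r y"
  "conj_action r (c *\<^sub>C x) = c *\<^sub>C conj_action r x"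
  by (simp_all add: conj_action_def distrib_left distrib_right scaleC_bop_mult)

lemma conj_action_mult: "conj_action r (x * y) = conj_action r x * conj_action r y"
  by (simp add: conj_action_eq mult.assoc)

lemma conj_action_star: "conj_action r (star x) = star (conj_action r x)"
  by (simp add: conj_action_def mult.assoc)

lemma bounded_linear_conj_action: "bounded_linear (conj_action r)"
  unfolding conj_action_def
  by (rule bounded_linear_compose[OF bounded_linear_mult_left bounded_linear_mult_right])

lemma norm_U: "norm (U_op r \<cdot> \<zeta>) = norm \<zeta>"
proof -
  have "cinner (U_op r \<cdot> \<zeta>) (U_op r \<cdot> \<zeta>) = cinner \<zeta> ((U_op (- r) * U_op r) \<cdot> \<zeta>)"
    using cinner_star_right[of \<zeta> "U_op r" "U_op r \<cdot> \<zeta>"] by (simp only: U_star bop_apply_simps)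
  then show ?thesis by (simp add: norm_ell2_def bop_apply_simps)
qed

lemma cinner_conj_action:
  "cinner \<eta> (conj_action r x \<cdot> \<xi>) = cinner (U_op (- r) \<cdot> \<eta>) (x \<cdot> U_op (- r) \<cdot> \<xi>)"
  using cinner_star[of "U_op r" \<eta> "x \<cdot> U_op (- r) \<cdot> \<xi>"]
  by (simp add: conj_action_eq bop_apply_simps U_star)

lemma mat_norm_conj_action:
  fixes X :: "nat \<Rightarrow> nat \<Rightarrow> ('h \<times> 'g::group_add tuples) bop"
  shows "mat_norm n (\<lambda>i j. conj_action r (X i j)) = mat_norm n X"
proof -
  let ?N = "\<lambda>X :: nat \<Rightarrow> nat \<Rightarrow> ('h \<times> 'g tuples) bop. {cmod (\<Sum>i<n. \<Sum>j<n. cinner (\<eta> i) (X i j \<cdot> \<xi> j)) |\<xi> \<eta>.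
     (\<Sum>i<n. (norm (\<xi> i))\<^sup>2) \<le> 1 \<and> (\<Sum>i<n. (norm (\<eta> i))\<^sup>2) \<le> 1}"
  have sub: "?N (\<lambda>i j. conj_action r (X i j)) \<subseteq> ?N X" for r X
  proof clarify
    fix \<xi> \<eta> :: "nat \<Rightarrow> ('h \<times> 'g tuples) ell2"
    assume "(\<Sum>i<n. (norm (\<xi> i))\<^sup>2) \<le> 1" "(\<Sum>i<n. (norm (\<eta> i))\<^sup>2) \<le> 1"
    then show "\<exists>\<xi>' \<eta>'. cmod (\<Sum>i<n. \<Sum>j<n. cinner (\<eta> i) (conj_action r (X i j) \<cdot> \<xi> j)) =
        cmod (\<Sum>i<n. \<Sum>j<n. cinner (\<eta>' i) (X i j \<cdot> \<xi>' j)) \<and>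
        (\<Sum>i<n. (norm (\<xi>' i))\<^sup>2) \<le> 1 \<and> (\<Sum>i<n. (norm (\<eta>' i))\<^sup>2) \<le> 1"
      by (intro exI[of _ "\<lambda>i. U_op (- r) \<cdot> \<xi> i"] exI[of _ "\<lambda>i. U_op (- r) \<cdot> \<eta> i"])
        (simp add: cinner_conj_action norm_U)
  qed
  have "?N (\<lambda>i j. conj_action r (X i j)) = ?N X"
    using sub[of r X] sub[of "- r" "\<lambda>i j. conj_action r (X i j)"] by simp
  then show ?thesis by (simp only: mat_norm_def)
qed

lemma mat_pos_conj_action:
  assumes "mat_pos n X" shows "mat_pos n (\<lambda>i j. conj_action r (X i j))"
  unfolding mat_pos_def cinner_conj_action
proof
  fix \<xi>
  show "0 \<le> (\<Sum>i<n. \<Sum>j<n. cinner (U_op (- r) \<cdot> \<xi> i) (X i j \<cdot> U_op (- r) \<cdot> \<xi> j))"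
    using assms unfolding mat_pos_def by (rule spec[of _ "\<lambda>i. U_op (- r) \<cdot> \<xi> i"])
qed

lemma norm_conj_action: "norm (conj_action r x) = norm x"
proof -
  have le: "norm (conj_action r x) \<le> norm x" for r x
  proof (rule norm_bop_bound)
    show "norm (conj_action r x \<cdot> \<xi>) \<le> norm x * norm \<xi>" for \<xi>
      using norm_bapply[of x "U_op (- r) \<cdot> \<xi>"] by (simp add: conj_action_eq bop_apply_simps norm_U)
  qed simp
  show ?thesis using le[of r x] le[of "- r" "conj_action r x"] by simp
qed

lemma gamma_action_conj:
  assumes E: "\<And>t x. x \<in> E \<Longrightarrow> conj_action t x \<in> E"
  shows "gamma_action E conj_action"
proof -
  have "conj_action t ` E = E" for t
  proof
    show "E \<subseteq> conj_action t ` E"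
    proof
      fix x assume "x \<in> E"
      then show "x \<in> conj_action t ` E"
        using E[of x "- t"] by (intro image_eqI[of _ _ "conj_action (- t) x"]) simp_all
    qed
  qed (use E in auto)
  then show ?thesis
    by (auto simp: gamma_action_def clinear_on_def conj_action_linear mat_norm_conj_action
        conj_action_zero conj_action_add conj_action_star conj_action_mult)
qed

text \<open>The projection onto the tuples of length one, where the regular representation lives,
  and the unit of the crossed product. It commutes with translations since these keep the
  length.\<close>

abbreviation E1 :: "('h \<times> 'g::group_add tuples) bop" where
  "E1 \<equiv> 1 \<otimes>\<^sub>o coord_proj {t. snd t = []}"

lemma proj_star: "star (1 \<otimes>\<^sub>o coord_proj F) = 1 \<otimes>\<^sub>o coord_proj F"
proof -
  have "star (coord_proj F) = coord_proj F"
    by (rule bop_eq_entryI) (simp add: entry_star, auto simp: entry_coord coord_coord_proj coord_ket)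
  then show ?thesis by (simp add: tensor_star)
qed

lemma proj_idem: "(1 \<otimes>\<^sub>o coord_proj F) * (1 \<otimes>\<^sub>o coord_proj F) = 1 \<otimes>\<^sub>o coord_proj F"
  by (rule bapply_eqI, rule slice_eqI) (simp add: bop_apply_simps slice_coord_proj)

lemma norm_proj: "norm (1 \<otimes>\<^sub>o coord_proj F) \<le> 1"
  by (rule norm_projection_le[OF proj_star proj_idem])

lemma proj_idem_assoc: "(1 \<otimes>\<^sub>o coord_proj F) * ((1 \<otimes>\<^sub>o coord_proj F) * x) = (1 \<otimes>\<^sub>o coord_proj F) * x"
  by (simp add: proj_idem flip: mult.assoc)

lemma E1_U: "E1 * U_op r = U_op r * E1"
  by (rule bapply_eqI, rule slice_eqI)
    (simp add: bop_apply_simps slice_coord_proj slice_U tshift_def)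

lemma E1_U_assoc: "E1 * (U_op r * x) = U_op r * (E1 * x)"
  by (simp only: E1_U flip: mult.assoc)

section \<open>The covariant pair of \<pi> and u, and the systems built from it\<close>

locale faithful_action =
  fixes \<alpha> :: "'g::group_add \<Rightarrow> 'a::cstar_algebra \<Rightarrow> 'a" and \<rho> :: "'a \<Rightarrow> 'h bop"
  assumes action: "cstar_action \<alpha>" and faithful: "faithful_rep \<rho>"
begin

abbreviation \<pi> :: "'a \<Rightarrow> ('h \<times> 'g tuples) bop" where "\<pi> \<equiv> pi_rep \<alpha> \<rho>"
abbreviation u :: "'g \<Rightarrow> ('h \<times> 'g tuples) bop" where "u \<equiv> U_op"
abbreviation B :: "('h \<times> 'g tuples) bop set" where "B \<equiv> reduced_crossed_product \<alpha> \<rho>"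
abbreviation AB :: "('h \<times> 'g tuples) bop set" where "AB \<equiv> min_tensor_B \<rho>"
abbreviation m :: "('h \<times> 'g tuples) bop \<Rightarrow> 'a \<Rightarrow> ('h \<times> 'g tuples) bop" where "m \<equiv> pi_mult \<alpha> \<rho>"

lemma star_hom_\<alpha>: "star_hom (\<alpha> s)" and \<alpha>_zero: "\<alpha> 0 = id" and \<alpha>_add: "\<alpha> (s + t) x = \<alpha> s (\<alpha> t x)"
  using action by (auto simp: cstar_action_def)

lemma \<alpha>_cancel [simp]: "\<alpha> (- t) (\<alpha> t x) = x" "\<alpha> t (\<alpha> (- t) x) = x"
  by (simp_all add: \<alpha>_zero flip: \<alpha>_add)

lemma \<rho>: "star_hom \<rho>" "inj \<rho>"
  using faithful by (auto simp: faithful_rep_def)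

lemma star_hom_\<rho>\<alpha>: "star_hom (\<lambda>b. \<rho> (\<alpha> s b))"
  using \<rho>(1) star_hom_\<alpha>[of s] by (simp add: star_hom_def clinear_on_def)

lemma \<pi>_eq: "\<pi> b = bdiag (\<lambda>t. \<rho> (\<alpha> (- tbar t) b))"
  unfolding pi_rep_def
proof (rule of_matrix_eq)
  fix x y :: "'h \<times> 'g tuples"
  obtain h s where x: "x = (h, s)" by (cases x)
  obtain k t where y: "y = (k, t)" by (cases y)
  note xy = x y
  have "entry (bdiag (\<lambda>t. \<rho> (\<alpha> (- tbar t) b))) x y =
      coord (slice s (bdiag (\<lambda>t. \<rho> (\<alpha> (- tbar t) b)) \<cdot> ket (k, t))) h"
    by (simp add: xy entry_coord coord_slice)
  also have "\<dots> = (if s = t then entry (\<rho> (\<alpha> (- tbar s) b)) h k else 0)"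
    by (simp add: slice_bdiag[OF star_hom_norm_le[OF star_hom_\<rho>\<alpha>]] ket_ten slice_ten coord_ket
        bapply_simps entry_coord)
  finally show "entry (bdiag (\<lambda>t. \<rho> (\<alpha> (- tbar t) b))) x y =
      (case x of (h, s) \<Rightarrow> \<lambda>(k, t). if s = t then entry (\<rho> (\<alpha> (- tbar s) b)) h k else 0) y"
    by (simp add: xy)
qed

lemma slice_\<pi>: "slice t (\<pi> b \<cdot> \<zeta>) = \<rho> (\<alpha> (- tbar t) b) \<cdot> slice t \<zeta>"
  unfolding \<pi>_eq by (rule slice_bdiag[OF star_hom_norm_le[OF star_hom_\<rho>\<alpha>]])

lemma star_hom_\<pi>: "star_hom \<pi>"
proof -
  note hom = star_homD[OF star_hom_\<alpha>] star_homD[OF \<rho>(1)]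
  have "\<pi> (star x) = star (\<pi> x)" for x
  proof (rule bapply_eqI, rule slice_eqI, rule cinner_eq_rightI)
    fix \<xi> t v
    have "\<pi> x \<cdot> ten v (ket t) = ten (\<rho> (\<alpha> (- tbar t) x) \<cdot> v) (ket t)"
      by (rule slice_eqI) (simp add: slice_\<pi> slice_ten coord_ket)
    then have "cinner (slice t (star (\<pi> x) \<cdot> \<xi>)) v = cinner (slice t \<xi>) (\<rho> (\<alpha> (- tbar t) x) \<cdot> v)"
      by (simp add: cinner_star flip: cinner_ten_ket_right)
    then show "cinner (slice t (\<pi> (star x) \<cdot> \<xi>)) v = cinner (slice t (star (\<pi> x) \<cdot> \<xi>)) v"
      by (simp add: slice_\<pi> hom cinner_star)
  qed
  moreover have "\<pi> (x + y) = \<pi> x + \<pi> y" "\<pi> (c *\<^sub>C x) = c *\<^sub>C \<pi> x" "\<pi> (x * y) = \<pi> x * \<pi> y" "\<pi> 1 = 1" for x y c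
    by (rule bapply_eqI, rule slice_eqI, simp add: slice_\<pi> bop_apply_simps hom)+
  ultimately show ?thesis by (simp add: star_hom_def clinear_on_def)
qed

lemmas \<pi>_simps = star_homD[OF star_hom_\<pi>] star_hom_linear[OF star_hom_\<pi>]

lemma tbar_tshift: "tbar (tshift r t) = r + tbar t"
  by (simp add: tbar_def tshift_def add.assoc)

lemma U_\<pi>: "u r * \<pi> b = \<pi> (\<alpha> r b) * u r"
  by (rule bapply_eqI, rule slice_eqI)
    (simp add: bop_apply_simps slice_U slice_\<pi> tbar_tshift minus_add \<alpha>_add)

lemma U_\<pi>_assoc: "u r * (\<pi> b * x) = \<pi> (\<alpha> r b) * (u r * x)"
  by (simp only: U_\<pi> flip: mult.assoc)

lemma proj_\<pi>: "(1 \<otimes>\<^sub>o coord_proj F) * \<pi> b = \<pi> b * (1 \<otimes>\<^sub>o coord_proj F)"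
  by (rule bapply_eqI, rule slice_eqI)
    (simp add: bop_apply_simps slice_coord_proj slice_\<pi>)

lemma proj_\<pi>_assoc: "(1 \<otimes>\<^sub>o coord_proj F) * (\<pi> b * x) = \<pi> b * ((1 \<otimes>\<^sub>o coord_proj F) * x)"
  by (simp only: proj_\<pi> flip: mult.assoc)

text \<open>These rules move algebra elements to the left and projections to the right, towards the
  form \<open>\<pi> a * u s * E1\<close> of the generators.\<close>

lemmas covariance = mult.assoc proj_\<pi> proj_\<pi>_assoc E1_U E1_U_assoc U_\<pi> U_\<pi>_assoc
  proj_idem proj_idem_assoc

lemma conj_action_module: "conj_action t (m x a) = m (conj_action t x) (\<alpha> t a)"
  by (simp add: conj_action_eq pi_mult_def mult.assoc U_\<pi>)

lemma right_moduleI: "(\<And>x a. x \<in> E \<Longrightarrow> x * \<pi> a \<in> E) \<Longrightarrow> right_module E m"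
  by (simp add: right_module_def clinear_on_def pi_mult_def \<pi>_simps algebra_simps scaleC_bop_mult)

subsection \<open>The crossed product\<close>

lemma B_eq: "B = closure (cspan {\<pi> a * u s * E1 |a s. True})"
  by (simp add: reduced_crossed_product_def)

lemma B_gen: "\<pi> a * u s * E1 \<in> B"
  unfolding B_eq by (rule closed_span_base) blast

lemma B_csubspace: "csubspace B" unfolding B_eq by (rule closed_span_csubspace)

lemma B_closed: "closed B" by (simp add: B_eq)

lemma B_mapsto:
  fixes f :: "('h \<times> 'g tuples) bop \<Rightarrow> ('h \<times> 'g tuples) bop"
  assumes "bounded_linear f" "\<And>x c. f x \<in> C \<Longrightarrow> f (c *\<^sub>C x) \<in> C"
    "\<And>a s. f (\<pi> a * u s * E1) \<in> C" "csubspace C" "closed C" "x \<in> B"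
  shows "f x \<in> C"
proof (rule closed_span_mapsto[where f = f and C = C and G = "{\<pi> a * u s * E1 |a s. True}"])
  show "x \<in> closure (cspan {\<pi> a * u s * E1 |a s. True})" using assms(6) by (simp add: B_eq)
  show "f y \<in> C" if "y \<in> {\<pi> a * u s * E1 |a s. True}" for y using assms(3) that by blast
qed (rule assms, assumption?)+

lemma E1_in_B: "E1 \<in> B"
  using B_gen[of 1 0] by (simp add: \<pi>_simps U_zero)

text \<open>The differences \<open>E1 * x - x\<close> and \<open>x * E1 - x\<close> vanish on
  generators; the membership principle with target {0} extends this to the closure.\<close>

lemma B_unit: "x \<in> B \<Longrightarrow> E1 * x = x \<and> x * E1 = x"
proof -
  assume x: "x \<in> B"
  have e: "E1 * (\<pi> a * u s * E1) = \<pi> a * u s * E1" for a s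
    by (simp add: covariance)
  have zero: "csubspace ({0} :: ('h \<times> 'g tuples) bop set)" by (rule csubspaceI) simp_all
  have "E1 * x - x \<in> {0}"
    by (rule B_mapsto[OF _ _ _ _ _ x])
      (auto simp: e scaleC_bop_mult zero bounded_linear_mult_right bounded_linear_ident
        scaleC_diff_right[symmetric] intro!: bounded_linear_sub)
  moreover have "x * E1 - x \<in> {0}"
    by (rule B_mapsto[OF _ _ _ _ _ x])
      (auto simp: proj_idem mult.assoc scaleC_bop_mult zero bounded_linear_mult_left bounded_linear_ident
        scaleC_diff_right[symmetric] intro!: bounded_linear_sub)
  ultimately show ?thesis by simp
qed

lemma B_star: "x \<in> B \<Longrightarrow> star x \<in> B"
proof (rule B_mapsto[OF bounded_linear_star_bop _ _ B_csubspace B_closed])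
  fix a s
  have "star (\<pi> a * u s * E1) = \<pi> (\<alpha> (- s) (star a)) * u (- s) * E1"
    by (simp add: \<pi>_simps(5)[symmetric] U_star proj_star covariance)
  then show "star (\<pi> a * u s * E1) \<in> B" using B_gen by simp
qed (auto intro: csubspaceD(3)[OF B_csubspace])

lemma opsys_B: "opsys B"
  unfolding opsys_def
  using B_csubspace B_star E1_in_B B_unit proj_star proj_idem by blast

lemma B_module: "x \<in> B \<Longrightarrow> x * \<pi> b \<in> B"
proof (rule B_mapsto[OF bounded_linear_mult_left _ _ B_csubspace B_closed])
  fix a s
  have "\<pi> a * u s * E1 * \<pi> b = \<pi> (a * \<alpha> s b) * u s * E1"
    by (simp add: covariance \<pi>_simps)
  then show "\<pi> a * u s * E1 * \<pi> b \<in> B" using B_gen by simp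
qed (auto simp: scaleC_bop_mult intro: csubspaceD(3)[OF B_csubspace])

lemma B_conj: "x \<in> B \<Longrightarrow> conj_action t x \<in> B"
proof (rule B_mapsto[OF bounded_linear_conj_action _ _ B_csubspace B_closed])
  fix a s
  have "conj_action t (\<pi> a * u s * E1) = \<pi> (\<alpha> t a) * u (t + s + - t) * E1"
    by (simp add: conj_action_eq covariance U_add U_diff)
  then show "conj_action t (\<pi> a * u s * E1) \<in> B" using B_gen by metis
qed (auto simp: conj_action_linear intro: csubspaceD(3)[OF B_csubspace])

lemma operator_module_B: "operator_module \<alpha> B conj_action m"
  unfolding operator_module_def
  by (simp add: opsys_B gamma_action_conj B_conj right_moduleI B_module conj_action_module)

subsection \<open>The minimal tensor product and its matrix subsystems\<close>

lemma AB_gen: "\<rho> a \<otimes>\<^sub>o T \<in> AB"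
  unfolding min_tensor_B_def by (rule closed_span_base) blast

lemma AB_csubspace: "csubspace AB" unfolding min_tensor_B_def by (rule closed_span_csubspace)

lemma AB_closed: "closed AB" by (simp add: min_tensor_B_def)

lemma AB_mapsto:
  fixes f :: "('h \<times> 'g tuples) bop \<Rightarrow> ('h \<times> 'g tuples) bop"
  assumes "bounded_linear f" "\<And>x c. f x \<in> C \<Longrightarrow> f (c *\<^sub>C x) \<in> C"
    "\<And>a T. f (\<rho> a \<otimes>\<^sub>o T) \<in> C" "csubspace C" "closed C" "x \<in> AB"
  shows "f x \<in> C"
proof (rule closed_span_mapsto[where f = f and C = C and G = "{\<rho> a \<otimes>\<^sub>o T |a T. True}"])
  show "x \<in> closure (cspan {\<rho> a \<otimes>\<^sub>o T |a T. True})" using assms(6) by (simp add: min_tensor_B_def)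
  show "f y \<in> C" if "y \<in> {\<rho> a \<otimes>\<^sub>o T |a T. True}" for y using assms(3) that by blast
qed (rule assms, assumption?)+

lemma opsys_AB: "opsys AB"
proof -
  have "star x \<in> AB" if "x \<in> AB" for x
    by (rule AB_mapsto[OF bounded_linear_star_bop _ _ AB_csubspace AB_closed that])
      (auto simp: tensor_star star_homD(5)[OF \<rho>(1), symmetric] AB_gen intro: csubspaceD(3)[OF AB_csubspace])
  moreover have "1 \<in> AB" using AB_gen[of 1 1] by (simp add: star_homD[OF \<rho>(1)] tensor_one)
  ultimately show ?thesis
    unfolding opsys_def using AB_csubspace by (auto intro!: bexI[of _ 1])
qed

lemma gamma_action_AB: "gamma_action AB conj_action"
proof (rule gamma_action_conj)
  fix t x assume x: "x \<in> AB"
  show "conj_action t x \<in> AB"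
  proof (rule AB_mapsto[OF bounded_linear_conj_action _ _ AB_csubspace AB_closed x])
    show "conj_action t (\<rho> a \<otimes>\<^sub>o T) \<in> AB" for a T
      by (simp add: conj_action_def U_op_def tensor_star tensor_mult AB_gen)
  qed (auto simp: conj_action_linear intro: csubspaceD(3)[OF AB_csubspace])
qed

lemma matrix_sys_eq:
  fixes F :: "'y set"
  assumes F: "finite F"
  shows "matrix_sys \<rho> F = {amp \<rho> F X |X. True}"
proof
  let ?R = "{amp \<rho> F X |X :: 'y \<Rightarrow> 'y \<Rightarrow> 'a. True}"
  have "csubspace ?R"
  proof (rule csubspaceI)
    have "amp \<rho> F (\<lambda>k l. 0 *\<^sub>C 0) = 0" unfolding amp_linear(2)[OF \<rho>(1)] by simp
    then show "0 \<in> ?R" by (intro CollectI exI[of _ "\<lambda>k l. 0 *\<^sub>C 0"]) simp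
  next
    fix x y assume "x \<in> ?R" "y \<in> ?R"
    then show "x + y \<in> ?R" using amp_linear(1)[OF \<rho>(1), of F] by (auto simp: eq_commute)
  next
    fix c x assume "x \<in> ?R"
    then show "c *\<^sub>C x \<in> ?R" using amp_linear(2)[OF \<rho>(1), of F] by (auto simp: eq_commute)
  qed
  moreover have "\<rho> a \<otimes>\<^sub>o matrix_unit s t = amp \<rho> F (\<lambda>k l. if k = s \<and> l = t then a else 0)"
    if "s \<in> F" "t \<in> F" for a s t
    using that by (intro bop_eq_blockI) (auto simp: block_amp[OF F] block_tensor_matrix_unit star_hom_linear[OF \<rho>(1)])
  ultimately show "matrix_sys \<rho> F \<subseteq> ?R"
    unfolding matrix_sys_def by (intro cspan_minimal) auto
  have "amp \<rho> F X \<in> matrix_sys \<rho> F" for X :: "'y \<Rightarrow> 'y \<Rightarrow> 'a"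
    unfolding matrix_sys_def amp_def
    by (intro csubspace_sum csubspace_span, rule cspan_base, blast)
  then show "?R \<subseteq> matrix_sys \<rho> F" by blast
qed

lemma amp_in_matrix_sys: "finite F \<Longrightarrow> amp \<rho> F X \<in> matrix_sys \<rho> F"
  by (auto simp: matrix_sys_eq)

lemma matrix_sys_cases:
  assumes "x \<in> matrix_sys \<rho> F" "finite F"
  obtains X where "x = amp \<rho> F X"
  using assms by (auto simp: matrix_sys_eq)

lemma amp_in_AB: "amp \<rho> F X \<in> AB"
  unfolding amp_def by (intro csubspace_sum AB_csubspace AB_gen)

lemma opsys_matrix_sys:
  assumes F: "finite F"
  shows "opsys (matrix_sys \<rho> F)"
  unfolding opsys_def
proof (intro conjI ballI bexI)
  show "csubspace (matrix_sys \<rho> F)" unfolding matrix_sys_def by (rule csubspace_span)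
  let ?e = "amp \<rho> F mat_one"
  show "?e \<in> matrix_sys \<rho> F" "star ?e = ?e" "?e * ?e = ?e"
    using amp_in_matrix_sys[OF F] by (simp_all add: amp_one_star[OF \<rho>(1)] amp_one_mult[OF F \<rho>(1)])
  fix x assume "x \<in> matrix_sys \<rho> F"
  then obtain X where x: "x = amp \<rho> F X" using F by (rule matrix_sys_cases)
  show "star x \<in> matrix_sys \<rho> F" unfolding x amp_star[OF \<rho>(1)] by (rule amp_in_matrix_sys[OF F])
  show "?e * x = x" "x * ?e = x" by (simp_all add: x amp_one_mult[OF F \<rho>(1)])
qed

text \<open>The diagonal operator \<pi>(b) multiplies column t by b twisted by the inverse of
  \<open>tbar t\<close>, again an element of the algebra. For finite F the module action therefore
  stays in M_F(A).\<close>

lemma amp_\<pi>: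
  assumes F: "finite F"
  shows "amp \<rho> F X * \<pi> b = amp \<rho> F (\<lambda>s t. X s t * \<alpha> (- tbar t) b)"
  by (rule bapply_eqI, rule slice_eqI)
    (simp add: bop_apply_simps slice_amp[OF F] slice_\<pi> star_homD(3)[OF \<rho>(1)])

lemma right_module_matrix_sys:
  assumes F: "finite F"
  shows "right_module (matrix_sys \<rho> F) m"
proof (rule right_moduleI)
  fix x a assume "x \<in> matrix_sys \<rho> F"
  then obtain X where x: "x = amp \<rho> F X" using F by (rule matrix_sys_cases)
  show "x * \<pi> a \<in> matrix_sys \<rho> F" unfolding x amp_\<pi>[OF F] by (rule amp_in_matrix_sys[OF F])
qed

lemma conj_action_amp:
  assumes F: "finite F"
  shows "conj_action r (amp \<rho> F X) = amp \<rho> (tshift r ` F) (\<lambda>s t. X (tshift (- r) s) (tshift (- r) t))"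
proof (rule bapply_eqI, rule slice_eqI)
  fix \<zeta> p
  have inj: "inj_on (tshift r) F" using bij_tshift bij_is_inj inj_on_subset by blast
  have mem: "tshift (- r) p \<in> F \<longleftrightarrow> p \<in> tshift r ` F"
    by (metis imageE image_eqI tshift_cancel)
  have "finite (tshift r ` F)" using F by simp
  then show "slice p (conj_action r (amp \<rho> F X) \<cdot> \<zeta>) =
      slice p (amp \<rho> (tshift r ` F) (\<lambda>s t. X (tshift (- r) s) (tshift (- r) t)) \<cdot> \<zeta>)"
    by (simp add: conj_action_eq bop_apply_simps slice_U slice_amp F mem sum.reindex[OF inj])
qed

lemma conj_action_matrix_sys:
  assumes F: "finite F"
  shows "conj_action r ` matrix_sys \<rho> F = matrix_sys \<rho> (tshift r ` F)"
proof -
  have sub: "conj_action r ` matrix_sys \<rho> F \<subseteq> matrix_sys \<rho> (tshift r ` F)" if "finite F" for r F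
    using that by (auto simp: matrix_sys_eq conj_action_amp)
  have "matrix_sys \<rho> (tshift r ` F) \<subseteq> conj_action r ` matrix_sys \<rho> F"
  proof
    fix x assume x: "x \<in> matrix_sys \<rho> (tshift r ` F)"
    have "tshift (- r) ` tshift r ` F = F" by (simp add: image_image)
    then have "conj_action (- r) x \<in> matrix_sys \<rho> F"
      using sub[of "tshift r ` F" "- r"] x F by auto
    then show "x \<in> conj_action r ` matrix_sys \<rho> F"
      by (intro image_eqI[of _ _ "conj_action (- r) x"]) simp_all
  qed
  with sub[OF F] show ?thesis by blast
qed

text \<open>In row p the translation u s has its only entry in column \<open>tshift (- s) p\<close>,
  and E1 removes that column unless it is a tuple of length one.\<close>

lemma compression_gen:
  assumes F: "finite F"
  shows "(1 \<otimes>\<^sub>o coord_proj F) * (\<pi> a * u s * E1) * (1 \<otimes>\<^sub>o coord_proj F) =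
    amp \<rho> F (\<lambda>p q. if q = tshift (- s) p \<and> snd q = [] then \<alpha> (- tbar p) a else 0)"
proof (rule bapply_eqI, rule slice_eqI)
  fix \<zeta> p
  have "\<rho> (if q = tshift (- s) p \<and> snd q = [] then \<alpha> (- tbar p) a else 0) \<cdot> slice q \<zeta> =
     (if q = tshift (- s) p then if snd q = [] then \<rho> (\<alpha> (- tbar p) a) \<cdot> slice q \<zeta> else 0 else 0)" for q
    by (simp add: star_hom_linear[OF \<rho>(1)] bop_apply_simps)
  then show "slice p (((1 \<otimes>\<^sub>o coord_proj F) * (\<pi> a * u s * E1) * (1 \<otimes>\<^sub>o coord_proj F)) \<cdot> \<zeta>) =
    slice p (amp \<rho> F (\<lambda>p q. if q = tshift (- s) p \<and> snd q = [] then \<alpha> (- tbar p) a else 0) \<cdot> \<zeta>)"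
    using F by (simp add: bop_apply_simps slice_coord_proj slice_\<pi> slice_U slice_amp)
qed

end

section \<open>Contractivity of completely positive maps\<close>

text \<open>The map is applied to the positive matrix with rows \<open>(\<parallel>x\<parallel>e, x)\<close> and \<open>(x\<^sup>*, \<parallel>x\<parallel>e)\<close>.\<close>

lemma cp_contractive:
  fixes \<phi> :: "'x bop \<Rightarrow> 'x bop"
  assumes \<phi>: "cp E D \<phi>" and E: "csubspace E" "\<And>x. x \<in> E \<Longrightarrow> star x \<in> E"
    and e: "e \<in> E" "star e = e" "e * e = e" "\<And>x. x \<in> E \<Longrightarrow> e * x = x \<and> x * e = x"
    and le: "norm (\<phi> e) \<le> 1"
  shows "ccp E D \<phi>"
  unfolding ccp_def
proof (intro conjI ballI \<phi>)
  fix x assume x: "x \<in> E"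
  have lin: "\<phi> (c *\<^sub>C y) = c *\<^sub>C \<phi> y" if "y \<in> E" for c y
    using \<phi> that by (simp add: cp_def clinear_on_def)
  show "norm (\<phi> x) \<le> norm x"
  proof (cases "x = 0")
    case True
    have "\<phi> (0 *\<^sub>C 0) = 0 *\<^sub>C \<phi> 0" by (rule lin[OF csubspaceD(1)[OF E(1)]])
    then show ?thesis using True by simp
  next
    case False
    define c where "c = norm x"
    have c: "c > 0" using False by (simp add: c_def)
    define X where "X i j = (if i = j then complex_of_real c *\<^sub>C e else if i = (0::nat) then x else star x)" for i j :: nat
    have ce: "complex_of_real c *\<^sub>C e \<in> E" by (rule csubspaceD(3)[OF E(1) e(1)])
    have XE: "X i j \<in> E" for i j using ce x E(2) by (simp add: X_def)
    have "mat_pos 2 X"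
      unfolding mat_pos_def
    proof
      fix \<xi> :: "nat \<Rightarrow> 'x ell2"
      let ?a = "norm (e \<cdot> \<xi> 0)" and ?b = "norm (e \<cdot> \<xi> 1)" and ?z = "cinner (\<xi> 0) (x \<cdot> \<xi> 1)"
      have ee: "cinner (\<xi> i) (e \<cdot> \<xi> i) = complex_of_real ((norm (e \<cdot> \<xi> i))\<^sup>2)" for i
        using cinner_star_right[of "\<xi> i" e "e \<cdot> \<xi> i"] e(2,3)
        by (simp add: cinner_self_norm flip: bop_apply_simps(6))
      \<comment> \<open>Inserting e on both sides bounds the off-diagonal term by the same two norms
        that occur in the diagonal terms; the whole form then dominates c (?a - ?b)^2.\<close>
      have "x = e * (x * e)" using e(4)[OF x] by simp
      then have "?z = cinner (\<xi> 0) ((e * (x * e)) \<cdot> \<xi> 1)" by (rule arg_cong)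
      also have "\<dots> = cinner (e \<cdot> \<xi> 0) (x \<cdot> e \<cdot> \<xi> 1)"
        using cinner_star[of e "\<xi> 0" "x \<cdot> e \<cdot> \<xi> 1"] by (simp add: bop_apply_simps e(2))
      finally have "cmod ?z \<le> ?a * (c * ?b)"
        unfolding c_def by (simp only: order_trans[OF cinner_bound mult_left_mono[OF norm_bapply norm_ge_zero]])
      then have "- (?a * (c * ?b)) \<le> Re ?z" using abs_Re_le_cmod[of ?z] by linarith
      moreover have "0 \<le> c * (?a - ?b)\<^sup>2" using c by simp
      ultimately have "0 \<le> c * ?a\<^sup>2 + c * ?b\<^sup>2 + 2 * Re ?z"
        by (simp add: power2_eq_square algebra_simps)
      moreover have "(\<Sum>i<2. \<Sum>j<2. cinner (\<xi> i) (X i j \<cdot> \<xi> j)) =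
          complex_of_real (c * ?a\<^sup>2 + c * ?b\<^sup>2 + 2 * Re ?z)"
        using complex_add_cnj[of ?z] cinner_commute[of "x \<cdot> \<xi> 1" "\<xi> 0"]
        by (simp add: numeral_2_eq_2 X_def bop_apply_simps cinner_simps ee cinner_star_right)
      ultimately show "0 \<le> (\<Sum>i<2. \<Sum>j<2. cinner (\<xi> i) (X i j \<cdot> \<xi> j))"
        by (simp only: less_eq_complex_def Re_complex_of_real Im_complex_of_real) simp
    qed
    then have pos: "mat_pos 2 (\<lambda>i j. \<phi> (X i j))"
      using \<phi> XE unfolding cp_def by blast
    have p: "0 \<le> c * cinner \<xi> (\<phi> e \<cdot> \<xi>) + cinner \<xi> (\<phi> x \<cdot> \<eta>) + (cinner \<eta> (\<phi> (star x) \<cdot> \<xi>) + c * cinner \<eta> (\<phi> e \<cdot> \<eta>))" for \<xi> \<eta>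
      using spec[OF pos[unfolded mat_pos_def], of "\<lambda>i. if i = 0 then \<xi> else \<eta>"]
      by (simp add: numeral_2_eq_2 X_def lin[OF e(1)] bop_apply_simps cinner_simps)
    have bound: "- 2 * Re (cinner \<xi> (\<phi> x \<cdot> \<eta>)) \<le> c * (norm \<xi>)\<^sup>2 + c * (norm \<eta>)\<^sup>2" for \<xi> \<eta>
    proof -
      have im: "Im (cinner \<zeta> (\<phi> e \<cdot> \<zeta>)) = 0" for \<zeta>
        using p[of \<zeta> 0] c by (simp add: less_eq_complex_def)
      \<comment> \<open>The vanishing imaginary part at \<i>\<eta> shows that the two off-diagonal
        terms have equal real parts; this replaces an appeal to \<phi> preserving adjoints.\<close>
      have "Re (cinner \<xi> (\<phi> x \<cdot> \<eta>)) = Re (cinner \<eta> (\<phi> (star x) \<cdot> \<xi>))"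
        using p[of \<xi> "\<i> *\<^sub>C \<eta>"] im[of \<xi>] im[of \<eta>] im[of "\<i> *\<^sub>C \<eta>"]
        by (simp add: less_eq_complex_def bapply_simps cinner_simps)
      moreover have "Re (cinner \<zeta> (\<phi> e \<cdot> \<zeta>)) \<le> (norm \<zeta>)\<^sup>2" for \<zeta>
      proof -
        have "Re (cinner \<zeta> (\<phi> e \<cdot> \<zeta>)) \<le> norm \<zeta> * (norm (\<phi> e) * norm \<zeta>)"
          by (intro order_trans[OF complex_Re_le_cmod] order_trans[OF cinner_bound] mult_left_mono norm_bapply) simp
        also have "\<dots> \<le> norm \<zeta> * (1 * norm \<zeta>)" by (intro mult_left_mono mult_right_mono le) auto
        finally show ?thesis by (simp add: power2_eq_square)
      qed
      then have "c * Re (cinner \<zeta> (\<phi> e \<cdot> \<zeta>)) \<le> c * (norm \<zeta>)\<^sup>2" for \<zeta> using c by simp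
      from add_mono[OF this[of \<xi>] this[of \<eta>]]
      show ?thesis
        using p[of \<xi> \<eta>] calculation by (simp add: less_eq_complex_def)
    qed
    show ?thesis
    proof (rule norm_bop_bound)
      fix \<eta>
      let ?n = "norm \<eta>" and ?d = "norm (\<phi> x \<cdot> \<eta>)"
      show "?d \<le> norm x * ?n"
      proof (cases "\<eta> = 0 \<or> \<phi> x \<cdot> \<eta> = 0")
        case False
        \<comment> \<open>Antiparallel to \<phi>(x)\<eta> and as long as \<eta>: the sign converts
          the lower bound on the form into an upper bound on the norm.\<close>
        define \<xi> where "\<xi> = (- (?n / ?d)) *\<^sub>R (\<phi> x \<cdot> \<eta>)"
        have "norm \<xi> = ?n" using False by (simp add: \<xi>_def)
        moreover have "Re (cinner \<xi> (\<phi> x \<cdot> \<eta>)) = - (?n * ?d)"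
          using False by (simp add: \<xi>_def cinner_minus cinner_scaleR_left cinner_self_norm power2_eq_square)
        ultimately have "?n * ?d \<le> ?n * (c * ?n)"
          using bound[of \<xi> \<eta>] by (simp add: power2_eq_square mult_ac)
        then show ?thesis using False by (simp add: c_def)
      qed auto
    qed simp
  qed
qed

lemma cp_mat_pos:
  "cp E D \<phi> \<Longrightarrow> (\<And>i j. i < n \<Longrightarrow> j < n \<Longrightarrow> X i j \<in> E) \<Longrightarrow> mat_pos n X \<Longrightarrow>
    mat_pos n (\<lambda>i j. \<phi> (X i j))"
  by (simp add: cp_def)

section \<open>Families of translates\<close>

text \<open>Indexing the translates of a single map freely by the group turns them into a \<open>\<Gamma>\<close>-family.\<close>

definition translate where
  "translate r E \<psi> = (\<lambda>x\<in>conj_action r ` E. conj_action r (\<psi> (conj_action (- r) x)))"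

lemma translate_apply: "x \<in> E \<Longrightarrow> translate r E \<psi> (conj_action r x) = conj_action r (\<psi> x)"
  by (simp add: translate_def)

lemma opsys_conj_action:
  assumes "opsys E" shows "opsys (conj_action r ` E)"
proof -
  obtain e where E: "csubspace E" "\<forall>x\<in>E. star x \<in> E"
    and e: "e \<in> E" "star e = e" "e * e = e" "\<forall>x\<in>E. e * x = x \<and> x * e = x"
    using assms unfolding opsys_def by blast
  have "csubspace (conj_action r ` E)"
  proof (rule csubspaceI)
    show "0 \<in> conj_action r ` E"
      using csubspaceD(1)[OF E(1)] by (intro image_eqI[of _ _ 0]) (simp_all add: conj_action_def)
  qed (use csubspaceD(2,3)[OF E(1)] in \<open>auto simp flip: conj_action_linear\<close>)
  moreover have "\<forall>x\<in>conj_action r ` E. star x \<in> conj_action r ` E"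
    using E(2) by (auto simp flip: conj_action_star)
  moreover have "\<exists>e\<in>conj_action r ` E. star e = e \<and> e * e = e \<and> (\<forall>x\<in>conj_action r ` E. e * x = x \<and> x * e = x)"
    using e by (intro bexI[of _ "conj_action r e"]) (auto simp flip: conj_action_star conj_action_mult)
  ultimately show ?thesis by (simp add: opsys_def)
qed

lemma cp_translate:
  assumes \<psi>: "cp E D \<psi>" and E: "csubspace E" and D: "\<And>x. x \<in> D \<Longrightarrow> conj_action r x \<in> D"
  shows "cp (conj_action r ` E) D (translate r E \<psi>)"
  unfolding cp_def
proof (intro conjI allI impI)
  have "\<psi> x \<in> D" if "x \<in> E" for x using \<psi> that by (auto simp: cp_def)
  then show "translate r E \<psi> \<in> conj_action r ` E \<rightarrow>\<^sub>E D"
    using D by (auto simp: translate_def)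
  have add: "\<psi> (x + y) = \<psi> x + \<psi> y" if "x \<in> E" "y \<in> E" for x y
    using \<psi> that by (simp add: cp_def clinear_on_def)
  have scale: "\<psi> (c *\<^sub>C x) = c *\<^sub>C \<psi> x" if "x \<in> E" for x c
    using \<psi> that by (simp add: cp_def clinear_on_def)
  show "clinear_on (conj_action r ` E) (translate r E \<psi>)"
    unfolding clinear_on_def
  proof (intro conjI ballI allI; elim imageE; hypsubst)
    fix x y assume xy: "x \<in> E" "y \<in> E"
    show "translate r E \<psi> (conj_action r x + conj_action r y) =
        translate r E \<psi> (conj_action r x) + translate r E \<psi> (conj_action r y)"
      unfolding conj_action_linear(1)[symmetric] translate_apply[OF csubspaceD(2)[OF E xy]]
      by (simp only: translate_apply xy add conj_action_linear)
  next
    fix c x assume x: "x \<in> E"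
    show "translate r E \<psi> (c *\<^sub>C conj_action r x) = c *\<^sub>C translate r E \<psi> (conj_action r x)"
      unfolding conj_action_linear(2)[symmetric] translate_apply[OF csubspaceD(3)[OF E x]]
      by (simp only: translate_apply x scale conj_action_linear)
  qed
  fix n X assume X: "\<forall>i<n. \<forall>j<n. X i j \<in> conj_action r ` E" and pos: "mat_pos n X"
  have EX: "conj_action (- r) (X i j) \<in> E" if "i < n" "j < n" for i j
  proof -
    have "X i j \<in> conj_action r ` E" using X that by blast
    then obtain y where "y \<in> E" "X i j = conj_action r y" by blast
    then show ?thesis by simp
  qed
  have "mat_pos n (\<lambda>i j. \<psi> (conj_action (- r) (X i j)))"
    by (rule cp_mat_pos[OF \<psi> EX mat_pos_conj_action[OF pos]])
  then have "mat_pos n (\<lambda>i j. conj_action r (\<psi> (conj_action (- r) (X i j))))"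
    by (rule mat_pos_conj_action)
  then show "mat_pos n (\<lambda>i j. translate r E \<psi> (X i j))"
    using X by (simp add: mat_pos_def translate_def)
qed

lemma ccp_translate:
  assumes \<psi>: "ccp E D \<psi>" and E: "csubspace E" and D: "\<And>x. x \<in> D \<Longrightarrow> conj_action r x \<in> D"
  shows "ccp (conj_action r ` E) D (translate r E \<psi>)"
  using cp_translate[of E D \<psi> r] assms by (auto simp: ccp_def translate_apply norm_conj_action)

lemma gamma_family_translates:
  fixes E :: "('h \<times> 'g::group_add tuples) bop set"
  assumes \<psi>: "cp E D \<psi>" and E: "opsys E" "E \<subseteq> A"
    and A: "gamma_action A conj_action" and D: "gamma_action D conj_action"
  shows "gamma_family (A, conj_action) (D, conj_action) (UNIV :: 'g set) (+)
    (\<lambda>r. conj_action r ` E) (\<lambda>r. translate r E \<psi>)"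
proof -
  have A': "conj_action r x \<in> A" if "x \<in> A" for r x using A that unfolding gamma_action_def by blast
  have D': "conj_action r x \<in> D" if "x \<in> D" for r x using D that unfolding gamma_action_def by blast
  have E': "csubspace E" using E(1) by (simp add: opsys_def)
  have 1: "translate (t + i) E \<psi> (conj_action t x) = conj_action t (translate i E \<psi> x)"
    if x: "x \<in> conj_action i ` E" for t i x
  proof -
    obtain y where y: "y \<in> E" "x = conj_action i y" using x by blast
    show ?thesis unfolding y(2) conj_action_add[symmetric] translate_apply[OF y(1)] by (rule refl)
  qed
  have 2: "conj_action t ` conj_action i ` E \<subseteq> conj_action (t + i) ` E" for t i
    by (auto simp: conj_action_add)
  have 3: "conj_action i ` E \<subseteq> A" for i using A' E(2) by auto
  have 4: "cp (conj_action i ` E) D (translate i E \<psi>)" for i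
    by (rule cp_translate[OF \<psi> E']) (rule D')
  show ?thesis
    unfolding gamma_family_def prod.case
  proof (intro conjI ballI allI)
    fix s t i :: 'g
    show "0 + i = i" "t + i \<in> UNIV" "s + t + i = s + (t + i)" by (simp_all add: add.assoc)
    show "opsys (conj_action i ` E)" by (rule opsys_conj_action[OF E(1)])
    show "conj_action i ` E \<subseteq> A" "conj_action t ` conj_action i ` E \<subseteq> conj_action (t + i) ` E"
      "cp (conj_action i ` E) D (translate i E \<psi>)" by (rule 3 2 4)+
    show "translate (t + i) E \<psi> (conj_action t b) = conj_action t (translate i E \<psi> b)"
      if "b \<in> conj_action i ` E" for b using that by (rule 1)
  qed
qed

context faithful_action
begin

text \<open>By covariance, acting by a after translating by r is translating after acting by
  \<open>\<alpha> (- r) a\<close>, so translates inherit the module structure.\<close>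

lemma right_module_translate:
  assumes E: "right_module E m"
  shows "right_module (conj_action r ` E) m"
proof (rule right_moduleI)
  fix x a assume "x \<in> conj_action r ` E"
  then obtain y where y: "y \<in> E" "x = conj_action r y" by blast
  have "x * \<pi> a = conj_action r (m y (\<alpha> (- r) a))"
    by (simp add: y conj_action_module) (simp add: pi_mult_def)
  then show "x * \<pi> a \<in> conj_action r ` E" using E y by (auto simp: right_module_def)
qed

lemma module_map_translate:
  assumes \<psi>: "module_map (E, m) (D, m) \<psi>"
  shows "module_map (conj_action r ` E, m) (D, m) (translate r E \<psi>)"
  unfolding module_map_def prod.case
proof (intro ballI allI impI)
  fix x a assume "x \<in> conj_action r ` E" and xa: "m x a \<in> conj_action r ` E"
  then obtain y where y: "y \<in> E" "x = conj_action r y" by blast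
  have eq: "m x a = conj_action r (m y (\<alpha> (- r) a))" by (simp add: y conj_action_module)
  with xa have E: "m y (\<alpha> (- r) a) \<in> E" by (auto dest: arg_cong[where f = "conj_action (- r)"])
  then have "\<psi> (m y (\<alpha> (- r) a)) = m (\<psi> y) (\<alpha> (- r) a)"
    using \<psi> y(1) by (simp add: module_map_def)
  then show "translate r E \<psi> (m x a) = m (translate r E \<psi> x) a"
    unfolding eq translate_apply[OF E] unfolding y(2) translate_apply[OF y(1)]
    by (simp add: conj_action_module)
qed

text \<open>Each translate is itself a c.p. module map, so the rule \<open>module_map\<close> gives
  A-admissibility, while the rule \<open>family\<close>, reached from the group as index set, gives
  \<Gamma>-admissibility.\<close>

lemma admissible_translates:
  assumes \<psi>: "cp E D \<psi>" "module_map (E, m) (D, m) \<psi>"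
    and E: "opsys E" "right_module E m \<or> E = AB" "E \<subseteq> A"
    and A: "opsys A" "gamma_action A conj_action"
    and D: "opsys D" "gamma_action D conj_action" "(D, m) \<in> module_systems \<alpha> \<rho>"
  shows "admissible_family (module_systems \<alpha> \<rho>) A conj_action m D conj_action m
    {(conj_action r ` E, translate r E \<psi>) |r. True}"
  unfolding admissible_family_def
proof (intro conjI ballI)
  have "{(conj_action r ` E, translate r E \<psi>) |r. True} =
      (\<lambda>r. (conj_action r ` E, translate r E \<psi>)) ` (UNIV :: 'g set)" by auto
  then show "Gamma_admissible (A, conj_action) (D, conj_action)
      {(conj_action r ` E, translate r E \<psi>) |r. True}"
    using Gamma_admissible_family[OF A D(1,2) gamma_family_translates[OF \<psi>(1) E(1,3) A(2) D(2)]]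
    by simp
  fix P assume "P \<in> {(conj_action r ` E, translate r E \<psi>) |r. True}"
  then obtain r where P: "P = (conj_action r ` E, translate r E \<psi>)" by blast
  have D': "conj_action r x \<in> D" if "x \<in> D" for x using D(2) that unfolding gamma_action_def by blast
  have AB: "conj_action r ` AB = AB" using gamma_action_AB by (simp add: gamma_action_def)
  have "(conj_action r ` E, m) \<in> module_systems \<alpha> \<rho>"
    using E(2) AB right_module_translate[of E r] opsys_conj_action[OF E(1), of r]
    by (auto simp: module_systems_def)
  moreover have "csubspace E" using E(1) by (simp add: opsys_def)
  ultimately show "case P of (E, \<psi>) \<Rightarrow> A_admissible (module_systems \<alpha> \<rho>) (E, m) (D, m) \<psi>"
    unfolding P prod.case
    using D(3) D' \<psi> by (intro A_admissible.module_map cp_translate module_map_translate)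
qed

end

subsection \<open>Compression and averaging\<close>

text \<open>The weight w is a member of the net transported to tuples and living on those of length
  one; \<open>F_free\<close> makes r recoverable from the translate of F by r.\<close>

locale weighted_action = faithful_action \<alpha> \<rho>
  for \<alpha> :: "'g::group_add \<Rightarrow> 'a::cstar_algebra \<Rightarrow> 'a" and \<rho> :: "'a \<Rightarrow> 'h bop" +
  fixes F :: "'g tuples set" and w :: "'g tuples \<Rightarrow> 'a"
  assumes F: "finite F" and w_star: "star (w s) = w s" and w_central: "w s * x = x * w s"
    and w_sum: "(\<Sum>s\<in>F. w s * w s) = 1"
    and w_support: "w s \<noteq> 0 \<Longrightarrow> s \<in> F \<and> snd s = []"
    and F_free: "tshift r ` F = F \<Longrightarrow> r = 0"
begin

abbreviation P :: "('h \<times> 'g tuples) bop" where "P \<equiv> 1 \<otimes>\<^sub>o coord_proj F"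

definition compress :: "('h \<times> 'g tuples) bop \<Rightarrow> ('h \<times> 'g tuples) bop" where
  "compress = (\<lambda>x\<in>B. P * x * P)"

definition coeff :: "('h \<times> 'g tuples) bop \<Rightarrow> 'g tuples \<Rightarrow> 'g tuples \<Rightarrow> 'a" where
  "coeff x s t = inv \<rho> (block x s t)"

text \<open>The entries of a row V for which \<open>average\<close> is conjugation by V of the
  matrix amplified along \<pi>. Such a conjugation preserves positivity, so only the amplification
  has to be examined.\<close>

definition leg :: "'g tuples \<Rightarrow> ('h \<times> 'g tuples) bop" where
  "leg s = \<pi> (w s) * u (tbar s) * E1"

definition average :: "('h \<times> 'g tuples) bop \<Rightarrow> ('h \<times> 'g tuples) bop" where
  "average = (\<lambda>x\<in>matrix_sys \<rho> F. \<Sum>s\<in>F. \<Sum>t\<in>F. leg s * \<pi> (coeff x s t) * star (leg t))"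

lemma coeff_amp: "s \<in> F \<Longrightarrow> t \<in> F \<Longrightarrow> coeff (amp \<rho> F X) s t = X s t"
  by (simp add: coeff_def block_amp[OF F] inv_f_f[OF \<rho>(2)])

lemma average_amp: "average (amp \<rho> F X) = (\<Sum>s\<in>F. \<Sum>t\<in>F. leg s * \<pi> (X s t) * star (leg t))"
  by (simp add: average_def amp_in_matrix_sys[OF F] coeff_amp)

text \<open>In multiplicative notation \<open>tbar s - tbar t\<close> is s t^-1. Moving the second
  weight to the left across it produces a generator of B, so all values of \<open>average\<close>
  lie in B.\<close>

lemma leg_\<pi>_leg:
  "leg s * \<pi> a * star (leg t) =
    \<pi> (w s * \<alpha> (tbar s) a * \<alpha> (tbar s - tbar t) (w t)) * u (tbar s - tbar t) * E1"
  by (simp add: leg_def U_star proj_star \<pi>_simps(3) \<pi>_simps(5)[symmetric] w_star covariance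
      U_diff \<alpha>_add[symmetric])

lemma average_in_B: "average (amp \<rho> F X) \<in> B"
  unfolding average_amp leg_\<pi>_leg by (intro csubspace_sum B_csubspace B_gen)

lemma average_linear: "clinear_on (matrix_sys \<rho> F) average"
  unfolding clinear_on_def
proof (intro conjI ballI allI)
  fix x y assume "x \<in> matrix_sys \<rho> F" "y \<in> matrix_sys \<rho> F"
  then obtain X Y where xy: "x = amp \<rho> F X" "y = amp \<rho> F Y" using F matrix_sys_cases by metis
  show "average (x + y) = average x + average y"
    unfolding xy amp_linear(1)[OF \<rho>(1), symmetric] average_amp
    by (simp add: \<pi>_simps(1) distrib_left distrib_right sum.distrib)
next
  fix c x assume "x \<in> matrix_sys \<rho> F"
  then obtain X where x: "x = amp \<rho> F X" using F by (rule matrix_sys_cases)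
  show "average (c *\<^sub>C x) = c *\<^sub>C average x"
    unfolding x amp_linear(2)[OF \<rho>(1), symmetric] average_amp
    by (simp add: \<pi>_simps(2) scaleC_bop_mult scaleC_sum_right)
qed

lemma sum_product_index:
  assumes "finite A"
  shows "(\<Sum>k\<in>A \<times> F. \<Sum>l\<in>A \<times> F. f k l) = (\<Sum>i\<in>A. \<Sum>j\<in>A. \<Sum>s\<in>F. \<Sum>t\<in>F. f (i, s) (j, t))"
proof -
  have eq: "(\<Sum>k\<in>A \<times> F. g k) = (\<Sum>i\<in>A. \<Sum>s\<in>F. g (i, s))" for g
    by (simp add: sum.cartesian_product)
  show ?thesis unfolding eq by (intro sum.cong refl) (rule sum.swap)
qed

text \<open>An n by n matrix over M_F(A) is a matrix over the algebra indexed by the pairs in {..<n}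
  \<times> F, to which \<open>amp_positive\<close> applies with \<pi> as the second representation.
  The legs only change the test vectors.\<close>

lemma average_cp: "cp (matrix_sys \<rho> F) B average"
  unfolding cp_def
proof (intro conjI allI impI)
  show "average \<in> matrix_sys \<rho> F \<rightarrow>\<^sub>E B"
  proof (rule PiE_I)
    fix x assume "x \<in> matrix_sys \<rho> F"
    then obtain X where "x = amp \<rho> F X" using F by (rule matrix_sys_cases)
    then show "average x \<in> B" using average_in_B by simp
  qed (simp add: average_def)
  show "clinear_on (matrix_sys \<rho> F) average" by (rule average_linear)
  fix n X assume X: "\<forall>i<n. \<forall>j<n. X i j \<in> matrix_sys \<rho> F" and pos: "mat_pos n X"
  have "\<forall>i j. \<exists>Z. i < n \<and> j < n \<longrightarrow> X i j = amp \<rho> F Z"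
    using X by (metis matrix_sys_cases F)
  then obtain Y where Y: "i < n \<Longrightarrow> j < n \<Longrightarrow> X i j = amp \<rho> F (Y i j)" for i j by metis
  let ?Y = "\<lambda>k l. Y (fst k) (fst l) (snd k) (snd l)"
  have "0 \<le> (\<Sum>k\<in>{..<n} \<times> F. \<Sum>l\<in>{..<n} \<times> F. cinner (\<eta> k) (\<rho> (?Y k l) \<cdot> \<eta> l))" for \<eta>
  proof -
    define \<xi> where "\<xi> i = (\<Sum>s\<in>F. ten (\<eta> (i, s)) (ket s))" for i
    have sl: "slice s (\<xi> i) = \<eta> (i, s)" if "s \<in> F" for s i
      using F that by (simp add: \<xi>_def slice_sum slice_ten coord_ket if_distrib[of "\<lambda>c. c *\<^sub>C _"] cong: if_cong)
    have "(\<Sum>i<n. \<Sum>j<n. cinner (\<xi> i) (X i j \<cdot> \<xi> j)) =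
        (\<Sum>i<n. \<Sum>j<n. \<Sum>s\<in>F. \<Sum>t\<in>F. cinner (\<eta> (i, s)) (\<rho> (Y i j s t) \<cdot> \<eta> (j, t)))"
      by (intro sum.cong refl) (simp add: Y cinner_amp sl)
    moreover have "0 \<le> (\<Sum>i<n. \<Sum>j<n. cinner (\<xi> i) (X i j \<cdot> \<xi> j))"
      using pos unfolding mat_pos_def by blast
    ultimately show ?thesis by (simp add: sum_product_index)
  qed
  from amp_positive[OF _ \<rho> star_hom_\<pi> this]
  have core: "0 \<le> (\<Sum>k\<in>{..<n} \<times> F. \<Sum>l\<in>{..<n} \<times> F. cinner (\<eta> k) (\<pi> (?Y k l) \<cdot> \<eta> l))" for \<eta>
    using F by blast
  show "mat_pos n (\<lambda>i j. average (X i j))"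
    unfolding mat_pos_def
  proof
    fix \<xi> :: "nat \<Rightarrow> ('h \<times> 'g tuples) ell2"
    have "(\<Sum>i<n. \<Sum>j<n. cinner (\<xi> i) (average (X i j) \<cdot> \<xi> j)) =
      (\<Sum>i<n. \<Sum>j<n. \<Sum>s\<in>F. \<Sum>t\<in>F. cinner (star (leg s) \<cdot> \<xi> i) (\<pi> (Y i j s t) \<cdot> star (leg t) \<cdot> \<xi> j))"
      by (intro sum.cong refl)
        (simp add: Y average_amp bop_sum_apply bop_apply_simps cinner_sum_right cinner_star)
    also have "\<dots> = (\<Sum>k\<in>{..<n} \<times> F. \<Sum>l\<in>{..<n} \<times> F.
        cinner (star (leg (snd k)) \<cdot> \<xi> (fst k)) (\<pi> (?Y k l) \<cdot> star (leg (snd l)) \<cdot> \<xi> (fst l)))"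
      by (simp add: sum_product_index)
    finally show "0 \<le> (\<Sum>i<n. \<Sum>j<n. cinner (\<xi> i) (average (X i j) \<cdot> \<xi> j))"
      using core[of "\<lambda>k. star (leg (snd k)) \<cdot> \<xi> (fst k)"] by simp
  qed
qed

text \<open>Distinct indices contribute nothing, and the diagonal terms add up by
  \<open>w_sum\<close>. That the unit goes to a projection is the bound used with
  \<open>cp_contractive\<close>.\<close>

lemma average_one: "average (amp \<rho> F mat_one) = E1"
proof -
  have "leg s * \<pi> (mat_one s t) * star (leg t) = (if s = t then \<pi> (w s * w s) * E1 else 0)" for s t
    unfolding leg_\<pi>_leg
    by (simp add: mat_one_def star_homD(4)[OF star_hom_\<alpha>] star_hom_linear(2)[OF star_hom_\<alpha>] \<pi>_simps \<alpha>_zero U_zero)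
  then have "average (amp \<rho> F mat_one) = (\<Sum>s\<in>F. \<pi> (w s * w s) * E1)"
    using F by (simp add: average_amp)
  also have "\<dots> = \<pi> (\<Sum>s\<in>F. w s * w s) * E1"
    by (simp add: star_hom_sum[OF star_hom_\<pi>] sum_distrib_right)
  finally show ?thesis by (simp add: w_sum \<pi>_simps)
qed

lemma average_ccp: "ccp (matrix_sys \<rho> F) B average"
proof (rule cp_contractive[OF average_cp, where e = "amp \<rho> F mat_one"])
  have o: "opsys (matrix_sys \<rho> F)" by (rule opsys_matrix_sys[OF F])
  then show "csubspace (matrix_sys \<rho> F)" "\<And>x. x \<in> matrix_sys \<rho> F \<Longrightarrow> star x \<in> matrix_sys \<rho> F"
    by (auto simp: opsys_def)
  show "norm (average (amp \<rho> F mat_one)) \<le> 1" unfolding average_one by (rule norm_proj)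
  show "amp \<rho> F mat_one * x = x \<and> x * amp \<rho> F mat_one = x" if "x \<in> matrix_sys \<rho> F" for x
    using that F by (elim matrix_sys_cases) (simp_all add: amp_one_mult[OF F \<rho>(1)])
qed (simp_all add: amp_in_matrix_sys[OF F] amp_one_star[OF \<rho>(1)] amp_one_mult[OF F \<rho>(1)])

text \<open>By \<open>amp_\<pi>\<close>, column t receives b twisted by the inverse of
  \<open>tbar t\<close>; the translation inside \<open>leg t\<close> undoes the twist, and
  centrality lets b pass the weight w t.\<close>

lemma average_module_map: "module_map (matrix_sys \<rho> F, m) (B, m) average"
  unfolding module_map_def prod.case
proof (intro ballI allI impI)
  fix x b assume "x \<in> matrix_sys \<rho> F"
  then obtain X where x: "x = amp \<rho> F X" using F by (rule matrix_sys_cases)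
  have "leg s * \<pi> (a * \<alpha> (- tbar t) b) * star (leg t) = leg s * \<pi> a * star (leg t) * \<pi> b" for s t a
  proof -
    have "\<pi> (w t) * \<pi> b = \<pi> b * \<pi> (w t)" by (simp add: w_central flip: \<pi>_simps(3))
    then have "star (leg t) * \<pi> b = \<pi> (\<alpha> (- tbar t) b) * star (leg t)"
      by (simp add: leg_def U_star proj_star \<pi>_simps(5)[symmetric] w_star mult.assoc)
        (simp add: U_\<pi>_assoc proj_\<pi>_assoc)
    then show ?thesis by (simp add: \<pi>_simps(3) mult.assoc)
  qed
  then show "average (m x b) = m (average x) b"
    unfolding x pi_mult_def amp_\<pi>[OF F] average_amp by (simp add: sum_distrib_right)
qed

lemma compress_gen: "compress (\<pi> a * u s * E1) =
    amp \<rho> F (\<lambda>p q. if q = tshift (- s) p \<and> snd q = [] then \<alpha> (- tbar p) a else 0)"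
  using compression_gen[OF F] by (simp add: compress_def B_gen)

end

section \<open>Closedness of the matrix subsystems and convergence on the crossed product\<close>

context faithful_action
begin

text \<open>As \<rho> is isometric, convergence of images forces the preimages to be Cauchy, and the
  algebra is complete.\<close>

lemma closed_range_\<rho>: "closed (range \<rho>)"
  unfolding closed_sequential_limits
proof (intro allI impI, elim conjE)
  fix x l assume x: "\<forall>n. x n \<in> range \<rho>" and l: "x \<longlonglongrightarrow> l"
  then have "\<forall>n. \<exists>a. x n = \<rho> a" by auto
  then obtain a where a: "\<And>n. x n = \<rho> (a n)" by metis
  have iso: "dist (\<rho> b) (\<rho> c) = dist b c" for b c
    by (simp add: dist_norm faithful_norm[OF \<rho>] flip: star_hom_linear(3)[OF \<rho>(1)])
  have "Cauchy x" using l by (rule LIMSEQ_imp_Cauchy)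
  then have "Cauchy a" by (simp add: Cauchy_def a iso)
  then obtain b where b: "a \<longlonglongrightarrow> b" using Cauchy_convergent convergent_def by blast
  then have "(\<lambda>n. \<rho> (a n)) \<longlonglongrightarrow> \<rho> b" by (simp add: lim_sequentially iso)
  then have "l = \<rho> b" using LIMSEQ_unique[OF l] by (simp flip: a)
  then show "l \<in> range \<rho>" by simp
qed

text \<open>M_F(A) is cut out by closed conditions: reassembling the blocks over F gives x back, and
  these blocks lie in the closed range of \<rho>. Hence compression of the closure B cannot leave
  M_F(A).\<close>

lemma closed_matrix_sys:
  fixes F :: "'y set"
  assumes F: "finite F"
  shows "closed (matrix_sys \<rho> F)"
proof -
  have bl: "bounded_linear (\<lambda>x :: ('h \<times> 'y) bop. block x s t)" for s t
    by (rule bounded_linear_intro[where K = 1])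
      (auto simp: block_simps norm_block simp flip: scaleC_of_real)
  have mu: "bounded_linear (\<lambda>S :: 'h bop. S \<otimes>\<^sub>o matrix_unit (s :: 'y) t)" for s t
    by (rule bounded_linear_intro[where K = 1])
      (auto simp: tensor_add_left tensor_scaleC_left norm_tensor_matrix_unit simp flip: scaleC_of_real)
  let ?g = "\<lambda>x :: ('h \<times> 'y) bop. \<Sum>s\<in>F. \<Sum>t\<in>F. block x s t \<otimes>\<^sub>o matrix_unit s t"
  have cont: "continuous_on UNIV ?g"
    by (intro continuous_on_sum linear_continuous_on bounded_linear_compose[OF mu bl])
  have "matrix_sys \<rho> F = {x. x = ?g x} \<inter> (\<Inter>s\<in>F. \<Inter>t\<in>F. (\<lambda>x. block x s t) -` range \<rho>)"
  proof (intro equalityI subsetI)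
    fix x assume "x \<in> matrix_sys \<rho> F"
    then obtain X where x: "x = amp \<rho> F X" using F by (rule matrix_sys_cases)
    have "?g x = x" unfolding x block_amp[OF F] unfolding amp_def by (intro sum.cong) auto
    moreover have "block x s t \<in> range \<rho>" if "s \<in> F" "t \<in> F" for s t
      using that by (simp add: x block_amp[OF F])
    ultimately show "x \<in> {x. x = ?g x} \<inter> (\<Inter>s\<in>F. \<Inter>t\<in>F. (\<lambda>x. block x s t) -` range \<rho>)"
      by simp
  next
    fix x assume x: "x \<in> {x. x = ?g x} \<inter> (\<Inter>s\<in>F. \<Inter>t\<in>F. (\<lambda>x. block x s t) -` range \<rho>)"
    have "\<rho> (inv \<rho> (block x s t)) = block x s t" if "s \<in> F" "t \<in> F" for s t
      using x that by (intro f_inv_into_f) auto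
    then have "?g x = amp \<rho> F (\<lambda>s t. inv \<rho> (block x s t))"
      by (simp add: amp_def)
    moreover have "x = ?g x" using x by simp
    ultimately have eq: "x = amp \<rho> F (\<lambda>s t. inv \<rho> (block x s t))" by (rule trans[rotated])
    show "x \<in> matrix_sys \<rho> F" by (subst eq) (rule amp_in_matrix_sys[OF F])
  qed
  moreover have "closed {x. x = ?g x}" by (intro closed_Collect_eq continuous_on_id cont)
  moreover have "closed ((\<lambda>x :: ('h \<times> 'y) bop. block x s t) -` range \<rho>)" for s t
    by (rule closed_vimage[OF closed_range_\<rho>]) (rule linear_continuous_on[OF bl])
  ultimately show ?thesis by (simp add: closed_INT closed_Int)
qed

text \<open>Contractivity uniform in i turns convergence on the dense span into convergence on B by
  splitting e into three parts. The algebraic assumptions are restricted to B because maps such as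
  \<open>compress\<close> are \<open>undefined\<close> elsewhere.\<close>

lemma B_tendsto:
  assumes add: "\<And>i x y. x \<in> B \<Longrightarrow> y \<in> B \<Longrightarrow> \<Theta> i (x + y) = \<Theta> i x + \<Theta> i y"
    and scale: "\<And>i c x. x \<in> B \<Longrightarrow> \<Theta> i (c *\<^sub>C x) = c *\<^sub>C \<Theta> i x"
    and contr: "\<And>i x. x \<in> B \<Longrightarrow> norm (\<Theta> i x) \<le> norm x"
    and gen: "\<And>a s. ((\<lambda>i. \<Theta> i (\<pi> a * u s * E1)) \<longlongrightarrow> \<pi> a * u s * E1) \<F>"
    and x: "x \<in> B"
  shows "((\<lambda>i. \<Theta> i x) \<longlongrightarrow> x) \<F>"
proof -
  let ?G = "{\<pi> a * u s * E1 |a s. True}"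
  let ?S = "{x \<in> B. ((\<lambda>i. \<Theta> i x) \<longlongrightarrow> x) \<F>}"
  have zero: "\<Theta> i 0 = 0" for i using scale[OF csubspaceD(1)[OF B_csubspace], of i 0] by simp
  have "csubspace ?S"
  proof (rule csubspaceI)
    show "0 \<in> ?S" using csubspaceD(1)[OF B_csubspace] by (simp add: zero)
    show "y + z \<in> ?S" if "y \<in> ?S" "z \<in> ?S" for y z
      using that csubspaceD(2)[OF B_csubspace, of y z] by (simp add: add tendsto_add)
    show "c *\<^sub>C y \<in> ?S" if "y \<in> ?S" for c y
    proof -
      have y: "y \<in> B" "((\<lambda>i. \<Theta> i y) \<longlongrightarrow> y) \<F>" using that by simp_all
      from bounded_linear.tendsto[OF bounded_linear_scaleC_bop y(2)]
      show ?thesis using csubspaceD(3)[OF B_csubspace y(1)] by (simp add: scale[OF y(1)])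
    qed
  qed
  then have span: "cspan ?G \<subseteq> ?S"
    using gen B_gen by (intro cspan_minimal) auto
  show ?thesis
  proof (rule tendstoI)
    fix e :: real assume e: "0 < e"
    have "x \<in> closure (cspan ?G)" using x by (simp add: B_eq)
    then obtain y where y: "y \<in> cspan ?G" "dist y x < e / 3"
      using e unfolding closure_approachable by (meson divide_pos_pos zero_less_numeral)
    have yS: "y \<in> B" "((\<lambda>i. \<Theta> i y) \<longlongrightarrow> y) \<F>" using span y(1) by auto
    have "\<forall>\<^sub>F i in \<F>. dist (\<Theta> i y) y < e / 3"
      by (rule tendstoD[OF yS(2)]) (use e in simp)
    then show "\<forall>\<^sub>F i in \<F>. dist (\<Theta> i x) x < e"
    proof (rule eventually_mono)
      fix i assume i: "dist (\<Theta> i y) y < e / 3"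
      have xy: "x + (-1) *\<^sub>C y \<in> B" using x yS(1) csubspaceD[OF B_csubspace] by blast
      have m1: "(-1) *\<^sub>C z = - z" for z :: "('h \<times> 'g tuples) bop"
        using scaleC_of_real[of "-1" z] by simp
      have "\<Theta> i x - \<Theta> i y = \<Theta> i (x + (-1) *\<^sub>C y)"
        unfolding add[OF x csubspaceD(3)[OF B_csubspace yS(1)]] scale[OF yS(1)] by (simp add: m1)
      then have "dist (\<Theta> i x) (\<Theta> i y) \<le> dist y x"
        using contr[OF xy, of i] by (simp add: dist_norm m1 norm_minus_commute)
      then show "dist (\<Theta> i x) x < e"
        using i y(2) dist_triangle[of "\<Theta> i x" x "\<Theta> i y"] dist_triangle[of "\<Theta> i y" x y] by linarith
    qed
  qed
qed

end

section \<open>Compression followed by averaging\<close>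

context weighted_action
begin

lemma compress_in: "x \<in> B \<Longrightarrow> compress x \<in> matrix_sys \<rho> F"
proof -
  assume x: "x \<in> B"
  have "P * x * P \<in> matrix_sys \<rho> F"
  proof (rule B_mapsto[where f = "\<lambda>x. P * x * P" and C = "matrix_sys \<rho> F", OF _ _ _ _ _ x])
    show "bounded_linear (\<lambda>x. P * x * P)"
      by (rule bounded_linear_compose[OF bounded_linear_mult_left bounded_linear_mult_right])
    show sub: "csubspace (matrix_sys \<rho> F)" using opsys_matrix_sys[OF F] by (simp add: opsys_def)
    show "P * (c *\<^sub>C y) * P \<in> matrix_sys \<rho> F" if "P * y * P \<in> matrix_sys \<rho> F" for c y
      using csubspaceD(3)[OF sub that] by (simp add: scaleC_bop_mult)
    show "P * (\<pi> a * u s * E1) * P \<in> matrix_sys \<rho> F" for a s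
      unfolding compression_gen[OF F] by (rule amp_in_matrix_sys[OF F])
    show "closed (matrix_sys \<rho> F)" by (rule closed_matrix_sys[OF F])
  qed
  then show ?thesis using x by (simp add: compress_def)
qed

lemma compress_idem: "x \<in> B \<Longrightarrow> P * compress x * P = compress x"
  by (simp add: compress_def proj_idem proj_idem_assoc mult.assoc)

lemma matrix_sys_subset: "finite G \<Longrightarrow> matrix_sys \<rho> G \<subseteq> AB"
  using amp_in_AB by (auto simp: matrix_sys_eq)

lemma compress_linear:
  "x \<in> B \<Longrightarrow> y \<in> B \<Longrightarrow> compress (x + y) = compress x + compress y"
  "x \<in> B \<Longrightarrow> compress (c *\<^sub>C x) = c *\<^sub>C compress x"
  by (simp_all add: compress_def csubspaceD[OF B_csubspace] distrib_left distrib_right scaleC_bop_mult)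

lemma compress_norm: "x \<in> B \<Longrightarrow> norm (compress x) \<le> norm x"
proof -
  assume x: "x \<in> B"
  have "norm (P * x * P) \<le> norm P * norm x * norm P"
    by (intro order_trans[OF norm_mult_ineq] mult_right_mono norm_mult_ineq) simp
  also have "\<dots> \<le> 1 * norm x * 1" by (intro mult_mono norm_proj) auto
  finally show ?thesis using x by (simp add: compress_def)
qed

lemma compress_ccp: "ccp B AB compress"
  unfolding ccp_def cp_def
proof (intro conjI allI impI ballI)
  show "compress \<in> B \<rightarrow>\<^sub>E AB"
    using compress_in matrix_sys_subset[OF F] by (auto simp: compress_def)
  show "clinear_on B compress" by (simp add: clinear_on_def compress_linear)
  show "norm (compress x) \<le> norm x" if "x \<in> B" for x using that by (rule compress_norm)
  fix n X assume X: "\<forall>i<n. \<forall>j<n. X i j \<in> B" and pos: "mat_pos n X"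
  show "mat_pos n (\<lambda>i j. compress (X i j))"
    unfolding mat_pos_def
  proof
    fix \<xi> :: "nat \<Rightarrow> ('h \<times> 'g tuples) ell2"
    have "cinner \<zeta> (P \<cdot> \<eta>) = cinner (P \<cdot> \<zeta>) \<eta>" for \<zeta> \<eta>
      using cinner_star[of P \<zeta> \<eta>] by (simp add: proj_star)
    then have "(\<Sum>i<n. \<Sum>j<n. cinner (\<xi> i) (compress (X i j) \<cdot> \<xi> j)) =
        (\<Sum>i<n. \<Sum>j<n. cinner (P \<cdot> \<xi> i) (X i j \<cdot> P \<cdot> \<xi> j))"
      using X by (intro sum.cong refl) (simp add: compress_def bop_apply_simps)
    also have "0 \<le> \<dots>" using spec[OF pos[unfolded mat_pos_def], of "\<lambda>i. P \<cdot> \<xi> i"] .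
    finally show "0 \<le> (\<Sum>i<n. \<Sum>j<n. cinner (\<xi> i) (compress (X i j) \<cdot> \<xi> j))" .
  qed
qed

lemma compress_module_map: "module_map (B, m) (AB, m) compress"
  by (simp add: module_map_def compress_def pi_mult_def mult.assoc proj_\<pi>)

text \<open>The factor by which averaging after compression multiplies the coefficient of s: the
  correlation of the weight with its translate by s.\<close>

definition overlap :: "'g \<Rightarrow> 'a" where
  "overlap s = (\<Sum>p\<in>F. w p * \<alpha> s (w (tshift (- s) p)))"

lemma average_compress_gen:
  "average (compress (\<pi> a * u s * E1)) = \<pi> (a * overlap s) * u s * E1"
proof -
  let ?z = "\<lambda>p. \<pi> (a * (w p * \<alpha> s (w (tshift (- s) p)))) * u s * E1"
  let ?q = "\<lambda>p. tshift (- s) p"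
  have d: "b - (- s + b) = s" for b :: 'g by (simp add: diff_eq_eq)
  have summand: "leg p * \<pi> (\<alpha> (- tbar p) a) * star (leg (?q p)) = ?z p" for p
    unfolding leg_\<pi>_leg tbar_tshift d \<alpha>_cancel w_central[of p a] by (simp only: mult.assoc)
  have inner: "(\<Sum>q\<in>F. leg p * \<pi> (if q = ?q p \<and> snd q = [] then \<alpha> (- tbar p) a else 0) * star (leg q)) = ?z p"
    for p
  \<comment> \<open>The entry of row p sits in column s^-1 p. Where the compression has no such
    entry, one of the two weights vanishes by \<open>w_support\<close>, so the formula remains
    true.\<close>
  proof (cases "?q p \<in> F \<and> snd p = []")
    case True
    have "snd (?q p) = []" using True by (simp add: tshift_def)
    then have "(\<Sum>q\<in>F. leg p * \<pi> (if q = ?q p \<and> snd q = [] then \<alpha> (- tbar p) a else 0) * star (leg q)) =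
        (\<Sum>q\<in>F. if q = ?q p then leg p * \<pi> (\<alpha> (- tbar p) a) * star (leg q) else 0)"
      by (intro sum.cong) (auto simp: \<pi>_simps)
    then show ?thesis using True F summand by simp
  next
    case False
    then have "w p = 0 \<or> w (?q p) = 0" using w_support by blast
    then have "?z p = 0" by (auto simp: star_hom_linear[OF star_hom_\<alpha>] \<pi>_simps)
    moreover have "(if q = ?q p \<and> snd q = [] then \<alpha> (- tbar p) a else 0) = 0" if "q \<in> F" for q
      using False that by (auto simp: tshift_def)
    ultimately show ?thesis by (simp add: \<pi>_simps)
  qed
  show ?thesis
    unfolding compress_gen average_amp inner overlap_def
    by (simp add: sum_distrib_left sum_distrib_right star_hom_sum[OF star_hom_\<pi>])
qed

lemma norm_average_compress_gen:
  "norm (average (compress (\<pi> a * u s * E1)) - \<pi> a * u s * E1) \<le> norm a * norm (overlap s - 1)"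
proof -
  have "average (compress (\<pi> a * u s * E1)) - \<pi> a * u s * E1 = \<pi> (a * (overlap s - 1)) * u s * E1"
    unfolding average_compress_gen right_diff_distrib mult_1_right \<pi>_simps(8) left_diff_distrib ..
  also have "norm \<dots> \<le> norm (\<pi> (a * (overlap s - 1))) * norm (u s) * norm (E1 :: ('h \<times> 'g tuples) bop)"
    by (intro order_trans[OF norm_mult_ineq] mult_right_mono norm_mult_ineq) simp
  also have "\<dots> \<le> norm (a * (overlap s - 1)) * 1 * 1"
    by (intro mult_mono star_hom_norm_le[OF star_hom_\<pi>] norm_proj norm_bop_bound)
      (auto simp: norm_U)
  finally show ?thesis using norm_mult_ineq[of a "overlap s - 1"] by simp
qed

lemma average_compress_linear:
  assumes "x \<in> B"
  shows "y \<in> B \<Longrightarrow> average (compress (x + y)) = average (compress x) + average (compress y)"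
    and "average (compress (c *\<^sub>C x)) = c *\<^sub>C average (compress x)"
    and "norm (average (compress x)) \<le> norm x"
proof -
  show "average (compress (x + y)) = average (compress x) + average (compress y)" if "y \<in> B"
    using average_linear compress_in assms that by (simp add: compress_linear clinear_on_def)
  show "average (compress (c *\<^sub>C x)) = c *\<^sub>C average (compress x)"
    using average_linear compress_in assms by (simp add: compress_linear clinear_on_def)
  have "norm (average (compress x)) \<le> norm (compress x)"
    using average_ccp compress_in[OF assms] by (simp add: ccp_def)
  then show "norm (average (compress x)) \<le> norm x"
    using compress_norm[OF assms] by linarith
qed

subsection \<open>The admissible families\<close>

lemma B_in_module_systems: "(B, m) \<in> module_systems \<alpha> \<rho>"
  using opsys_B by (simp add: module_systems_def right_moduleI B_module)

lemma gamma_action_B: "gamma_action B conj_action"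
  by (rule gamma_action_conj) (rule B_conj)

lemma translate_zero: "\<psi> \<in> extensional E \<Longrightarrow> translate 0 E \<psi> = \<psi>"
  by (auto simp: translate_def conj_action_zero fun_eq_iff extensional_def)

text \<open>P is in general moved by translations, so \<open>compress\<close> is exhibited as the
  member r = 0 in the family of its own translates, all of which have domain B.\<close>

lemma compress_admissible: "admissible_map (module_systems \<alpha> \<rho>) B conj_action m AB conj_action m compress"
  unfolding admissible_map_def
proof (intro exI conjI)
  show "admissible_family (module_systems \<alpha> \<rho>) B conj_action m AB conj_action m
      {(conj_action r ` B, translate r B compress) |r. True}"
    using compress_ccp
    by (intro admissible_translates compress_module_map opsys_B opsys_AB gamma_action_B gamma_action_AB
        right_moduleI[THEN disjI1] B_module subset_refl)
      (simp_all add: ccp_def module_systems_def)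
  have "compress = translate 0 B compress" by (simp add: translate_zero compress_def)
  moreover have "conj_action 0 ` B = B" by (simp add: conj_action_zero)
  ultimately show "(B, compress) \<in> {(conj_action r ` B, translate r B compress) |r. True}"
    by (intro CollectI exI[of _ 0]) simp
qed

abbreviation zero_map :: "'g tuples set \<Rightarrow> ('h \<times> 'g tuples) bop \<Rightarrow> ('h \<times> 'g tuples) bop" where
  "zero_map G \<equiv> \<lambda>x\<in>matrix_sys \<rho> G. 0"

definition averages :: "'g tuples set \<Rightarrow> ('h \<times> 'g tuples) bop \<Rightarrow> ('h \<times> 'g tuples) bop" where
  "averages G = (if \<exists>r. G = tshift r ` F
     then translate (THE r. G = tshift r ` F) (matrix_sys \<rho> F) average
     else (zero_map G))"

text \<open>If the translates of F by r and r' agree, then -r' + r stabilizes F and is 0 by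
  \<open>F_free\<close>; this gives the definite description in \<open>averages\<close> its
  value.\<close>

lemma averages_orbit: "averages (tshift r ` F) = translate r (matrix_sys \<rho> F) average"
proof -
  have "(THE r'. tshift r ` F = tshift r' ` F) = r"
  proof (rule the_equality)
    fix r' assume "tshift r ` F = tshift r' ` F"
    then have "tshift (- r') ` tshift r ` F = tshift (- r') ` tshift r' ` F" by simp
    then have "tshift (- r' + r) ` F = F" by (simp add: image_image tshift_add)
    then have "- r' + r = 0" by (rule F_free)
    then show "r' = r" by (metis add.inverse_inverse add_eq_0_iff)
  qed simp
  then show ?thesis by (auto simp: averages_def)
qed

lemma averages_F: "averages F = average"
  using averages_orbit[of 0] by (simp add: translate_zero average_def)

lemma zero_ccp: "ccp (matrix_sys \<rho> G) B (zero_map G)"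
proof -
  have sub: "csubspace (matrix_sys \<rho> G)" unfolding matrix_sys_def by (rule csubspace_span)
  show ?thesis
    using csubspaceD(1)[OF B_csubspace] csubspaceD(2,3)[OF sub]
    by (simp add: ccp_def cp_def clinear_on_def mat_pos_def bop_apply_simps)
qed

lemma averages_ccp:
  assumes "finite G"
  shows "ccp (matrix_sys \<rho> G) B (averages G)"
proof (cases "\<exists>r. G = tshift r ` F")
  case True
  then obtain r where G: "G = tshift r ` F" by blast
  have "csubspace (matrix_sys \<rho> F)" unfolding matrix_sys_def by (rule csubspace_span)
  then show ?thesis
    unfolding G averages_orbit conj_action_matrix_sys[OF F, symmetric]
    by (intro ccp_translate average_ccp B_conj)
next
  case False
  then show ?thesis using zero_ccp by (simp add: averages_def)
qed

text \<open>The complement of an orbit is invariant, so the finite sets in it can themselves serve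
  as indices, with G \<mapsto> rG as the action.\<close>

lemma zero_admissible:
  "admissible_family (module_systems \<alpha> \<rho>) AB conj_action m B conj_action m
    {(matrix_sys \<rho> G, zero_map G) |G. finite G \<and> (\<nexists>r. G = tshift r ` F)}"
  unfolding admissible_family_def
proof (intro conjI ballI)
  let ?I = "{G. finite G \<and> (\<nexists>r. G = tshift r ` F)}"
  have I: "tshift t ` G \<in> ?I" if "G \<in> ?I" for t G
  proof -
    have "G = tshift (- t + r) ` F" if "tshift t ` G = tshift r ` F" for r
      using arg_cong[OF that, of "\<lambda>G. tshift (- t) ` G"] by (simp add: image_image tshift_add)
    then show ?thesis using that by auto
  qed
  have "gamma_family (AB, conj_action) (B, conj_action) ?I (\<lambda>t G. tshift t ` G) (matrix_sys \<rho>)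
      (\<lambda>G. zero_map G)"
    unfolding gamma_family_def prod.case
  proof (intro conjI ballI allI)
    fix G s t assume G: "G \<in> ?I"
    then have fin: "finite G" by simp
    show "tshift 0 ` G = G" "tshift (s + t) ` G = tshift s ` tshift t ` G"
      by (simp_all add: image_image tshift_add)
    show "tshift t ` G \<in> ?I" by (rule I[OF G])
    show "opsys (matrix_sys \<rho> G)" "matrix_sys \<rho> G \<subseteq> AB"
      by (rule opsys_matrix_sys[OF fin] matrix_sys_subset[OF fin])+
    show "conj_action t ` matrix_sys \<rho> G \<subseteq> matrix_sys \<rho> (tshift t ` G)"
      by (simp add: conj_action_matrix_sys[OF fin])
    show "cp (matrix_sys \<rho> G) B (zero_map G)" using zero_ccp by (simp add: ccp_def)
    fix x assume x: "x \<in> matrix_sys \<rho> G"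
    then have "conj_action t x \<in> matrix_sys \<rho> (tshift t ` G)"
      using conj_action_matrix_sys[OF fin, of t] by blast
    then show "zero_map (tshift t ` G) (conj_action t x) = conj_action t ((zero_map G) x)"
      using x by (simp add: conj_action_def)
  qed
  from Gamma_admissible_family[OF opsys_AB gamma_action_AB opsys_B gamma_action_B this]
  show "Gamma_admissible (AB, conj_action) (B, conj_action)
      {(matrix_sys \<rho> G, zero_map G) |G. finite G \<and> (\<nexists>r. G = tshift r ` F)}"
    by (subst setcompr_eq_image)
  fix Q assume "Q \<in> {(matrix_sys \<rho> G, zero_map G) |G. finite G \<and> (\<nexists>r. G = tshift r ` F)}"
  then obtain G where Q: "Q = (matrix_sys \<rho> G, zero_map G)" and G: "finite G" by blast
  show "case Q of (E, \<psi>) \<Rightarrow> A_admissible (module_systems \<alpha> \<rho>) (E, m) (B, m) \<psi>"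
    unfolding Q prod.case
  proof (rule A_admissible.module_map)
    show "(matrix_sys \<rho> G, m) \<in> module_systems \<alpha> \<rho>"
      using opsys_matrix_sys[OF G] right_module_matrix_sys[OF G] by (simp add: module_systems_def)
    show "(B, m) \<in> module_systems \<alpha> \<rho>" by (rule B_in_module_systems)
    show "cp (matrix_sys \<rho> G) B (zero_map G)" using zero_ccp by (simp add: ccp_def)
    show "module_map (matrix_sys \<rho> G, m) (B, m) (zero_map G)"
      by (simp add: module_map_def pi_mult_def)
  qed
qed

text \<open>On the orbit of F the members are translates indexed by the group, off the orbit they
  are zero maps indexed by sets; the rule \<open>union\<close> joins the two families.\<close>

lemma averages_admissible:
  "admissible_family (module_systems \<alpha> \<rho>) AB conj_action m B conj_action m
    {(matrix_sys \<rho> G, averages G) |G. finite G}"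
proof -
  let ?O = "{(conj_action r ` matrix_sys \<rho> F, translate r (matrix_sys \<rho> F) average) |r. True}"
  let ?Z = "{(matrix_sys \<rho> G, zero_map G) |G. finite G \<and> (\<nexists>r. G = tshift r ` F)}"
  have orbit: "admissible_family (module_systems \<alpha> \<rho>) AB conj_action m B conj_action m ?O"
    using average_ccp right_module_matrix_sys[OF F]
    by (intro admissible_translates average_module_map opsys_B opsys_AB gamma_action_B gamma_action_AB
        opsys_matrix_sys F matrix_sys_subset B_in_module_systems) (simp_all add: ccp_def)
  have "{(matrix_sys \<rho> G, averages G) |G. finite G} = ?O \<union> ?Z"
  proof (intro equalityI subsetI)
    fix Q assume "Q \<in> {(matrix_sys \<rho> G, averages G) |G. finite G}"
    then obtain G where G: "finite G" and Q: "Q = (matrix_sys \<rho> G, averages G)" by blast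
    show "Q \<in> ?O \<union> ?Z"
    proof (cases "\<exists>r. G = tshift r ` F")
      case True
      then obtain r where "G = tshift r ` F" by blast
      then have "Q = (conj_action r ` matrix_sys \<rho> F, translate r (matrix_sys \<rho> F) average)"
        by (simp add: Q averages_orbit conj_action_matrix_sys[OF F])
      then show ?thesis by blast
    next
      case False
      then have "Q = (matrix_sys \<rho> G, zero_map G)" by (simp add: Q averages_def)
      then show ?thesis using False G by blast
    qed
  next
    fix Q assume "Q \<in> ?O \<union> ?Z"
    then show "Q \<in> {(matrix_sys \<rho> G, averages G) |G. finite G}"
    proof
      assume "Q \<in> ?O"
      then obtain r where "Q = (conj_action r ` matrix_sys \<rho> F, translate r (matrix_sys \<rho> F) average)" by blast
      then have "Q = (matrix_sys \<rho> (tshift r ` F), averages (tshift r ` F))"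
        by (simp add: averages_orbit conj_action_matrix_sys[OF F])
      moreover have "finite (tshift r ` F)" using F by simp
      ultimately show ?thesis by blast
    next
      assume "Q \<in> ?Z"
      then obtain G where G: "finite G" "\<nexists>r. G = tshift r ` F" "Q = (matrix_sys \<rho> G, zero_map G)"
        by blast
      then have "Q = (matrix_sys \<rho> G, averages G)" by (simp add: averages_def)
      then show ?thesis using G(1) by blast
    qed
  qed
  moreover note O = orbit[unfolded admissible_family_def] and Z = zero_admissible[unfolded admissible_family_def]
  have "Gamma_admissible (AB, conj_action) (B, conj_action) (?O \<union> ?Z)"
    by (rule Gamma_admissible.union[OF conjunct1[OF O] conjunct1[OF Z]])
  moreover have "\<forall>(E, \<psi>) \<in> ?O \<union> ?Z. A_admissible (module_systems \<alpha> \<rho>) (E, m) (B, m) \<psi>"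
    unfolding ball_Un by (rule conjI[OF conjunct2[OF O] conjunct2[OF Z]])
  ultimately show ?thesis unfolding admissible_family_def by (simp only: simp_thms)
qed

end

section \<open>Amenable actions\<close>

lemma Sum_any_eq_sum:
  "finite A \<Longrightarrow> (\<And>s. s \<notin> A \<Longrightarrow> f s = 0) \<Longrightarrow> Sum_any f = sum f A"
  by (rule Sum_any.expand_superset) auto

text \<open>When the square is expanded, both sums of squares are 1, the second being the image
  under \<open>\<alpha> t\<close> of a reindexed copy of the first; centrality merges the two mixed
  terms.\<close>

lemma (in faithful_action) amenable_sum:
  fixes T :: "'g \<Rightarrow> 'a"
  defines "K \<equiv> {s. T s \<noteq> 0}"
  assumes K: "finite K" and T_star: "\<And>s. star (T s) = T s" and T_central: "\<And>s x. T s * x = x * T s"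
    and sum: "Sum_any (\<lambda>s. (T s)\<^sup>2) = 1"
  shows "Sum_any (\<lambda>s. star (T s - \<alpha> t (T (- t + s))) * (T s - \<alpha> t (T (- t + s)))) =
    2 *\<^sub>R (1 - (\<Sum>p\<in>K. T p * \<alpha> t (T (- t + p))))"
proof -
  let ?d = "\<lambda>s. \<alpha> t (T (- t + s))"
  note hom = star_homD[OF star_hom_\<alpha>] star_hom_linear[OF star_hom_\<alpha>]
  \<comment> \<open>S contains the supports of T and of its translate by t, so all sums can be taken
    over one finite set.\<close>
  define S where "S = K \<union> (\<lambda>p. t + p) ` K"
  have S: "finite S" using K by (simp add: S_def)
  have TS: "T s = 0" "T (- t + s) = 0" if "s \<notin> S" for s
  proof -
    show "T s = 0" using that by (auto simp: S_def K_def)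
    show "T (- t + s) = 0"
    proof (rule ccontr)
      assume "T (- t + s) \<noteq> 0"
      then have "t + (- t + s) \<in> S" unfolding S_def K_def by blast
      then show False using that by simp
    qed
  qed
  have c2: "(\<Sum>s\<in>S. T s * T s) = 1"
    using Sum_any_eq_sum[OF S, of "\<lambda>s. (T s)\<^sup>2"] TS sum by (simp add: power2_eq_square)
  have "(\<Sum>s\<in>S. T (- t + s) * T (- t + s)) = (\<Sum>p\<in>(\<lambda>s. - t + s) ` S. T p * T p)"
    by (subst sum.reindex) (auto simp: inj_on_def)
  also have "\<dots> = Sum_any (\<lambda>s. (T s)\<^sup>2)"
  proof (rule trans[OF _ Sum_any_eq_sum[symmetric]])
    show "finite ((\<lambda>s. - t + s) ` S)" using S by simp
    fix p assume p: "p \<notin> (\<lambda>s. - t + s) ` S"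
    have "t + p \<notin> S"
    proof
      assume "t + p \<in> S"
      then have "- t + (t + p) \<in> (\<lambda>s. - t + s) ` S" by (rule imageI)
      then show False using p by simp
    qed
    then show "(T p)\<^sup>2 = 0" using TS(2)[of "t + p"] by simp
  qed (simp add: power2_eq_square)
  finally have "\<alpha> t (\<Sum>s\<in>S. T (- t + s) * T (- t + s)) = 1" by (simp add: sum hom)
  then have d2: "(\<Sum>s\<in>S. ?d s * ?d s) = 1"
    by (simp add: star_hom_sum[OF star_hom_\<alpha>] hom)
  have cd: "(\<Sum>s\<in>S. T s * ?d s) = (\<Sum>p\<in>K. T p * ?d p)"
    using S by (intro sum.mono_neutral_right) (auto simp: S_def K_def)
  have "Sum_any (\<lambda>s. star (T s - ?d s) * (T s - ?d s)) = (\<Sum>s\<in>S. star (T s - ?d s) * (T s - ?d s))"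
    by (rule Sum_any_eq_sum[OF S]) (simp add: TS hom)
  also have "\<dots> = (\<Sum>s\<in>S. T s * T s + ?d s * ?d s - 2 *\<^sub>R (T s * ?d s))"
  proof (rule sum.cong[OF refl])
    fix s
    have "star (?d s) = ?d s" by (simp add: T_star flip: hom(5))
    moreover have "?d s * T s = T s * ?d s" by (rule T_central[symmetric])
    ultimately show "star (T s - ?d s) * (T s - ?d s) = T s * T s + ?d s * ?d s - 2 *\<^sub>R (T s * ?d s)"
      by (simp add: star_diff T_star left_diff_distrib right_diff_distrib scaleR_2)
  qed
  also have "\<dots> = 1 + 1 - 2 *\<^sub>R (\<Sum>p\<in>K. T p * ?d p)"
    by (simp only: sum_subtractf sum.distrib c2 d2 flip: scaleR_sum_right) (simp only: cd)
  finally show ?thesis by (simp add: scaleR_diff_right scaleR_2)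
qed

lemma central_positiveD:
  "central_positive z \<Longrightarrow> star z = z" "central_positive z \<Longrightarrow> z * x = x * z"
  by (auto simp: central_positive_def star_mult star_star)

theorem theorem3p2:
  fixes \<alpha> :: "'g::group_add \<Rightarrow> 'a::cstar_algebra \<Rightarrow> 'a"
    and \<rho> :: "'a \<Rightarrow> 'h bop"
  assumes "cstar_action \<alpha>"
    and "faithful_rep \<rho>"
    and "amenable_action TYPE('i) \<alpha>"
  shows "A_Gamma_nuclear \<alpha> \<rho> (reduced_crossed_product \<alpha> \<rho>) conj_action (pi_mult \<alpha> \<rho>)"
proof -
  interpret faithful_action \<alpha> \<rho> using assms(1,2) by unfold_locales
  from assms(3) obtain \<F> :: "'i filter" and T :: "'i \<Rightarrow> 'g \<Rightarrow> 'a" where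
    \<F>: "\<F> \<noteq> bot" and T: "\<forall>i. finite {s. T i s \<noteq> 0} \<and> (\<forall>s. central_positive (T i s)) \<and>
      Sum_any (\<lambda>s. (T i s)\<^sup>2) = 1"
    and lim: "\<forall>t. ((\<lambda>i. Sum_any (\<lambda>s.
         star (T i s - \<alpha> t (T i (- t + s))) * (T i s - \<alpha> t (T i (- t + s))))) \<longlongrightarrow> 0) \<F>"
    unfolding amenable_action_def by (elim exE conjE)
  define K where "K i = {s. T i s \<noteq> 0}" for i
  have K: "finite (K i)" for i using T by (simp add: K_def)
  have T_star: "star (T i s) = T i s" and T_central: "T i s * x = x * T i s" for i s x
    using T central_positiveD by blast+
  text \<open>The pair \<open>(0, [0])\<close> makes the orbit of the finite set free.\<close>
  define F :: "'i \<Rightarrow> 'g tuples set" where "F i = insert (0, [0]) ((\<lambda>p. (p, [])) ` K i)" for i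
  define w :: "'i \<Rightarrow> 'g tuples \<Rightarrow> 'a" where "w i s = (if snd s = [] then T i (fst s) else 0)" for i s
  \<comment> \<open>The additional tuple drops out of every sum whose summand vanishes there, as
    products containing \<open>w i\<close> do.\<close>
  have F_sum: "(\<Sum>s\<in>F i. f s) = (\<Sum>p\<in>K i. f (p, []))" if "f (0, [0]) = 0" for i and f :: "'g tuples \<Rightarrow> 'a"
  proof -
    have "(\<Sum>s\<in>F i. f s) = (\<Sum>s\<in>(\<lambda>p. (p, [])) ` K i. f s)"
      unfolding F_def using K by (subst sum.insert) (auto simp: that)
    also have "\<dots> = (\<Sum>p\<in>K i. f (p, []))" by (subst sum.reindex) (auto simp: inj_on_def)
    finally show ?thesis .
  qed
  interpret W: weighted_action \<alpha> \<rho> "F i" "w i" for i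
  proof unfold_locales
    show "finite (F i)" using K by (simp add: F_def)
    show "star (w i s) = w i s" "w i s * x = x * w i s" for s x
      by (simp_all add: w_def T_star T_central)
    have "(\<Sum>s\<in>F i. w i s * w i s) = (\<Sum>p\<in>K i. (T i p)\<^sup>2)"
      by (subst F_sum) (simp_all add: w_def power2_eq_square)
    also have "\<dots> = Sum_any (\<lambda>s. (T i s)\<^sup>2)"
      by (rule Sum_any_eq_sum[OF K, symmetric]) (simp add: K_def)
    finally show "(\<Sum>s\<in>F i. w i s * w i s) = 1" using T by simp
    show "s \<in> F i \<and> snd s = []" if "w i s \<noteq> 0" for s
      using that by (cases s) (auto simp: w_def F_def K_def split: if_splits)
    show "r = 0" if "tshift r ` F i = F i" for r
    proof -
      \<comment> \<open>Shifts keep the length, and F i has only one tuple of length two, so this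
        tuple is fixed and r + 0 = 0.\<close>
      have "tshift r (0, [0]) \<in> F i" using that by (auto simp: F_def)
      then show ?thesis by (auto simp: F_def tshift_def)
    qed
  qed
  have overlap: "((\<lambda>i. norm (W.overlap i t - 1)) \<longlongrightarrow> 0) \<F>" for t
  proof -
    let ?D = "\<lambda>i. Sum_any (\<lambda>s. star (T i s - \<alpha> t (T i (- t + s))) * (T i s - \<alpha> t (T i (- t + s))))"
    have "W.overlap i t = (\<Sum>p\<in>K i. T i p * \<alpha> t (T i (- t + p)))" for i
      unfolding W.overlap_def by (subst F_sum) (simp_all add: w_def tshift_def)
    \<comment> \<open>Amenability enters here: the quantity that tends to 0 is twice the deviation
      of the overlap from 1.\<close>
    then have "?D i = 2 *\<^sub>R (1 - W.overlap i t)" for i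
      using amenable_sum[of "T i" t] K[of i] T_star T_central T by (simp add: K_def)
    then have "norm (W.overlap i t - 1) = norm (?D i) / 2" for i
      by (simp add: norm_minus_commute)
    moreover have "((\<lambda>i. norm (?D i) / 2) \<longlongrightarrow> 0) \<F>"
      using tendsto_divide[OF tendsto_norm[OF spec[OF lim, of t]] tendsto_const[of 2]] by simp
    ultimately show ?thesis by (simp only:)
  qed
  have conv: "((\<lambda>i. W.average i (W.compress i x)) \<longlongrightarrow> x) \<F>" if "x \<in> B" for x
  proof (rule B_tendsto[OF _ _ _ _ that])
    fix a :: 'a and s :: 'g
    have "((\<lambda>i. norm a * norm (W.overlap i s - 1)) \<longlongrightarrow> 0) \<F>"
      using tendsto_mult_left[OF overlap[of s], of "norm a"] by simp
    then have "((\<lambda>i. W.average i (W.compress i (\<pi> a * u s * E1)) - \<pi> a * u s * E1) \<longlongrightarrow> 0) \<F>"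
      by (rule Lim_null_comparison[rotated]) (intro always_eventually allI W.norm_average_compress_gen)
    then show "((\<lambda>i. W.average i (W.compress i (\<pi> a * u s * E1))) \<longlongrightarrow> \<pi> a * u s * E1) \<F>"
      by (rule LIM_zero_cancel)
  qed (rule W.average_compress_linear; assumption)+
  show ?thesis
    unfolding A_Gamma_nuclear_def
  proof (intro conjI allI impI)
    show "operator_module \<alpha> B conj_action m" by (rule operator_module_B)
    fix \<epsilon> :: real and S assume \<epsilon>: "0 < \<epsilon>" and S: "finite S" "S \<subseteq> B"
    \<comment> \<open>As S is finite, the eventual estimates hold at a common index, which exists
      because the filter is proper.\<close>
    have "\<forall>b\<in>S. \<forall>\<^sub>F i in \<F>. dist (W.average i (W.compress i b)) b < \<epsilon>"
      using tendstoD[OF conv \<epsilon>] S(2) by blast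
    then have "\<forall>\<^sub>F i in \<F>. \<forall>b\<in>S. dist (W.average i (W.compress i b)) b < \<epsilon>"
      using S(1) by (simp add: eventually_ball_finite)
    then obtain i where i: "\<forall>b\<in>S. dist (W.average i (W.compress i b)) b < \<epsilon>"
      using eventually_happens'[OF \<F>] by blast
    \<comment> \<open>The compression by P in the definition of nuclearity leaves
      \<open>compress\<close> unchanged, since P is idempotent.\<close>
    have approx: "norm (W.averages i (F i) (W.P i * W.compress i b * W.P i) - b) \<le> \<epsilon>" if "b \<in> S" for b
    proof -
      have "b \<in> B" using that S(2) by blast
      then show ?thesis using i that by (simp add: W.averages_F W.compress_idem dist_norm less_imp_le)
    qed
    show "\<exists>\<phi> \<psi>.
          ccp B AB \<phi> \<and>
          admissible_map (module_systems \<alpha> \<rho>) B conj_action m AB conj_action m \<phi> \<and>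
          (\<forall>F. finite F \<longrightarrow> ccp (matrix_sys \<rho> F) B (\<psi> F)) \<and>
          admissible_family (module_systems \<alpha> \<rho>) AB conj_action m B conj_action m
            {(matrix_sys \<rho> F, \<psi> F) |F. finite F} \<and>
          (\<exists>F. finite F \<and> (\<forall>b\<in>S.
             norm (\<psi> F ((1 \<otimes>\<^sub>o coord_proj F) * \<phi> b * (1 \<otimes>\<^sub>o coord_proj F)) - b) \<le> \<epsilon>))"
      by (intro exI[of _ "W.compress i"] exI[of _ "W.averages i"] exI[of _ "F i"] conjI allI impI ballI
          W.compress_ccp W.compress_admissible W.averages_ccp W.averages_admissible W.F approx)
  qed
qed

end
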